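(* Let $f$ be a function of class $\mathcal D$ having negative spectrum and suppose that the topological pressure $P(t)$ has a zero $h>\Theta_f$. Then the hyperbolic dimension of $f$ equals $h$: $\operatorname{HypDim}(f)=h$.
   Context: Notation: $\mathbb D=\{|z|<1\}$, $\mathbb D^*=\{|z|>1\}$, $\mathcal H=\{\Re\xi>0\}$, $Q_T=\{0<\Re\xi<4T,|\Im\xi|<4T\}$. Class $\mathcal D$: either an entire function $f$ with $S(f)$ (closure of critical and finite asymptotic values) contained in $\mathbb D$ and finitely many components $\Omega_1,\dots,\Omega_N$ of $f^{-1}(\mathbb D^* )$ (tracts; $f=\exp\circ\tau_j$ on $\Omega_j$ with $\tau_j:\Omega_j\to\mathcal H$ conformal), or a model function $f=e^{\tau_j}$ on a finite disjoint union $\Omega=\bigcup\Omega_j$ of unbounded simply connected domains with conformal $\tau_j:\Omega_j\to\mathcal H$ whose inverses $\varphi_j$ satisfy $|\varphi_j(\xi_n)|\to\infty$ as $|\xi_n|\to\infty$; in both cases $\overline\Omega\cap\overline{\mathbb D}=\emptyset$ and for each $j$ there is $M$ with $|\varphi_j(\xi)|\le M|\varphi_j(\xi')|$ for $\xi,\xi'\in Q_T\setminus Q_{T/8}$, $T$ large. Spectrum: $\varphi_{j,T}(\xi)=\varphi_j(T\xi)/|\varphi_j(T)|$, $\beta_h(r,t)=\log\int_I|h'(r+iy)|^tdy/\log(1/r)$ with $I=[-2,-1]\cup[1,2]$, $\beta_{\infty,j}(t)=\limsup_{T\to\infty}\beta_{\varphi_{j,T}}(1/T,t)$, $b_{\infty,j}(t)=\beta_{\infty,j}(t)-t+1$,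 $\Theta_f=\max_j$(smallest positive zero of $b_{\infty,j}$), $b_\infty=\max_j b_{\infty,j}$; negative spectrum: $b_\infty(t)<0$ for $t>\Theta_f$. Pressure: $|f'(z)|_1=|f'(z)||z|/|f(z)|$, $\mathcal L_tg(w)=\sum_{z\in f^{-1}(w)}|f'(z)|_1^{-t}g(z)$, and for $t>\Theta_f$, $P(t)=\lim_{n\to\infty}\frac1n\log\mathcal L_t^n\mathbb 1(w)$, $w\in\mathcal J_f$ (this limit exists and is independent of $w$). Julia set: usual one for entire $f$; for a model $\mathcal J_f=\{z\in\mathbb D^*:f^n(z)\in\mathbb D^*\ \forall n\}$. $\operatorname{HypDim}(f)$ is the Hausdorff dimension of $\{z\in\mathcal J_f:\liminf_n|f^n(z)|<\infty\}$. *)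

theory Defs
  imports "HOL-Complex_Analysis.Complex_Analysis"
begin

definition outer_disc :: "complex set" where
  "outer_disc = {z. norm z > 1}"

definition right_half_plane :: "complex set" where
  "right_half_plane = {\<xi>. Re \<xi> > 0}"

definition Qsq :: "real \<Rightarrow> complex set" where
  "Qsq T = {\<xi>. 0 < Re \<xi> \<and> Re \<xi> < 4 * T \<and> \<bar>Im \<xi>\<bar> < 4 * T}"

definition conformal_onto_H :: "(complex \<Rightarrow> complex) \<Rightarrow> complex set \<Rightarrow> bool" where
  "conformal_onto_H \<tau> U \<longleftrightarrow> \<tau> holomorphic_on U \<and> bij_betw \<tau> U right_half_plane"

definition phi :: "(nat \<Rightarrow> complex set) \<Rightarrow> (nat \<Rightarrow> complex \<Rightarrow> complex) \<Rightarrow> nat \<Rightarrow> complex \<Rightarrow> complex" where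
  "phi \<Omega> \<tau> j = inv_into (\<Omega> j) (\<tau> j)"

definition bounded_distortion :: "(complex \<Rightarrow> complex) \<Rightarrow> bool" where
  "bounded_distortion \<phi> \<longleftrightarrow>
     (\<exists>M T0. \<forall>T\<ge>T0. \<forall>\<xi>\<in>Qsq T - Qsq (T / 8). \<forall>\<xi>'\<in>Qsq T - Qsq (T / 8).
        norm (\<phi> \<xi>) \<le> M * norm (\<phi> \<xi>'))"

definition critical_values :: "(complex \<Rightarrow> complex) \<Rightarrow> complex set" where
  "critical_values f = {f z | z. deriv f z = 0}"

definition asymptotic_values :: "(complex \<Rightarrow> complex) \<Rightarrow> complex set" where
  "asymptotic_values f = {a. \<exists>\<gamma> :: real \<Rightarrow> complex.
      continuous_on {0..} \<gamma> \<and> filterlim \<gamma> at_infinity at_top \<and> ((f \<circ> \<gamma>) \<longlongrightarrow> a) at_top}"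

definition singular_set :: "(complex \<Rightarrow> complex) \<Rightarrow> complex set" where
  "singular_set f = closure (critical_values f \<union> asymptotic_values f)"

definition entire_classD ::
  "(complex \<Rightarrow> complex) \<Rightarrow> nat \<Rightarrow> (nat \<Rightarrow> complex set) \<Rightarrow> (nat \<Rightarrow> complex \<Rightarrow> complex) \<Rightarrow> bool" where
  "entire_classD f N \<Omega> \<tau> \<longleftrightarrow>
     N \<ge> 1 \<and> f holomorphic_on UNIV \<and> singular_set f \<subseteq> ball 0 1 \<and>
     inj_on \<Omega> {..<N} \<and> components (f -` outer_disc) = \<Omega> ` {..<N} \<and>
     (\<forall>j<N. conformal_onto_H (\<tau> j) (\<Omega> j) \<and> (\<forall>z\<in>\<Omega> j. f z = exp (\<tau> j z))) \<and>
     closure (\<Union>j<N. \<Omega> j) \<inter> cball 0 1 = {} \<and>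
     (\<forall>j<N. bounded_distortion (phi \<Omega> \<tau> j))"

definition model_classD ::
  "(complex \<Rightarrow> complex) \<Rightarrow> nat \<Rightarrow> (nat \<Rightarrow> complex set) \<Rightarrow> (nat \<Rightarrow> complex \<Rightarrow> complex) \<Rightarrow> bool" where
  "model_classD f N \<Omega> \<tau> \<longleftrightarrow>
     N \<ge> 1 \<and>
     (\<forall>j<N. open (\<Omega> j) \<and> connected (\<Omega> j) \<and> \<Omega> j \<noteq> {} \<and> simply_connected (\<Omega> j) \<and> \<not> bounded (\<Omega> j)) \<and>
     (\<forall>i<N. \<forall>j<N. i \<noteq> j \<longrightarrow> \<Omega> i \<inter> \<Omega> j = {}) \<and>
     (\<forall>j<N. conformal_onto_H (\<tau> j) (\<Omega> j) \<and> (\<forall>z\<in>\<Omega> j. f z = exp (\<tau> j z))) \<and>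
     (\<forall>j<N. \<forall>B. \<exists>R. \<forall>\<xi>\<in>right_half_plane. norm \<xi> \<ge> R \<longrightarrow> norm (phi \<Omega> \<tau> j \<xi>) \<ge> B) \<and>
     closure (\<Union>j<N. \<Omega> j) \<inter> cball 0 1 = {} \<and>
     (\<forall>j<N. bounded_distortion (phi \<Omega> \<tau> j))"

definition classD ::
  "bool \<Rightarrow> (complex \<Rightarrow> complex) \<Rightarrow> nat \<Rightarrow> (nat \<Rightarrow> complex set) \<Rightarrow> (nat \<Rightarrow> complex \<Rightarrow> complex) \<Rightarrow> bool" where
  "classD model f N \<Omega> \<tau> \<longleftrightarrow> (if model then model_classD f N \<Omega> \<tau> else entire_classD f N \<Omega> \<tau>)"

definition normal_family :: "complex set \<Rightarrow> (nat \<Rightarrow> complex \<Rightarrow> complex) \<Rightarrow> bool" where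
  "normal_family U F \<longleftrightarrow>
     (\<forall>r::nat \<Rightarrow> nat. strict_mono r \<longrightarrow> (\<exists>s::nat \<Rightarrow> nat. strict_mono s \<and>
        ((\<exists>g. \<forall>K. compact K \<and> K \<subseteq> U \<longrightarrow> uniform_limit K (\<lambda>n. F (r (s n))) g sequentially) \<or>
         (\<forall>K. compact K \<and> K \<subseteq> U \<longrightarrow>
            (\<forall>B. eventually (\<lambda>n. \<forall>z\<in>K. B \<le> norm (F (r (s n)) z)) sequentially)))))"

definition fatou_set :: "(complex \<Rightarrow> complex) \<Rightarrow> complex set" where
  "fatou_set f = {z. \<exists>U. open U \<and> z \<in> U \<and> normal_family U (\<lambda>n. f ^^ n)}"

definition julia_set_entire :: "(complex \<Rightarrow> complex) \<Rightarrow> complex set" where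
  "julia_set_entire f = - fatou_set f"

text \<open>For a model, J_f = points whose whole orbit is defined and stays in the outer disc;
  since f is defined on Omega only (and Omega lies in the outer disc, f(Omega) too),
  this is the set of points all of whose iterates lie in Omega.\<close>
definition julia_set_model :: "(complex \<Rightarrow> complex) \<Rightarrow> complex set \<Rightarrow> complex set" where
  "julia_set_model f \<Omega>all = {z. \<forall>n. (f ^^ n) z \<in> \<Omega>all}"

definition julia_set :: "bool \<Rightarrow> (complex \<Rightarrow> complex) \<Rightarrow> nat \<Rightarrow> (nat \<Rightarrow> complex set) \<Rightarrow> complex set" where
  "julia_set model f N \<Omega> =
     (if model then julia_set_model f (\<Union>j<N. \<Omega> j) else julia_set_entire f)"

definition Iset :: "real set" where
  "Iset = {-2..-1} \<union> {1..2}"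

definition phiT :: "(nat \<Rightarrow> complex set) \<Rightarrow> (nat \<Rightarrow> complex \<Rightarrow> complex) \<Rightarrow> nat \<Rightarrow> real \<Rightarrow> complex \<Rightarrow> complex" where
  "phiT \<Omega> \<tau> j T \<xi> = phi \<Omega> \<tau> j (of_real T * \<xi>) / of_real (norm (phi \<Omega> \<tau> j (of_real T)))"

definition beta :: "(complex \<Rightarrow> complex) \<Rightarrow> real \<Rightarrow> real \<Rightarrow> real" where
  "beta h r t = ln (integral Iset (\<lambda>y. norm (deriv h (Complex r y)) powr t)) / ln (1 / r)"

definition beta_inf :: "(nat \<Rightarrow> complex set) \<Rightarrow> (nat \<Rightarrow> complex \<Rightarrow> complex) \<Rightarrow> nat \<Rightarrow> real \<Rightarrow> ereal" where
  "beta_inf \<Omega> \<tau> j t = Limsup at_top (\<lambda>T::real. ereal (beta (phiT \<Omega> \<tau> j T) (1 / T) t))"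

definition b_inf :: "(nat \<Rightarrow> complex set) \<Rightarrow> (nat \<Rightarrow> complex \<Rightarrow> complex) \<Rightarrow> nat \<Rightarrow> real \<Rightarrow> ereal" where
  "b_inf \<Omega> \<tau> j t = beta_inf \<Omega> \<tau> j t - ereal t + 1"

definition is_smallest_pos_zero :: "(real \<Rightarrow> ereal) \<Rightarrow> real \<Rightarrow> bool" where
  "is_smallest_pos_zero b t \<longleftrightarrow> t > 0 \<and> b t = 0 \<and> (\<forall>s. 0 < s \<and> s < t \<longrightarrow> b s \<noteq> 0)"

definition smallest_pos_zero :: "(real \<Rightarrow> ereal) \<Rightarrow> real" where
  "smallest_pos_zero b = (THE t. is_smallest_pos_zero b t)"

definition Theta :: "nat \<Rightarrow> (nat \<Rightarrow> complex set) \<Rightarrow> (nat \<Rightarrow> complex \<Rightarrow> complex) \<Rightarrow> real" where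
  "Theta N \<Omega> \<tau> = Max ((\<lambda>j. smallest_pos_zero (b_inf \<Omega> \<tau> j)) ` {..<N})"

text \<open>Negative spectrum: Theta_f is well defined (each b_(inf,j) has a smallest positive zero)
  and b_inf(t) = max_j b_(inf,j)(t) < 0 for all t > Theta_f.\<close>
definition negative_spectrum :: "nat \<Rightarrow> (nat \<Rightarrow> complex set) \<Rightarrow> (nat \<Rightarrow> complex \<Rightarrow> complex) \<Rightarrow> bool" where
  "negative_spectrum N \<Omega> \<tau> \<longleftrightarrow>
     (\<forall>j<N. \<exists>t. is_smallest_pos_zero (b_inf \<Omega> \<tau> j) t) \<and>
     (\<forall>t>Theta N \<Omega> \<tau>. Max ((\<lambda>j. b_inf \<Omega> \<tau> j t) ` {..<N}) < 0)"

definition domain_of :: "bool \<Rightarrow> nat \<Rightarrow> (nat \<Rightarrow> complex set) \<Rightarrow> complex set" where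
  "domain_of model N \<Omega> = (if model then (\<Union>j<N. \<Omega> j) else UNIV)"

definition cyl_deriv :: "(complex \<Rightarrow> complex) \<Rightarrow> complex \<Rightarrow> real" where
  "cyl_deriv f z = norm (deriv f z) * norm z / norm (f z)"

definition transfer_op ::
  "(complex \<Rightarrow> complex) \<Rightarrow> complex set \<Rightarrow> real \<Rightarrow> (complex \<Rightarrow> ennreal) \<Rightarrow> complex \<Rightarrow> ennreal" where
  "transfer_op f Dom t g w =
     infsum (\<lambda>z. ennreal (cyl_deriv f z powr (- t)) * g z) {z \<in> Dom. f z = w}"

definition pressure_zero_at ::
  "(complex \<Rightarrow> complex) \<Rightarrow> complex set \<Rightarrow> real \<Rightarrow> complex \<Rightarrow> bool" where
  "pressure_zero_at f Dom t w \<longleftrightarrow>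
     (\<forall>n. 0 < (transfer_op f Dom t ^^ n) (\<lambda>_. 1) w \<and> (transfer_op f Dom t ^^ n) (\<lambda>_. 1) w < \<infinity>) \<and>
     (\<lambda>n. ln (enn2real ((transfer_op f Dom t ^^ n) (\<lambda>_. 1) w)) / real n) \<longlonglongrightarrow> 0"

definition hausdorff_content :: "real \<Rightarrow> real \<Rightarrow> complex set \<Rightarrow> ennreal" where
  "hausdorff_content \<delta> s A =
     (INF U \<in> {U :: nat \<Rightarrow> complex set. A \<subseteq> (\<Union>i. U i) \<and> (\<forall>i. bounded (U i) \<and> diameter (U i) \<le> \<delta>)}.
        (\<Sum>i. ennreal (diameter (U i) powr s)))"

definition hausdorff_measure :: "real \<Rightarrow> complex set \<Rightarrow> ennreal" where
  "hausdorff_measure s A = (SUP \<delta> \<in> {0<..}. hausdorff_content \<delta> s A)"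

definition hausdorff_dim :: "complex set \<Rightarrow> real" where
  "hausdorff_dim A = Inf {s. s \<ge> 0 \<and> hausdorff_measure s A = 0}"

definition hyp_dim :: "bool \<Rightarrow> (complex \<Rightarrow> complex) \<Rightarrow> nat \<Rightarrow> (nat \<Rightarrow> complex set) \<Rightarrow> real" where
  "hyp_dim model f N \<Omega> =
     hausdorff_dim {z \<in> julia_set model f N \<Omega>. liminf (\<lambda>n. ereal (norm ((f ^^ n) z))) < \<infinity>}"

end

theory Submission
  imports Defs
begin

text \<open>
  In logarithmic coordinates the inverse branches of \<open>f\<close> form an infinite conformal iterated function
  system \<open>G i\<close> on the right half-plane, the sum over words of length \<open>n\<close> of \<open>norm (deriv (Gw w) z) powr t\<close>
  is \<open>\<L>\<^sub>t\<^sup>n 1\<close>, and by Schwarz-Pick and Bloch the derivatives \<open>deriv (Gw w)\<close> decrease exponentially in the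
  length of \<open>w\<close>. Hence \<open>P(h) = 0\<close> makes these sums exponentially small for exponents above \<open>h\<close>, and with
  bounded distortion this gives covers that prove \<open>HypDim f \<le> h\<close>. For exponents below \<open>h\<close> the sums are
  exponentially large; negative spectrum at some \<open>t\<close> in \<open>(\<Theta>, h)\<close> and a Phragmen-Lindelof argument make
  \<open>\<L>\<^sub>h 1\<close> small near infinity, so this mass does not escape to infinity. The branches that stay in a
  bounded region can be continued by a fixed return word into a small disc, which leaves a finite
  iterated function system with bounded orbits, and Moran's argument bounds the dimension of its limit
  set from below.
\<close>

section \<open>Distortion of univalent functions\<close>

text \<open>The pressure is known at one exponent and over one base point only, and merely as a
  subexponential rate. Other exponents are reached by a trade: \<open>norm (deriv (Gw w) z)\<close>
  is at most a constant times \<open>\<kappa> ^ n\<close> for every word of length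
  \<open>Suc n\<close>, so a change of exponent gains a fixed exponential factor on all terms at
  once, and half of that gain absorbs the unknown rate. One distortion constant serves all words,
  because each \<open>Gw w\<close> is univalent on the whole half-plane and the compared points have
  real part bounded below and bounded mutual distance; this is what the gap \<delta> between the
  tracts and the closed unit disc provides. The constants are crude: the recurring 48 comes from
  Bloch's theorem. The obstacle to the lower bound is that a large sum over infinitely many branches
  does not by itself give a compact invariant set: it has to be carried by finitely many words with
  bounded endpoints, all made to return to the same disc. No conformal measure is constructed;
  Hausdorff measure is estimated directly from covers.\<close>

lemma Cauchy_deriv_bound:
  assumes "f holomorphic_on S" "open S" "cball a r \<subseteq> S" "r > 0"
    and "\<And>z. z \<in> cball a r \<Longrightarrow> norm (f z - c) \<le> B"
  shows "norm (deriv f a) \<le> B / r"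
proof -
  have hol: "(\<lambda>z. f z - c) holomorphic_on S" using assms(1) by (intro holomorphic_intros)
  have "norm ((deriv ^^ 1) (\<lambda>z. f z - c) a) \<le> fact 1 * B / r ^ 1"
  proof (rule Cauchy_inequality)
    show "(\<lambda>z. f z - c) holomorphic_on ball a r"
      using hol assms(3) ball_subset_cball holomorphic_on_subset by blast
    show "continuous_on (cball a r) (\<lambda>z. f z - c)"
      using hol assms(3) holomorphic_on_imp_continuous_on holomorphic_on_subset by blast
    show "norm (f x - c) \<le> B" if "norm (a - x) = r" for x
      using assms(5)[of x] that by (simp add: dist_norm)
  qed (use assms in auto)
  moreover have "deriv (\<lambda>z. f z - c) a = deriv f a"
  proof -
    have "f field_differentiable at a"
      using assms(1,2,3,4) by (meson centre_in_cball holomorphic_on_imp_differentiable_at less_imp_le subsetD)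
    then show ?thesis
      by (intro DERIV_imp_deriv) (auto intro!: derivative_eq_intros dest: field_differentiable_derivI)
  qed
  ultimately show ?thesis by simp
qed

text \<open>By Bloch's theorem the image contains a disc of radius proportional to \<open>r * norm (deriv f a)\<close>,
  but a disc of radius greater than \<open>pi\<close> contains two points that differ by \<open>2 * pi * \<i>\<close>.\<close>
lemma deriv_bound_of_exp_inj:
  assumes hol: "f holomorphic_on ball a r" and r: "r > 0"
    and inj: "inj_on (\<lambda>z. exp (f z)) (ball a r)"
  shows "r * norm (deriv f a) \<le> 48"
proof (rule ccontr)
  assume "\<not> ?thesis"
  \<comment> \<open>48 = 12 * 4: Bloch's theorem yields a disc of radius
    \<open>r * norm (deriv f a) / 12\<close>, and radius 4 > pi has room for both
    \<open>b - \<i> * pi\<close> and \<open>b + \<i> * pi\<close>.\<close>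
  then have "4 \<le> r * norm (deriv f a) / 12" by simp
  then obtain b where b: "ball b 4 \<subseteq> f ` ball a r" using Bloch[OF hol r] by blast
  have "pi < 4" by (rule pi_less_4)
  then have "b - \<i> * pi \<in> ball b 4" "b + \<i> * pi \<in> ball b 4"
    by (auto simp: dist_norm norm_mult)
  then have "b - \<i> * pi \<in> f ` ball a r" "b + \<i> * pi \<in> f ` ball a r" using b by blast+
  then obtain u v where uv: "u \<in> ball a r" "v \<in> ball a r" "f u = b - \<i> * pi" "f v = b + \<i> * pi"
    by (elim imageE) metis
  have "f v = f u + 2 * of_real pi * \<i>" unfolding uv by simp
  then have "exp (f v) = exp (f u + 2 * of_real pi * \<i>)" by simp
  also have "\<dots> = exp (f u)" by (simp add: exp_add)
  finally have "v = u" using inj uv(1,2) unfolding inj_on_def by blast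
  then have "\<i> * pi = 0" using uv by simp
  then show False by simp
qed

text \<open>The exponential of this logarithm is injective because \<open>g\<close> is, so
  \<open>deriv_bound_of_exp_inj\<close> applies at each \<open>z\<close>, on the largest disc about
  \<open>z\<close> inside \<open>ball a r\<close>.\<close>

lemma deriv_log_of_inj:
  assumes hol: "g holomorphic_on ball a r" and r: "r > 0"
    and inj: "inj_on g (ball a r)" and p: "p \<notin> g ` ball a r"
  shows "\<exists>f. f holomorphic_on ball a r \<and> (\<forall>z\<in>ball a r. g z - p = exp (f z)) \<and>
    (\<forall>z\<in>ball a r. (r - dist a z) * norm (deriv f z) \<le> 48)"
proof -
  have "(\<lambda>z. g z - p) holomorphic_on ball a r" using hol by (intro holomorphic_intros)
  moreover have "\<forall>z\<in>ball a r. g z - p \<noteq> 0" using p by auto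
  ultimately obtain f where f: "f holomorphic_on ball a r"
      "\<And>z. z \<in> ball a r \<Longrightarrow> g z - p = exp (f z)"
    using holomorphic_logarithm_exists[of "ball a r" "\<lambda>z. g z - p" a] r
    by (metis centre_in_ball convex_ball open_ball)
  have "(r - dist a z) * norm (deriv f z) \<le> 48" if z: "z \<in> ball a r" for z
  proof (rule deriv_bound_of_exp_inj)
    have sub: "ball z (r - dist a z) \<subseteq> ball a r"
    proof
      fix x assume "x \<in> ball z (r - dist a z)"
      then show "x \<in> ball a r" using dist_triangle[of a x z] by simp
    qed
    then show "f holomorphic_on ball z (r - dist a z)" using f holomorphic_on_subset by blast
    show "r - dist a z > 0" using z by simp
    show "inj_on (\<lambda>z. exp (f z)) (ball z (r - dist a z))"
      using inj f(2) sub unfolding inj_on_def by (metis diff_add_cancel subsetD)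
  qed
  then show ?thesis using f by blast
qed

text \<open>If the closed disc of radius \<open>s\<close> about \<open>g a\<close> lay in the image,
  the inverse of \<open>g\<close> would be defined on it with values in \<open>ball a r\<close>;
  Cauchy's estimate then bounds \<open>1 / norm (deriv g a)\<close> by \<open>r / s\<close>, against
  the choice of \<open>s\<close>.\<close>

lemma univalent_omits:
  assumes hol: "g holomorphic_on ball a r" and r: "r > 0" and inj: "inj_on g (ball a r)"
    and s: "s > r * norm (deriv g a)"
  shows "\<exists>p. p \<notin> g ` ball a r \<and> norm (p - g a) \<le> s"
proof (rule ccontr)
  assume "\<not> ?thesis"
  then have sub: "cball (g a) s \<subseteq> g ` ball a r" by (force simp: dist_norm norm_minus_commute)
  obtain u where u: "u holomorphic_on (g ` ball a r)"
      "\<And>z. z \<in> ball a r \<Longrightarrow> deriv g z * deriv u (g z) = 1" "\<And>z. z \<in> ball a r \<Longrightarrow> u (g z) = z"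
    using holomorphic_has_inverse[OF hol open_ball inj] by blast
  have s0: "s > 0" using s r by (smt (verit) mult_nonneg_nonneg norm_ge_zero)
  have "norm (deriv u (g a)) \<le> r / s"
  proof (rule Cauchy_deriv_bound[OF u(1) _ sub s0, of a])
    show "open (g ` ball a r)" by (rule open_mapping_thm3[OF hol open_ball inj])
    fix z assume "z \<in> cball (g a) s"
    then obtain x where "x \<in> ball a r" "z = g x" using sub by blast
    then show "norm (u z - a) \<le> r" using u(3) by (simp add: dist_norm norm_minus_commute)
  qed
  moreover have "norm (deriv g a) * norm (deriv u (g a)) = 1"
    using u(2)[of a] r by (metis centre_in_ball norm_mult norm_one)
  ultimately have "1 \<le> norm (deriv g a) * (r / s)"
    by (metis mult_left_mono norm_ge_zero)
  then have "s \<le> r * norm (deriv g a)" using s0 by (simp add: field_simps)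
  then show False using s by simp
qed

lemma inj_deriv_nonzero:
  assumes "g holomorphic_on S" "open S" "inj_on g S" "z \<in> S"
  shows "deriv g z \<noteq> 0"
  using assms holomorphic_injective_imp_regular by blast

text \<open>\<open>g\<close> omits a point \<open>p\<close> near \<open>g a\<close>, so \<open>g - p\<close> has a univalent logarithm, whose
  derivative is bounded: this bounds the growth of \<open>g\<close>.\<close>
lemma univalent_growth:
  assumes hol: "g holomorphic_on ball a r" and r: "r > 0" and inj: "inj_on g (ball a r)"
    and z: "z \<in> cball a (r/2)"
  shows "norm (g z - g a) \<le> 2 * (exp 48 + 1) * r * norm (deriv g a)"
proof -
  have nz: "deriv g a \<noteq> 0" using inj_deriv_nonzero[OF hol open_ball inj] r by simp
  then have "2 * r * norm (deriv g a) > r * norm (deriv g a)" using r by simp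
  then obtain p where p: "p \<notin> g ` ball a r" "norm (p - g a) \<le> 2 * r * norm (deriv g a)"
    using univalent_omits[OF hol r inj] by blast
  obtain f where f: "f holomorphic_on ball a r" "\<forall>z\<in>ball a r. g z - p = exp (f z)"
     "\<forall>z\<in>ball a r. (r - dist a z) * norm (deriv f z) \<le> 48"
    using deriv_log_of_inj[OF hol r inj p(1)] by blast
  have sub: "cball a (r/2) \<subseteq> ball a r" using r by auto
  have "norm (f z - f a) \<le> (96 / r) * norm (z - a)"
  proof (rule field_differentiable_bound[of "cball a (r/2)" f "deriv f"])
    fix x assume x: "x \<in> cball a (r/2)"
    then have xb: "x \<in> ball a r" using sub by blast
    then show "(f has_field_derivative deriv f x) (at x within cball a (r / 2))"
      using f(1) holomorphic_derivI open_ball has_field_derivative_at_within by blast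
    have "(r/2) * norm (deriv f x) \<le> (r - dist a x) * norm (deriv f x)"
      using x by (intro mult_right_mono) auto
    also have "\<dots> \<le> 48" using f(3) xb by blast
    finally show "norm (deriv f x) \<le> 96 / r" using r by (simp add: field_simps)
  qed (use z r in auto)
  also have "\<dots> \<le> (96 / r) * (r/2)"
    using z r by (intro mult_left_mono) (auto simp: dist_norm norm_minus_commute)
  also have "\<dots> = 48" using r by simp
  finally have "norm (exp (f z - f a)) \<le> exp 48"
    using complex_Re_le_cmod[of "f z - f a"] unfolding norm_exp_eq_Re exp_le_cancel_iff by linarith
  moreover have "g z - p = (g a - p) * exp (f z - f a)"
  proof -
    have "g z - p = exp (f z)" "g a - p = exp (f a)" using f(2) sub z r by auto
    then show ?thesis by (simp add: exp_diff)
  qed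
  ultimately have "norm (g z - p) \<le> norm (g a - p) * exp 48"
    by (simp add: norm_mult mult_left_mono)
  also have "\<dots> \<le> (2 * r * norm (deriv g a)) * exp 48"
    using p(2) by (intro mult_right_mono) (auto simp: norm_minus_commute)
  finally have "norm (g z - p) \<le> (2 * r * norm (deriv g a)) * exp 48" .
  moreover have "norm (g z - g a) \<le> norm (g z - p) + norm (p - g a)"
    using norm_triangle_ineq[of "g z - p" "p - g a"] by simp
  ultimately show ?thesis using p(2) by (simp add: algebra_simps)
qed

text \<open>The growth bound \<open>2 * (exp 48 + 1) * r\<close> divided by the radius
  \<open>r/4\<close> on which Cauchy's estimate is applied.\<close>

definition Kdist :: real where "Kdist = 8 * (exp 48 + 1)"

lemma Kdist_ge_1: "Kdist \<ge> 1"
proof -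
  have "exp (48::real) > 0" by simp
  then show ?thesis unfolding Kdist_def by (simp only: distrib_left)
qed

lemma univalent_distortion:
  assumes hol: "g holomorphic_on ball a r" and r: "r > 0" and inj: "inj_on g (ball a r)"
    and b: "b \<in> cball a (r/4)"
  shows "norm (deriv g b) \<le> Kdist * norm (deriv g a)"
proof -
  have tri: "cball b (r/4) \<subseteq> cball a (r/2)"
  proof
    fix x assume "x \<in> cball b (r/4)"
    then show "x \<in> cball a (r/2)" using b dist_triangle[of a x b] by simp
  qed
  have "cball a (r/2) \<subseteq> ball a r" using r by auto
  with tri have sub: "cball b (r/4) \<subseteq> ball a r" by (rule order_trans)
  have "norm (deriv g b) \<le> (2 * (exp 48 + 1) * r * norm (deriv g a)) / (r/4)"
    using tri r univalent_growth[OF hol r inj]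
    by (intro Cauchy_deriv_bound[OF hol open_ball sub, of "g a"]) auto
  also have "\<dots> = Kdist * norm (deriv g a)" using r by (simp add: Kdist_def)
  finally show ?thesis .
qed

section \<open>Distortion on half-planes\<close>

definition HP :: "real \<Rightarrow> complex set" where "HP d = {z. Re z > d}"

lemma HP_iff [simp]: "z \<in> HP d \<longleftrightarrow> Re z > d" by (simp add: HP_def)

lemma open_HP [simp]: "open (HP d)" unfolding HP_def by (rule open_halfspace_Re_gt)

lemma convex_HP [simp]: "convex (HP d)" unfolding HP_def by (rule convex_halfspace_Re_gt)

lemma HP_0: "right_half_plane = HP 0" by (simp add: HP_def right_half_plane_def)

lemma ball_subset_HP: "ball a (Re a) \<subseteq> HP 0"
proof
  fix z assume "z \<in> ball a (Re a)"
  then have "\<bar>Re (a - z)\<bar> < Re a" by (metis abs_Re_le_cmod dist_norm le_less_trans mem_ball)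
  then show "z \<in> HP 0" by auto
qed

text \<open>Chaining the local distortion bound along the segment from \<open>a\<close> to \<open>b\<close>.\<close>
lemma univalent_distortion_HP_aux:
  assumes "g holomorphic_on HP 0" "inj_on g (HP 0)" "d > 0"
    and "Re a \<ge> d" "Re b \<ge> d" "dist a b \<le> real n * (d/4)"
  shows "norm (deriv g b) \<le> Kdist ^ n * norm (deriv g a)"
  using assms(4-6)
proof (induction n arbitrary: b)
  case 0
  then show ?case by simp
next
  case (Suc n)
  define t where "t = real n / real (Suc n)"
  have t: "0 \<le> t" "t \<le> 1" "1 - t = 1 / real (Suc n)" by (auto simp: t_def field_simps)
  define c where "c = (1 - t) *\<^sub>R a + t *\<^sub>R b"
  have "Re c = (1 - t) * Re a + t * Re b" by (simp add: c_def)
  also have "\<dots> \<ge> (1 - t) * d + t * d"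
    using t Suc.prems(1,2) by (intro add_mono mult_left_mono) auto
  finally have Rec: "Re c \<ge> d" by (simp add: algebra_simps)
  have "a - c = t *\<^sub>R (a - b)" by (simp add: c_def algebra_simps)
  then have "dist a c = t * dist a b" using t by (simp add: dist_norm)
  also have "\<dots> \<le> t * (real (Suc n) * (d/4))" using Suc.prems(3) t by (intro mult_left_mono) auto
  also have "\<dots> = real n * (d/4)" by (simp add: t_def)
  finally have ac: "dist a c \<le> real n * (d/4)" .
  have "c - b = (1 - t) *\<^sub>R (a - b)" by (simp add: c_def algebra_simps)
  then have "dist c b = (1 - t) * dist a b" using t by (simp add: dist_norm)
  also have "\<dots> \<le> (1 - t) * (real (Suc n) * (d/4))" using Suc.prems(3) t by (intro mult_left_mono) auto
  also have "\<dots> = d/4" using t(3) by simp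
  finally have cb: "b \<in> cball c (d/4)" by simp
  have sub: "ball c d \<subseteq> HP 0" using ball_subset_HP[of c] Rec subset_ball[OF Rec, of c] by blast
  have "norm (deriv g b) \<le> Kdist * norm (deriv g c)"
    using univalent_distortion[of g c d b] assms(1-3) cb sub
    by (meson holomorphic_on_subset inj_on_subset)
  also have "\<dots> \<le> Kdist * (Kdist ^ n * norm (deriv g a))"
    using Suc.IH[OF Suc.prems(1) Rec ac] Kdist_ge_1 by (intro mult_left_mono) auto
  finally show ?case by simp
qed

text \<open>The constant depends only on \<open>d\<close> and \<open>L\<close>. This uniformity over
  all univalent \<open>g\<close> lets a single constant serve words of every length.\<close>

lemma univalent_distortion_HP:
  assumes "d > 0"
  shows "\<exists>K\<ge>1. \<forall>g a b. g holomorphic_on HP 0 \<and> inj_on g (HP 0) \<and> Re a \<ge> d \<and> Re b \<ge> d \<and> dist a b \<le> L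
    \<longrightarrow> norm (deriv g b) \<le> K * norm (deriv g a)"
proof -
  obtain n :: nat where "L / (d/4) \<le> real n" using real_arch_simple by blast
  then have n: "L \<le> real n * (d/4)" using assms by (simp add: field_simps)
  have "Kdist ^ n \<ge> 1" using Kdist_ge_1 by (simp add: one_le_power)
  then show ?thesis
  proof (intro exI[of _ "Kdist ^ n"] conjI allI impI)
    fix g a b
    assume *: "g holomorphic_on HP 0 \<and> inj_on g (HP 0) \<and> Re a \<ge> d \<and> Re b \<ge> d \<and> dist a b \<le> L"
    then have "dist a b \<le> real n * (d/4)" using n by linarith
    then show "norm (deriv g b) \<le> Kdist ^ n * norm (deriv g a)"
      using univalent_distortion_HP_aux[of g d a b n] * assms by blast
  qed
qed

section \<open>Holomorphic maps between half-planes\<close>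

text \<open>Schwarz lemma, transported to the half-planes \<open>HP 0\<close> and \<open>HP d\<close> by Moebius maps.\<close>
lemma Schwarz_Pick_HP:
  assumes hol: "G holomorphic_on HP 0" and img: "G ` HP 0 \<subseteq> HP d" and a: "Re a > 0"
  shows "Re a * norm (deriv G a) \<le> Re (G a) - d"
proof -
  \<comment> \<open>\<open>m\<close> is the Moebius map of the unit disc onto the right half-plane
    with \<open>m 0 = a\<close>; its derivative at 0 is \<open>2 * Re a\<close>.\<close>
  define m where "m z = (a + cnj a * z) / (1 - z)" for z :: complex
  define b where "b = G a - of_real d"
  have imgD: "Re (G z) > d" if "Re z > 0" for z
    using image_subset_iff[THEN iffD1, OF img] that HP_iff by blast
  have b0: "Re b > 0" using imgD[OF a] by (simp add: b_def)
  have mH: "Re (m z) > 0" if z: "norm z < 1" for z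
  proof -
    have ne: "1 - z \<noteq> 0" using z by auto
    have "Re (m z) = Re ((a + cnj a * z) * cnj (1 - z)) / (norm (1 - z))\<^sup>2"
      unfolding m_def complex_div_cnj[of "a + cnj a * z" "1 - z"] by (rule Re_divide_of_real)
    also have "Re ((a + cnj a * z) * cnj (1 - z)) = Re a * (1 - (norm z)\<^sup>2)"
      unfolding cmod_power2 by (simp add: algebra_simps power2_eq_square)
    also have "\<dots> / (norm (1 - z))\<^sup>2 > 0"
      using a ne z by (intro divide_pos_pos mult_pos_pos) (auto simp: power_less_one_iff abs_square_less_1)
    finally show ?thesis .
  qed
  have m0: "m 0 = a" by (simp add: m_def)
  \<comment> \<open>\<open>P\<close> is the Cayley map of \<open>HP d\<close> into the unit disc
    that sends \<open>G a\<close> to 0; its derivative there is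
    \<open>1 / (2 * Re b)\<close>.\<close>
  define P where "P w = (w - of_real d - b) / (w - of_real d + cnj b)" for w
  have Pden: "w - of_real d + cnj b \<noteq> 0" if "Re w > d" for w
  proof -
    have "Re (w - of_real d + cnj b) > 0" using that b0 by simp
    then show ?thesis by (metis less_irrefl zero_complex.simps(1))
  qed
  define F where "F z = P (G (m z))" for z
  have Fhol: "F holomorphic_on ball 0 1"
  proof -
    have "m holomorphic_on ball 0 1" unfolding m_def by (intro holomorphic_intros) auto
    moreover have "m ` ball 0 1 \<subseteq> HP 0" using mH by auto
    ultimately have "G \<circ> m holomorphic_on ball 0 1"
      using holomorphic_on_compose_gen hol by blast
    moreover have "P holomorphic_on HP d"
      unfolding P_def by (intro holomorphic_intros) (use Pden in auto)
    moreover have "(G \<circ> m) ` ball 0 1 \<subseteq> HP d"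
      using mH imgD by (simp add: image_subset_iff)
    ultimately have "P \<circ> (G \<circ> m) holomorphic_on ball 0 1"
      using holomorphic_on_compose_gen by blast
    then show ?thesis by (simp add: F_def[abs_def] o_def)
  qed
  have F0: "F 0 = 0" by (simp add: F_def P_def m0 b_def)
  have F1: "norm (F z) < 1" if z: "norm z < 1" for z
  proof -
    define w where "w = G (m z) - of_real d"
    have w0: "Re w > 0" using imgD[OF mH[OF z]] by (simp add: w_def)
    have "(norm (w - b))\<^sup>2 < (norm (w + cnj b))\<^sup>2"
    proof -
      have "(norm (w + cnj b))\<^sup>2 - (norm (w - b))\<^sup>2 = 4 * (Re w * Re b)"
        unfolding cmod_power2 by (simp add: power2_eq_square algebra_simps)
      then show ?thesis using mult_pos_pos[OF w0 b0] by linarith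
    qed
    then have "norm (w - b) < norm (w + cnj b)" by (rule power_less_imp_less_base) simp
    moreover have "w + cnj b \<noteq> 0" using Pden[OF imgD[OF mH[OF z]]] by (simp add: w_def)
    ultimately show ?thesis unfolding F_def P_def w_def[symmetric] by (simp add: norm_divide divide_simps)
  qed
  have "norm (deriv F 0) \<le> 1" using Schwarz_Lemma(2)[OF Fhol F0, of 0] F1 by simp
  moreover have "deriv F 0 = deriv G a * of_real (2 * Re a) / of_real (2 * Re b)"
  proof (rule DERIV_imp_deriv)
    have dm: "(m has_field_derivative of_real (2 * Re a)) (at 0)"
      unfolding m_def by (rule derivative_eq_intros refl | simp)+ (simp add: complex_eq_iff)
    have dG: "(G has_field_derivative deriv G a) (at (m 0))"
      unfolding m0 using hol a by (intro holomorphic_derivI[OF hol]) auto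
    have gab: "G a - of_real d = b" by (simp add: b_def)
    have bb: "b + cnj b = of_real (2 * Re b)" by (simp add: complex_eq_iff)
    have bne: "b + cnj b \<noteq> 0" using b0 by (simp add: complex_eq_iff)
    have dP: "(P has_field_derivative 1 / of_real (2 * Re b)) (at (G (m 0)))"
    proof -
      have "(P has_field_derivative (1 * (G a - of_real d + cnj b) - (G a - of_real d - b) * 1)
          / ((G a - of_real d + cnj b) * (G a - of_real d + cnj b))) (at (G a))"
        unfolding P_def
      proof (rule DERIV_divide)
        show "((\<lambda>w. w - of_real d - b) has_field_derivative 1) (at (G a))"
          by (auto intro!: derivative_eq_intros)
        show "((\<lambda>w. w - of_real d + cnj b) has_field_derivative 1) (at (G a))"
          by (auto intro!: derivative_eq_intros)
        show "G a - of_real d + cnj b \<noteq> 0" using bne gab by simp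
      qed
      also have "(1 * (G a - of_real d + cnj b) - (G a - of_real d - b) * 1)
          / ((G a - of_real d + cnj b) * (G a - of_real d + cnj b)) = 1 / (b + cnj b)"
        unfolding gab using bne by simp
      finally show ?thesis unfolding m0 bb .
    qed
    have "((\<lambda>z. P (G (m z))) has_field_derivative
        (1 / of_real (2 * Re b)) * (deriv G a * of_real (2 * Re a))) (at 0)"
      by (rule DERIV_chain2[OF dP DERIV_chain2[OF dG dm]])
    then show "(F has_field_derivative deriv G a * of_real (2 * Re a) / of_real (2 * Re b)) (at 0)"
      unfolding F_def[abs_def] times_divide_eq_left by (simp only: mult_1 mult.commute)
  qed
  ultimately have "norm (deriv G a) * (2 * Re a) \<le> 2 * Re b"
    using a b0 by (simp add: norm_mult norm_divide divide_simps)
  then have "2 * (Re a * norm (deriv G a)) \<le> 2 * (Re (G a) - d)"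
    by (simp add: b_def algebra_simps)
  then show ?thesis by simp
qed

text \<open>Phragmen-Lindelof: damp \<open>f\<close> by \<open>1 + e * (z - d)\<close>, apply the maximum principle on large
  half-discs, and let \<open>e\<close> tend to 0.\<close>
lemma Phragmen_Lindelof_HP:
  assumes hol: "f holomorphic_on HP 0" and d: "d > 0"
    and bnd: "\<And>z. Re z \<ge> d \<Longrightarrow> norm (f z) \<le> A"
    and line: "\<And>z. Re z = d \<Longrightarrow> norm (f z) \<le> B"
    and z: "Re z \<ge> d"
  shows "norm (f z) \<le> B"
proof -
  have B0: "B \<ge> 0" using order_trans[OF norm_ge_zero line[of "of_real d"]] by simp
  have A0: "A \<ge> 0" using order_trans[OF norm_ge_zero bnd[of "of_real d"]] by simp
  have "norm (f z) \<le> B * norm (1 + of_real e * (z - of_real d))" if e: "e > 0" for e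
  proof -
    define p where "p w = 1 + of_real e * (w - of_real d)" for w :: complex
    have Rep: "Re (p w) \<ge> 1" if "Re w \<ge> d" for w using that e by (simp add: p_def)
    have p1: "norm (p w) \<ge> 1" if "Re w \<ge> d" for w
      using Rep[OF that] complex_Re_le_cmod order_trans by blast
    have pne: "p w \<noteq> 0" if "Re w \<ge> d" for w using p1[OF that] by auto
    have "norm (f z) \<le> (B + x) * norm (p z)" if x: "x > 0" for x
    proof -
      \<comment> \<open>The slack \<open>x\<close> is there because \<open>B\<close> may be 0. The
        radius puts \<open>z\<close> into the half-disc \<open>S\<close> and makes
        \<open>norm (p w)\<close> at least \<open>A / x\<close> on the arc, so that
        \<open>x * norm (p w)\<close> absorbs the crude bound \<open>A\<close>.\<close>
      define R where "R = max (dist (of_real d) z) ((A / x + 1) / e) + 1"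
      define S where "S = {w. Re w \<ge> d} \<inter> cball (of_real d) R"
      have clS: "closed S" unfolding S_def by (intro closed_Int closed_halfspace_Re_ge closed_cball)
      have fr: "w \<in> S \<and> (Re w = d \<or> dist (of_real d) w = R)" if w: "w \<in> frontier S" for w
      proof -
        have wS: "w \<in> S" using w clS frontier_subset_closed by blast
        have "{w. Re w > d} \<inter> ball (of_real d) R \<subseteq> interior S"
          by (rule interior_maximal) (auto simp: S_def intro!: open_Int open_halfspace_Re_gt)
        then have "w \<notin> {w. Re w > d} \<inter> ball (of_real d) R"
          using w by (auto simp: frontier_def)
        then show ?thesis using wS by (auto simp: S_def)
      qed
      have "norm (f z / p z) \<le> B + x"
      proof (rule maximum_modulus_frontier[of "\<lambda>w. f w / p w" S])
        have Ssub: "S \<subseteq> HP 0" using d by (auto simp: S_def)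
        have hfp: "f holomorphic_on S" "p holomorphic_on S"
          using hol Ssub holomorphic_on_subset unfolding p_def by (blast, intro holomorphic_intros)
        have hq: "(\<lambda>w. f w / p w) holomorphic_on S"
          using hfp pne by (intro holomorphic_on_divide) (auto simp: S_def)
        then show "(\<lambda>w. f w / p w) holomorphic_on interior S"
          using holomorphic_on_subset interior_subset by blast
        show "continuous_on (closure S) (\<lambda>w. f w / p w)"
          using hq clS by (simp add: holomorphic_on_imp_continuous_on)
        show "bounded S" unfolding S_def by (rule bounded_Int) simp
        show "z \<in> S" using z by (auto simp: S_def R_def)
        fix w assume "w \<in> frontier S"
        then have wS: "w \<in> S" and or: "Re w = d \<or> dist (of_real d) w = R" using fr by auto
        have wd: "Re w \<ge> d" using wS by (simp add: S_def)
        from or show "norm (f w / p w) \<le> B + x"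
        proof
          assume "Re w = d"
          then have "norm (f w) \<le> B" by (rule line)
          also have "B \<le> (B + x) * 1" using x by simp
          also have "\<dots> \<le> (B + x) * norm (p w)"
            using p1[OF wd] B0 x by (intro mult_left_mono) auto
          finally show ?thesis using p1[OF wd] pne[OF wd] by (simp add: norm_divide divide_simps)
        next
          assume wR: "dist (of_real d) w = R"
          have "e * R \<le> norm (p w) + 1"
          proof -
            have "e * R = norm (of_real e * (w - of_real d))"
              using wR e by (simp add: norm_mult dist_norm norm_minus_commute)
            also have "\<dots> = norm (p w - 1)" by (simp add: p_def)
            also have "\<dots> \<le> norm (p w) + 1" by (metis norm_one norm_triangle_ineq4)
            finally show ?thesis .
          qed
          moreover have "e * R \<ge> A / x + 1"
          proof -
            have "R \<ge> (A / x + 1) / e" by (simp add: R_def)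
            then show ?thesis using e by (simp add: field_simps)
          qed
          ultimately have "norm (p w) \<ge> A / x" by simp
          then have "A \<le> x * norm (p w)" using x by (simp add: field_simps)
          also have "\<dots> \<le> (B + x) * norm (p w)" using B0 by (intro mult_right_mono) auto
          finally have "norm (f w) \<le> (B + x) * norm (p w)" using bnd[OF wd] by simp
          then show ?thesis using p1[OF wd] pne[OF wd] by (simp add: norm_divide divide_simps)
        qed
      qed
      then show ?thesis using p1[OF z] pne[OF z] by (simp add: norm_divide divide_simps)
    qed
    then have "norm (f z) \<le> B * norm (p z) + x" if "x > 0" for x
    proof -
      have "x / norm (p z) > 0" using that p1[OF z] by (intro divide_pos_pos) auto
      then have "norm (f z) \<le> (B + x / norm (p z)) * norm (p z)" by fact
      also have "\<dots> = B * norm (p z) + x" using p1[OF z] by (auto simp: algebra_simps)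
      finally show ?thesis .
    qed
    then have "norm (f z) \<le> B * norm (p z)" by (rule field_le_epsilon)
    then show ?thesis by (simp add: p_def)
  qed
  then have ev: "\<forall>\<^sub>F e in at_right 0. norm (f z) \<le> B * norm (1 + of_real e * (z - of_real d))"
    by (simp add: eventually_at_right_less eventually_mono[OF eventually_at_right_less])
  have "((\<lambda>e. B * norm (1 + of_real e * (z - of_real d))) \<longlongrightarrow> B * norm (1 + of_real 0 * (z - of_real d))) (at_right 0)"
    by (intro tendsto_intros)
  then have "((\<lambda>e. B * norm (1 + of_real e * (z - of_real d))) \<longlongrightarrow> B) (at_right 0)" by simp
  then show ?thesis using tendsto_lowerbound[OF _ ev] by simp
qed

section \<open>Sums of extended nonnegative reals\<close>

lemma infsum_ennreal_SUP:
  fixes f :: "'a \<Rightarrow> ennreal"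
  shows "infsum f A = (SUP F\<in>{F. finite F \<and> F \<subseteq> A}. sum f F)"
  by (rule nonneg_infsum_complete) simp

lemma summable_on_ennreal_any:
  fixes f :: "'a \<Rightarrow> ennreal"
  shows "f summable_on A"
  by (rule nonneg_summable_on_complete) simp

lemma sum_le_infsum_ennreal:
  fixes f :: "'a \<Rightarrow> ennreal"
  assumes "finite F" "F \<subseteq> A"
  shows "sum f F \<le> infsum f A"
  unfolding infsum_ennreal_SUP using assms by (intro SUP_upper) auto

lemma infsum_le_ennreal:
  fixes f :: "'a \<Rightarrow> ennreal"
  assumes "\<And>F. finite F \<Longrightarrow> F \<subseteq> A \<Longrightarrow> sum f F \<le> c"
  shows "infsum f A \<le> c"
  unfolding infsum_ennreal_SUP using assms by (intro SUP_least) auto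

lemma infsum_mono_ennreal:
  fixes f :: "'a \<Rightarrow> ennreal"
  assumes "\<And>x. x \<in> A \<Longrightarrow> f x \<le> g x"
  shows "infsum f A \<le> infsum g A"
  using assms by (intro infsum_mono summable_on_ennreal_any) auto

lemma infsum_mono_set_ennreal:
  fixes f :: "'a \<Rightarrow> ennreal"
  assumes "A \<subseteq> B"
  shows "infsum f A \<le> infsum f B"
  by (rule infsum_le_ennreal, rule sum_le_infsum_ennreal) (use assms in blast)+

lemma infsum_nat_le_suminf_ennreal:
  fixes f :: "nat \<Rightarrow> ennreal"
  shows "infsum f UNIV \<le> suminf f"
proof (rule infsum_le_ennreal)
  fix F :: "nat set" assume "finite F"
  then show "sum f F \<le> suminf f" by (intro sum_le_suminf) simp_all
qed

lemma infsum_cmult_ennreal: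
  fixes f :: "'a \<Rightarrow> ennreal"
  shows "infsum (\<lambda>x. c * f x) A = c * infsum f A"
proof -
  have "(SUP F\<in>{F. finite F \<and> F \<subseteq> A}. c * sum f F) = c * (SUP F\<in>{F. finite F \<and> F \<subseteq> A}. sum f F)"
    by (rule SUP_mult_left_ennreal[symmetric]) 
  then show ?thesis unfolding infsum_ennreal_SUP by (simp add: sum_distrib_left)
qed

lemma infsum_Sigma_ennreal:
  fixes f :: "'a \<Rightarrow> 'b \<Rightarrow> ennreal"
  shows "infsum (\<lambda>(x, y). f x y) (Sigma A B) = infsum (\<lambda>x. infsum (f x) (B x)) A"
proof (rule antisym)
  show "infsum (\<lambda>(x, y). f x y) (Sigma A B) \<le> infsum (\<lambda>x. infsum (f x) (B x)) A"
  proof (rule infsum_le_ennreal)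
    fix F assume F: "finite F" "F \<subseteq> Sigma A B"
    define Y where "Y x = {y. (x, y) \<in> F}" for x
    have Yfin: "finite (Y x)" for x
      unfolding Y_def by (rule finite_subset[of _ "snd ` F"]) (use F in force)+
    have FS: "F = Sigma (fst ` F) Y" by (force simp: Y_def)
    have "sum (\<lambda>(x, y). f x y) F = (\<Sum>x\<in>fst ` F. \<Sum>y\<in>Y x. f x y)"
      using F Yfin by (subst FS) (simp add: sum.Sigma)
    also have "\<dots> \<le> (\<Sum>x\<in>fst ` F. infsum (f x) (B x))"
      using F Yfin by (intro sum_mono sum_le_infsum_ennreal) (auto simp: Y_def)
    also have "\<dots> \<le> infsum (\<lambda>x. infsum (f x) (B x)) A"
      using F by (intro sum_le_infsum_ennreal) auto
    finally show "sum (\<lambda>(x, y). f x y) F \<le> infsum (\<lambda>x. infsum (f x) (B x)) A" .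
  qed
  show "infsum (\<lambda>x. infsum (f x) (B x)) A \<le> infsum (\<lambda>(x, y). f x y) (Sigma A B)"
  proof (rule infsum_le_ennreal)
    fix X assume X: "finite X" "X \<subseteq> A"
    have "(\<Sum>x\<in>X. infsum (f x) (B x)) = infsum (\<lambda>(x, y). f x y) (Sigma X B)"
      using X(1)
    proof (induction X)
      case (insert x X)
      have "infsum (\<lambda>(x, y). f x y) ({x} \<times> B x) = infsum (f x) (B x)"
        by (subst infsum_reindex_bij_betw[symmetric, of "Pair x" "B x"]) (auto simp: bij_betw_def inj_on_def)
      moreover have "Sigma (insert x X) B = {x} \<times> B x \<union> Sigma X B" by auto
      moreover have "infsum (\<lambda>(x, y). f x y) ({x} \<times> B x \<union> Sigma X B) =
          infsum (\<lambda>(x, y). f x y) ({x} \<times> B x) + infsum (\<lambda>(x, y). f x y) (Sigma X B)"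
        using insert.hyps by (intro infsum_Un_disjoint summable_on_ennreal_any) auto
      ultimately show ?case using insert by simp
    qed simp
    also have "\<dots> \<le> infsum (\<lambda>(x, y). f x y) (Sigma A B)"
      using X by (intro infsum_mono_set_ennreal) auto
    finally show "(\<Sum>x\<in>X. infsum (f x) (B x)) \<le> infsum (\<lambda>(x, y). f x y) (Sigma A B)" .
  qed
qed

section \<open>Hausdorff measure\<close>

lemma hausdorff_content_le_infsum:
  fixes U :: "'i::countable \<Rightarrow> complex set"
  assumes cov: "A \<subseteq> (\<Union>i\<in>I. U i)" and U: "\<And>i. i \<in> I \<Longrightarrow> bounded (U i) \<and> diameter (U i) \<le> \<delta>"
    and "\<delta> \<ge> 0"
  shows "hausdorff_content \<delta> s A \<le> infsum (\<lambda>i. ennreal (diameter (U i) powr s)) I"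
proof -
  \<comment> \<open>Indices outside the range of \<open>to_nat\<close> on \<open>I\<close> get the
    empty set: its diameter is 0 and \<open>0 powr s\<close> is 0, so the padding is free.\<close>
  define V where "V n = (if n \<in> to_nat ` I then U (from_nat n) else {})" for n
  have "A \<subseteq> (\<Union>n. V n)"
  proof
    fix x assume "x \<in> A"
    then obtain i where "i \<in> I" "x \<in> U i" using cov by blast
    then have "x \<in> V (to_nat i)" by (simp add: V_def)
    then show "x \<in> (\<Union>n. V n)" by blast
  qed
  moreover have "bounded (V n) \<and> diameter (V n) \<le> \<delta>" for n
    using U assms(3) by (auto simp: V_def)
  ultimately have "hausdorff_content \<delta> s A \<le> (\<Sum>n. ennreal (diameter (V n) powr s))"
    unfolding hausdorff_content_def by (intro INF_lower) auto
  also have "\<dots> \<le> infsum (\<lambda>i. ennreal (diameter (U i) powr s)) I"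
  proof (rule suminf_le_const)
    fix n
    define F where "F = {i \<in> I. to_nat i < n}"
    have finF: "finite F"
    proof (rule finite_imageD)
      show "finite (to_nat ` F)" by (rule finite_subset[of _ "{..<n}"]) (auto simp: F_def)
      show "inj_on to_nat F" by (simp add: inj_on_def)
    qed
    have "(\<Sum>k<n. ennreal (diameter (V k) powr s)) = (\<Sum>k\<in>to_nat ` F. ennreal (diameter (V k) powr s))"
      by (rule sum.mono_neutral_right) (auto simp: F_def V_def)
    also have "\<dots> = (\<Sum>i\<in>F. ennreal (diameter (U i) powr s))"
      by (subst sum.reindex) (auto simp: F_def V_def inj_on_def intro!: sum.cong)
    also have "\<dots> \<le> infsum (\<lambda>i. ennreal (diameter (U i) powr s)) I"
      using finF by (intro sum_le_infsum_ennreal) (auto simp: F_def)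
    finally show "(\<Sum>k<n. ennreal (diameter (V k) powr s)) \<le> infsum (\<lambda>i. ennreal (diameter (U i) powr s)) I" .
  qed simp
  finally show ?thesis .
qed

lemma hausdorff_measure_eq_0_iff:
  "hausdorff_measure s A = 0 \<longleftrightarrow> (\<forall>\<delta>>0. hausdorff_content \<delta> s A = 0)"
proof
  assume "hausdorff_measure s A = 0"
  then have "hausdorff_content \<delta> s A \<le> 0" if "\<delta> > 0" for \<delta>
    unfolding hausdorff_measure_def using that SUP_upper[of \<delta> "{0<..}" "\<lambda>\<delta>. hausdorff_content \<delta> s A"] by simp
  then show "\<forall>\<delta>>0. hausdorff_content \<delta> s A = 0" by simp
next
  assume "\<forall>\<delta>>0. hausdorff_content \<delta> s A = 0"
  then have "hausdorff_measure s A \<le> 0" unfolding hausdorff_measure_def by (intro SUP_least) simp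
  then show "hausdorff_measure s A = 0" by simp
qed

lemma hausdorff_content_mono:
  assumes "A \<subseteq> B" shows "hausdorff_content \<delta> s A \<le> hausdorff_content \<delta> s B"
  unfolding hausdorff_content_def using assms by (intro INF_superset_mono) blast+

lemma hausdorff_measure_0_mono:
  "A \<subseteq> B \<Longrightarrow> hausdorff_measure s B = 0 \<Longrightarrow> hausdorff_measure s A = 0"
  unfolding hausdorff_measure_eq_0_iff by (metis hausdorff_content_mono le_zero_eq)

lemma hausdorff_content_delta_mono:
  assumes "\<delta> \<le> \<delta>'" shows "hausdorff_content \<delta>' s A \<le> hausdorff_content \<delta> s A"
  unfolding hausdorff_content_def
proof (rule INF_superset_mono)
  show "{U. A \<subseteq> (\<Union>i. U i) \<and> (\<forall>i. bounded (U i) \<and> diameter (U i) \<le> \<delta>)}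
      \<subseteq> {U :: nat \<Rightarrow> complex set. A \<subseteq> (\<Union>i. U i) \<and> (\<forall>i. bounded (U i) \<and> diameter (U i) \<le> \<delta>')}"
    using order_trans[OF _ assms] by blast
qed simp

text \<open>For diameters at most 1 a larger exponent gives a smaller power, and contents at scale
  \<delta> are bounded by those at scale \<open>min \<delta> 1\<close>.\<close>

lemma hausdorff_measure_0_exponent_mono:
  assumes "hausdorff_measure s A = 0" "s \<le> t"
  shows "hausdorff_measure t A = 0"
proof -
  have le: "hausdorff_content \<delta> t A \<le> hausdorff_content \<delta> s A" if "\<delta> \<le> 1" for \<delta>
    unfolding hausdorff_content_def
  proof (rule INF_mono)
    fix U assume U: "U \<in> {U :: nat \<Rightarrow> complex set. A \<subseteq> (\<Union>i. U i) \<and> (\<forall>i. bounded (U i) \<and> diameter (U i) \<le> \<delta>)}"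
    have "(\<Sum>i. ennreal (diameter (U i) powr t)) \<le> (\<Sum>i. ennreal (diameter (U i) powr s))"
    proof (intro suminf_le ennreal_leI)
      fix i
      have "0 \<le> diameter (U i)" "diameter (U i) \<le> 1" using U that by (auto intro: diameter_ge_0 order_trans)
      then show "diameter (U i) powr t \<le> diameter (U i) powr s"
        using assms(2) by (cases "diameter (U i) = 0") (auto intro: powr_mono')
    qed auto
    then show "\<exists>V\<in>{U :: nat \<Rightarrow> complex set. A \<subseteq> (\<Union>i. U i) \<and> (\<forall>i. bounded (U i) \<and> diameter (U i) \<le> \<delta>)}.
       (\<Sum>i. ennreal (diameter (V i) powr t)) \<le> (\<Sum>i. ennreal (diameter (U i) powr s))"
      using U by blast
  qed
  show ?thesis unfolding hausdorff_measure_eq_0_iff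
  proof (intro allI impI)
    fix \<delta> :: real assume "\<delta> > 0"
    then have "hausdorff_content \<delta> t A \<le> hausdorff_content (min \<delta> 1) t A"
      by (intro hausdorff_content_delta_mono) auto
    also have "\<dots> \<le> hausdorff_content (min \<delta> 1) s A" by (rule le) simp
    also have "\<dots> = 0" using assms(1) \<open>\<delta> > 0\<close> unfolding hausdorff_measure_eq_0_iff by simp
    finally show "hausdorff_content \<delta> t A = 0" by simp
  qed
qed

lemma hausdorff_measure_0_UN:
  assumes "\<And>k::nat. hausdorff_measure s (A k) = 0"
  shows "hausdorff_measure s (\<Union>k. A k) = 0"
  unfolding hausdorff_measure_eq_0_iff
proof (intro allI impI)
  fix \<delta> :: real assume \<delta>: "\<delta> > 0"
  have "hausdorff_content \<delta> s (\<Union>k. A k) \<le> ennreal e" if e: "e > 0" for e :: real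
  proof -
    have "\<exists>U :: nat \<Rightarrow> complex set. A k \<subseteq> (\<Union>i. U i) \<and> (\<forall>i. bounded (U i) \<and> diameter (U i) \<le> \<delta>) \<and>
        (\<Sum>i. ennreal (diameter (U i) powr s)) \<le> ennreal (e * (1/2) ^ Suc k)" for k
    proof -
      have "hausdorff_content \<delta> s (A k) < ennreal (e * (1/2) ^ Suc k)"
        using assms[of k] \<delta> e unfolding hausdorff_measure_eq_0_iff by (simp add: ennreal_zero_less_mult_iff)
      then show ?thesis unfolding hausdorff_content_def INF_less_iff using less_imp_le by blast
    qed
    then obtain U :: "nat \<Rightarrow> nat \<Rightarrow> complex set" where U: "\<And>k. A k \<subseteq> (\<Union>i. U k i)"
        "\<And>k i. bounded (U k i) \<and> diameter (U k i) \<le> \<delta>"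
        "\<And>k. (\<Sum>i. ennreal (diameter (U k i) powr s)) \<le> ennreal (e * (1/2) ^ Suc k)"
      by metis
    define V where "V = (\<lambda>(k, i). U k i)"
    have "hausdorff_content \<delta> s (\<Union>k. A k) \<le> infsum (\<lambda>p. ennreal (diameter (V p) powr s)) UNIV"
    proof (rule hausdorff_content_le_infsum)
      show "(\<Union>k. A k) \<subseteq> (\<Union>p\<in>UNIV. V p)"
      proof
        fix x assume "x \<in> (\<Union>k. A k)"
        then obtain k where "x \<in> A k" by blast
        then obtain i where "x \<in> U k i" using U(1) by blast
        then have "x \<in> V (k, i)" by (simp add: V_def)
        then show "x \<in> (\<Union>p\<in>UNIV. V p)" by blast
      qed
      show "bounded (V p) \<and> diameter (V p) \<le> \<delta>" for p
        using U(2) by (cases p) (simp add: V_def)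
    qed (use \<delta> in simp)
    also have "\<dots> = infsum (\<lambda>(k, i). ennreal (diameter (U k i) powr s)) (Sigma UNIV (\<lambda>_. UNIV))"
      by (simp add: V_def case_prod_unfold)
    also have "\<dots> = infsum (\<lambda>k. infsum (\<lambda>i. ennreal (diameter (U k i) powr s)) UNIV) UNIV"
      by (rule infsum_Sigma_ennreal)
    also have "\<dots> \<le> infsum (\<lambda>k. ennreal (e * (1/2) ^ Suc k)) UNIV"
    proof (rule infsum_mono_ennreal)
      fix k :: nat
      have "infsum (\<lambda>i. ennreal (diameter (U k i) powr s)) UNIV \<le> (\<Sum>i. ennreal (diameter (U k i) powr s))"
        by (rule infsum_nat_le_suminf_ennreal)
      then show "infsum (\<lambda>i. ennreal (diameter (U k i) powr s)) UNIV \<le> ennreal (e * (1/2) ^ Suc k)"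
        using U(3)[of k] by (rule order_trans)
    qed
    also have "\<dots> \<le> (\<Sum>k. ennreal (e * (1/2) ^ Suc k))"
      by (rule infsum_nat_le_suminf_ennreal)
    also have "\<dots> = ennreal e"
    proof -
      have "(\<lambda>k. e * (1/2) ^ Suc k) sums (e * 1)"
        by (intro sums_mult power_half_series)
      then show ?thesis using e by (subst suminf_ennreal_eq) auto
    qed
    finally show ?thesis .
  qed
  then have "hausdorff_content \<delta> s (\<Union>k. A k) \<le> 0 + ennreal e" if "e > 0" for e
    using that by simp
  then have "hausdorff_content \<delta> s (\<Union>k. A k) \<le> 0" by (rule ennreal_le_epsilon)
  then show "hausdorff_content \<delta> s (\<Union>k. A k) = 0" by simp
qed

lemma hausdorff_dim_eqI:
  assumes "h > 0" and up: "\<And>s. s > h \<Longrightarrow> hausdorff_measure s A = 0"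
    and low: "\<And>s. 0 < s \<Longrightarrow> s < h \<Longrightarrow> hausdorff_measure s A \<noteq> 0"
  shows "hausdorff_dim A = h"
proof -
  let ?S = "{s. s \<ge> 0 \<and> hausdorff_measure s A = 0}"
  have lb: "h \<le> s" if "s \<in> ?S" for s
  proof (rule ccontr)
    assume "\<not> h \<le> s"
    then have sh: "s < h" by simp
    have sA: "s \<ge> 0" "hausdorff_measure s A = 0" using that by simp_all
    \<comment> \<open>\<open>s\<close> may be 0, where \<open>low\<close> says nothing; the midpoint
      is positive, still below \<open>h\<close>, and inherits null measure from
      \<open>s\<close>.\<close>
    have "hausdorff_measure ((s + h) / 2) A = 0"
      by (rule hausdorff_measure_0_exponent_mono[OF sA(2)]) (use sh in simp)
    moreover have "0 < (s + h) / 2" "(s + h) / 2 < h" using sA(1) sh assms(1) by simp_all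
    ultimately show False using low by blast
  qed
  have "bdd_below ?S" using lb by (rule bdd_belowI)
  then have "Inf ?S \<le> h + e" if "e > 0" for e
    using up[of "h + e"] that assms(1) by (intro cInf_lower) simp_all
  then have "Inf ?S \<le> h" by (rule field_le_epsilon)
  moreover have "h \<le> Inf ?S"
  proof (rule cInf_greatest)
    have "h + 1 \<in> ?S" using up[of "h + 1"] assms(1) by simp
    then show "?S \<noteq> {}" by blast
  qed (rule lb)
  ultimately show ?thesis unfolding hausdorff_dim_def by simp
qed

text \<open>Moran's lower bound without a measure. If all covering sets have diameter less than the
  separation \<open>d\<close>, then each of them meets at most one piece \<open>g i ` \<Lambda>\<close>; pulling the sets that meet
  \<open>g i ` \<Lambda>\<close> back by \<open>g i\<close> gives a cover with fewer sets. The map \<open>\<phi>\<close> is a change of coordinates.\<close>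
lemma Moran_finite_cover:
  fixes U :: "'j \<Rightarrow> complex set" and \<phi> :: "'a \<Rightarrow> complex" and g :: "'i \<Rightarrow> 'a \<Rightarrow> 'a"
  assumes E: "finite E" "card E \<ge> 2" and ne: "\<Lambda> \<noteq> {}" and bdd: "bounded (\<phi> ` \<Lambda>)"
    and inv: "\<And>i x. i \<in> E \<Longrightarrow> x \<in> \<Lambda> \<Longrightarrow> g i x \<in> \<Lambda>"
    and d: "d > 0"
    and sep: "\<And>i j x y. i \<in> E \<Longrightarrow> j \<in> E \<Longrightarrow> i \<noteq> j \<Longrightarrow> x \<in> \<Lambda> \<Longrightarrow> y \<in> \<Lambda> \<Longrightarrow> d \<le> dist (\<phi> (g i x)) (\<phi> (g j y))"
    and expd: "\<And>i x y. i \<in> E \<Longrightarrow> x \<in> \<Lambda> \<Longrightarrow> y \<in> \<Lambda> \<Longrightarrow> \<rho> i * dist (\<phi> x) (\<phi> y) \<le> dist (\<phi> (g i x)) (\<phi> (g i y))"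
    and \<rho>: "\<And>i. i \<in> E \<Longrightarrow> \<rho> i > 0" and s: "s > 0" and sum: "1 \<le> (\<Sum>i\<in>E. \<rho> i powr s)"
    and "finite J" "\<And>j. j \<in> J \<Longrightarrow> bounded (U j)" "\<phi> ` \<Lambda> \<subseteq> (\<Union>j\<in>J. U j)"
  shows "d powr s \<le> (\<Sum>j\<in>J. diameter (U j) powr s)"
  using assms(12-14)
proof (induction "card J" arbitrary: J U rule: less_induct)
  case less
  show ?case
  proof (cases "\<exists>j\<in>J. diameter (U j) \<ge> d")
    case True
    then obtain j where j: "j \<in> J" "diameter (U j) \<ge> d" by blast
    have "d powr s \<le> diameter (U j) powr s" using j d s by (intro powr_mono2) auto
    also have "\<dots> \<le> (\<Sum>j\<in>J. diameter (U j) powr s)"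
      using j less.prems by (intro member_le_sum) auto
    finally show ?thesis .
  next
    case False
    define Ji where "Ji i = {j \<in> J. \<exists>x\<in>\<Lambda>. \<phi> (g i x) \<in> U j}" for i
    define V where "V i j = \<phi> ` {x \<in> \<Lambda>. \<phi> (g i x) \<in> U j}" for i j
    have disj: "Ji i \<inter> Ji k = {}" if ik: "i \<in> E" "k \<in> E" "i \<noteq> k" for i k
    proof (rule ccontr)
      assume "Ji i \<inter> Ji k \<noteq> {}"
      then obtain j x y where *: "j \<in> J" "x \<in> \<Lambda>" "y \<in> \<Lambda>" "\<phi> (g i x) \<in> U j" "\<phi> (g k y) \<in> U j"
        by (auto simp: Ji_def)
      then have "dist (\<phi> (g i x)) (\<phi> (g k y)) \<le> diameter (U j)"
        using diameter_bounded_bound less.prems(2) by blast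
      then have "d \<le> diameter (U j)" using sep[OF ik] * by force
      then show False using False * by auto
    qed
    have nonempty: "Ji i \<noteq> {}" if "i \<in> E" for i
    proof -
      obtain x where "x \<in> \<Lambda>" using ne by blast
      then have "\<phi> (g i x) \<in> \<phi> ` \<Lambda>" using inv that by blast
      then obtain j where "j \<in> J" "\<phi> (g i x) \<in> U j" using less.prems(3) by blast
      then show ?thesis using \<open>x \<in> \<Lambda>\<close> by (auto simp: Ji_def)
    qed
    have step: "\<rho> i powr s * d powr s \<le> (\<Sum>j\<in>Ji i. diameter (U j) powr s)" if i: "i \<in> E" for i
    proof -
      \<comment> \<open>A second index makes \<open>Ji i\<close> a proper subset of
        \<open>J\<close>, since the nonempty \<open>Ji k\<close> is disjoint from it. This is where
        \<open>card E \<ge> 2\<close> enters and what drives the induction on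
        \<open>card J\<close>.\<close>
      obtain k where k: "k \<in> E" "k \<noteq> i"
      proof -
        have "card (E - {i}) \<ge> 1" using E i by simp
        then have "E - {i} \<noteq> {}" by (metis card.empty not_one_le_zero)
        then show ?thesis using that by blast
      qed
      have "Ji i \<subset> J" using disj[OF i k(1)] k(2) nonempty[OF k(1)] unfolding Ji_def by blast
      then have "card (Ji i) < card J" using less.prems(1) psubset_card_mono by blast
      moreover have "finite (Ji i)" using less.prems(1) by (simp add: Ji_def)
      moreover have "bounded (V i j)" for j
        unfolding V_def by (rule bounded_subset[OF bdd]) auto
      moreover have "\<phi> ` \<Lambda> \<subseteq> (\<Union>j\<in>Ji i. V i j)"
      proof
        fix w assume "w \<in> \<phi> ` \<Lambda>"
        then obtain x where x: "x \<in> \<Lambda>" "w = \<phi> x" by blast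
        then have "\<phi> (g i x) \<in> \<phi> ` \<Lambda>" using inv i by blast
        then obtain j where "j \<in> J" "\<phi> (g i x) \<in> U j" using less.prems(3) by blast
        then show "w \<in> (\<Union>j\<in>Ji i. V i j)" using x by (auto simp: Ji_def V_def)
      qed
      ultimately have IH: "d powr s \<le> (\<Sum>j\<in>Ji i. diameter (V i j) powr s)"
        using less.hyps[of "Ji i" "V i"] by blast
      have "\<rho> i powr s * d powr s \<le> \<rho> i powr s * (\<Sum>j\<in>Ji i. diameter (V i j) powr s)"
        using IH by (intro mult_left_mono) auto
      also have "\<dots> = (\<Sum>j\<in>Ji i. (\<rho> i * diameter (V i j)) powr s)"
        using \<rho>[OF i] by (simp add: sum_distrib_left powr_mult diameter_ge_0 \<open>\<And>j. bounded (V i j)\<close>)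
      also have "\<dots> \<le> (\<Sum>j\<in>Ji i. diameter (U j) powr s)"
      proof (intro sum_mono powr_mono2)
        fix j assume j: "j \<in> Ji i"
        then have bU: "bounded (U j)" using less.prems(2) by (simp add: Ji_def)
        show "0 \<le> \<rho> i * diameter (V i j)"
          using \<rho>[OF i] \<open>bounded (V i j)\<close> by (intro mult_nonneg_nonneg diameter_ge_0) auto
        have "diameter (V i j) \<le> diameter (U j) / \<rho> i"
        proof (rule diameter_le)
          show "V i j \<noteq> {} \<or> 0 \<le> diameter (U j) / \<rho> i"
            using \<rho>[OF i] diameter_ge_0[OF bU] by simp
          fix a b assume "a \<in> V i j" "b \<in> V i j"
          then obtain x y where xy: "x \<in> \<Lambda>" "y \<in> \<Lambda>" "a = \<phi> x" "b = \<phi> y" "\<phi> (g i x) \<in> U j" "\<phi> (g i y) \<in> U j"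
            by (auto simp: V_def)
          have "\<rho> i * dist a b \<le> dist (\<phi> (g i x)) (\<phi> (g i y))" using expd[OF i xy(1,2)] xy by simp
          also have "\<dots> \<le> diameter (U j)" using diameter_bounded_bound bU xy by blast
          finally show "norm (a - b) \<le> diameter (U j) / \<rho> i"
            using \<rho>[OF i] by (simp add: field_simps dist_norm)
        qed
        then show "\<rho> i * diameter (V i j) \<le> diameter (U j)" using \<rho>[OF i] by (simp add: field_simps)
      qed (use s in auto)
      finally show ?thesis .
    qed
    have "d powr s \<le> (\<Sum>i\<in>E. \<rho> i powr s) * d powr s" using sum by (simp add: mult_le_cancel_right1)
    also have "\<dots> = (\<Sum>i\<in>E. \<rho> i powr s * d powr s)" by (simp add: sum_distrib_right)
    also have "\<dots> \<le> (\<Sum>i\<in>E. \<Sum>j\<in>Ji i. diameter (U j) powr s)" using step by (rule sum_mono)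
    also have "\<dots> = (\<Sum>j\<in>(\<Union>i\<in>E. Ji i). diameter (U j) powr s)"
    proof (rule sum.UNION_disjoint[symmetric])
      show "\<forall>i\<in>E. finite (Ji i)" using less.prems(1) by (simp add: Ji_def)
      show "\<forall>i\<in>E. \<forall>k\<in>E. i \<noteq> k \<longrightarrow> Ji i \<inter> Ji k = {}" using disj by blast
    qed (use E in simp)
    also have "\<dots> \<le> (\<Sum>j\<in>J. diameter (U j) powr s)"
    proof (rule sum_mono2)
      show "(\<Union>i\<in>E. Ji i) \<subseteq> J" unfolding Ji_def by blast
    qed (use less.prems(1) in simp_all)
    finally show ?thesis .
  qed
qed

text \<open>Compactness can reduce a countable cover to a finite one only if the sets are open. As
  \<open>s > 0\<close>, \<open>(diameter U + 2 * \<eta>) powr s\<close> is continuous at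
  \<open>\<eta> = 0\<close> even when the diameter is 0.\<close>

lemma open_enlargement:
  fixes U :: "complex set"
  assumes "bounded U" "s > 0" "e > 0"
  shows "\<exists>V. open V \<and> U \<subseteq> V \<and> bounded V \<and> diameter V powr s \<le> diameter U powr s + e"
proof (cases "U = {}")
  case True
  then show ?thesis using assms(3) by (intro exI[of _ "{}"]) auto
next
  case False
  have "((\<lambda>\<eta>. (diameter U + 2 * \<eta>) powr s) \<longlongrightarrow> (diameter U + 2 * 0) powr s) (at_right 0)"
  proof (rule tendsto_powr')
    show "diameter U + 2 * 0 \<noteq> 0 \<or> 0 < s \<and> (\<forall>\<^sub>F \<eta> in at_right 0. 0 \<le> diameter U + 2 * \<eta>)"
      using assms diameter_ge_0[OF assms(1)]
      by (auto simp: eventually_at_filter intro!: always_eventually)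
  qed (intro tendsto_intros)+
  then have "\<forall>\<^sub>F \<eta> in at_right 0. (diameter U + 2 * \<eta>) powr s < diameter U powr s + e"
    using assms(3) by (intro order_tendstoD(2)) auto
  then have "\<forall>\<^sub>F \<eta> in at_right 0. (diameter U + 2 * \<eta>) powr s < diameter U powr s + e \<and> \<eta> > 0"
    using eventually_at_right_less by (rule eventually_conj)
  then obtain \<eta> where \<eta>: "(diameter U + 2 * \<eta>) powr s < diameter U powr s + e" "\<eta> > 0"
    using eventually_happens trivial_limit_at_right_real by blast
  define V where "V = (\<Union>u\<in>U. ball u \<eta>)"
  have dV: "dist x y \<le> diameter U + 2 * \<eta>" if xy: "x \<in> V" "y \<in> V" for x y
  proof -
    obtain u v where uv: "u \<in> U" "v \<in> U" "dist u x < \<eta>" "dist v y < \<eta>" using xy by (auto simp: V_def)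
    have "dist x y \<le> dist u x + dist u v + dist v y"
      using dist_triangle[of x y u] dist_triangle[of u y v] by (simp add: dist_commute)
    then show ?thesis using uv diameter_bounded_bound[OF assms(1), of u v] by simp
  qed
  have "open V" unfolding V_def by auto
  moreover have "U \<subseteq> V" using \<eta>(2) by (auto simp: V_def)
  moreover have "bounded V"
    using dV False \<open>U \<subseteq> V\<close> unfolding bounded_def by blast
  moreover have "diameter V \<le> diameter U + 2 * \<eta>"
    using dV False \<open>U \<subseteq> V\<close> by (intro diameter_le) (auto simp: dist_norm)
  then have "diameter V powr s \<le> (diameter U + 2 * \<eta>) powr s"
    using assms \<open>bounded V\<close> by (intro powr_mono2 diameter_ge_0) auto
  ultimately show ?thesis using \<eta>(1) by (meson less_imp_le order_trans)
qed

text \<open>Enlarging the \<open>i\<close>-th set at cost \<open>(c/2) * (1/2) ^ Suc i\<close> costs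
  at most \<open>c/2\<close> in total, so a countable cover with sum below \<open>c/2\<close> would
  produce a finite one with sum below \<open>c\<close>.\<close>

lemma hausdorff_measure_pos_of_finite_covers:
  assumes comp: "compact K" and s: "s > 0" and c: "c > 0"
    and fin: "\<And>(U :: nat \<Rightarrow> complex set) J. finite J \<Longrightarrow> (\<And>j. j \<in> J \<Longrightarrow> bounded (U j)) \<Longrightarrow> K \<subseteq> (\<Union>j\<in>J. U j)
      \<Longrightarrow> c \<le> (\<Sum>j\<in>J. diameter (U j) powr s)"
  shows "hausdorff_measure s K \<noteq> 0"
proof
  assume "hausdorff_measure s K = 0"
  then have "hausdorff_content 1 s K < ennreal (c/2)" using c by (simp add: hausdorff_measure_eq_0_iff)
  then obtain U :: "nat \<Rightarrow> complex set" where U: "K \<subseteq> (\<Union>i. U i)" "\<And>i. bounded (U i)"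
      and small: "(\<Sum>i. ennreal (diameter (U i) powr s)) < ennreal (c/2)"
    unfolding hausdorff_content_def INF_less_iff by blast
  have "\<forall>i. \<exists>V. open V \<and> U i \<subseteq> V \<and> bounded V \<and> diameter V powr s \<le> diameter (U i) powr s + (c/2) * (1/2) ^ Suc i"
    using open_enlargement[OF U(2) s] c by simp
  then obtain V where V: "\<And>i. open (V i)" "\<And>i. U i \<subseteq> V i" "\<And>i. bounded (V i)"
      "\<And>i. diameter (V i) powr s \<le> diameter (U i) powr s + (c/2) * (1/2) ^ Suc i"
    by metis
  have "K \<subseteq> (\<Union>i\<in>UNIV. V i)" using U(1) V(2) by blast
  then obtain J where J: "finite J" "K \<subseteq> (\<Union>i\<in>J. V i)"
    using compactE_image[OF comp, of UNIV V] V(1) by auto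
  have half: "(\<Sum>j\<in>J. (1/2::real) ^ Suc j) \<le> 1"
    using sum_le_suminf[of "\<lambda>j. (1/2::real) ^ Suc j" J] power_half_series J(1) sums_unique sums_summable
    by fastforce
  have "c \<le> (\<Sum>j\<in>J. diameter (V j) powr s)" using fin[of J V] J V(3) by blast
  also have "\<dots> \<le> (\<Sum>j\<in>J. diameter (U j) powr s + (c/2) * (1/2) ^ Suc j)"
    using V(4) by (rule sum_mono)
  also have "\<dots> = (\<Sum>j\<in>J. diameter (U j) powr s) + (c/2) * (\<Sum>j\<in>J. (1/2) ^ Suc j)"
    by (simp only: sum.distrib sum_distrib_left)
  also have "\<dots> \<le> (\<Sum>j\<in>J. diameter (U j) powr s) + (c/2) * 1"
    using half c by (intro add_left_mono mult_left_mono) auto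
  finally have "c/2 \<le> (\<Sum>j\<in>J. diameter (U j) powr s)" by simp
  then have "ennreal (c/2) \<le> ennreal (\<Sum>j\<in>J. diameter (U j) powr s)" by (rule ennreal_leI)
  also have "\<dots> = (\<Sum>j\<in>J. ennreal (diameter (U j) powr s))" by simp
  also have "\<dots> \<le> (\<Sum>i. ennreal (diameter (U i) powr s))"
    using J(1) by (intro sum_le_suminf) auto
  finally show False using small by simp
qed

section \<open>Inverse branches in logarithmic coordinates\<close>

text \<open>\<open>W\<close> is the union of the tracts and \<open>g j\<close> is a logarithm of the inverse of \<open>\<tau> j\<close>, so that the
  preimages of \<open>exp z\<close> under \<open>f\<close> are the points \<open>exp (g j (z + 2 * pi * k * \<i>))\<close>.\<close>
locale tract_system =
  fixes f :: "complex \<Rightarrow> complex" and N :: nat and W :: "complex set"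
    and g :: "nat \<Rightarrow> complex \<Rightarrow> complex" and \<delta> :: real
  assumes delta_pos: "\<delta> > 0"
    and N_pos: "N \<ge> 1"
    and g_hol: "\<And>j. j < N \<Longrightarrow> g j holomorphic_on HP 0"
    and g_range: "\<And>j z. j < N \<Longrightarrow> Re z > 0 \<Longrightarrow> Re (g j z) > \<delta>"
    and g_W: "\<And>j z. j < N \<Longrightarrow> Re z > 0 \<Longrightarrow> exp (g j z) \<in> W"
    and f_g: "\<And>j z. j < N \<Longrightarrow> Re z > 0 \<Longrightarrow> f (exp (g j z)) = exp z"
    and W_g: "\<And>v. v \<in> W \<Longrightarrow> \<exists>j<N. \<exists>z. Re z > 0 \<and> v = exp (g j z)"
    and g_uniq: "\<And>j k z z'. j < N \<Longrightarrow> k < N \<Longrightarrow> Re z > 0 \<Longrightarrow> Re z' > 0 \<Longrightarrow>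
      exp (g j z) = exp (g k z') \<Longrightarrow> j = k \<and> z = z'"
    and f_hol: "f holomorphic_on W" and W_open: "open W"
begin

definition per :: "int \<Rightarrow> complex" where "per k = of_int (2 * k) * of_real pi * \<i>"

lemma Re_per [simp]: "Re (per k) = 0" by (simp add: per_def)
lemma Im_per: "Im (per k) = 2 * pi * of_int k" by (simp add: per_def)
lemma per_0 [simp]: "per 0 = 0" by (simp add: per_def)
lemma per_eq_iff [simp]: "per k = per l \<longleftrightarrow> k = l" by (simp add: per_def)
lemma exp_per [simp]: "exp (z + per k) = exp z"
  using exp_eq[of "z + per k" z] by (auto simp: per_def)
lemma exp_eq_per: "exp z = exp z' \<Longrightarrow> \<exists>k. z = z' + per k"
  unfolding exp_eq per_def by auto

definition I :: "(nat \<times> int) set" where "I = {..<N} \<times> UNIV"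

definition G :: "nat \<times> int \<Rightarrow> complex \<Rightarrow> complex" where
  "G i z = g (fst i) (z + per (snd i))"

text \<open>The head of the word is applied first, so it inverts the last of the
  \<open>length w\<close> steps of the orbit; a letter appended at the end of the word puts a new
  point in front of the orbit.\<close>

fun Gw :: "(nat \<times> int) list \<Rightarrow> complex \<Rightarrow> complex" where
  "Gw [] z = z"
| "Gw (i # w) z = Gw w (G i z)"

definition words :: "nat \<Rightarrow> (nat \<times> int) list set" where
  "words n = {w. length w = n \<and> set w \<subseteq> I}"

lemma fst_I: "i \<in> I \<Longrightarrow> fst i < N" by (auto simp: I_def)

lemma words_0 [simp]: "words 0 = {[]}" by (auto simp: words_def)

lemma words_Suc: "words (Suc n) = (\<lambda>(i, w). i # w) ` (I \<times> words n)"
  by (auto simp: words_def length_Suc_conv image_iff)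

lemma words_append: "w \<in> words m \<Longrightarrow> w' \<in> words n \<Longrightarrow> w @ w' \<in> words (m + n)"
  by (auto simp: words_def)

lemma Gw_append: "Gw (w @ w') z = Gw w' (Gw w z)"
  by (induction w arbitrary: z) auto

lemma G_range: "i \<in> I \<Longrightarrow> Re z > 0 \<Longrightarrow> Re (G i z) > \<delta>"
  unfolding G_def using g_range[OF fst_I] by simp

lemma G_pos: "i \<in> I \<Longrightarrow> Re z > 0 \<Longrightarrow> Re (G i z) > 0"
  using G_range[of i z] delta_pos by linarith

lemma G_hol: assumes "i \<in> I" shows "G i holomorphic_on HP 0"
proof -
  have "g (fst i) \<circ> (\<lambda>z. z + per (snd i)) holomorphic_on HP 0"
    by (rule holomorphic_on_compose_gen[OF _ g_hol[OF fst_I[OF assms]]])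
      (auto intro!: holomorphic_intros)
  then show ?thesis by (simp add: G_def[abs_def] o_def)
qed

lemma G_uniq:
  assumes "i \<in> I" "j \<in> I" "Re z > 0" "exp (G i z) = exp (G j z)"
  shows "i = j"
proof -
  have "fst i = fst j \<and> z + per (snd i) = z + per (snd j)"
    using g_uniq[OF fst_I[OF assms(1)] fst_I[OF assms(2)], of "z + per (snd i)" "z + per (snd j)"]
      assms(3,4) by (simp add: G_def)
  then show ?thesis by (simp add: prod_eq_iff)
qed

lemma exp_G_inj:
  assumes "i \<in> I" shows "inj_on (\<lambda>z. exp (G i z)) (HP 0)"
proof (rule inj_onI)
  fix x y assume "x \<in> HP 0" "y \<in> HP 0" "exp (G i x) = exp (G i y)"
  then have "x + per (snd i) = y + per (snd i)"
    using g_uniq[OF fst_I[OF assms] fst_I[OF assms], of "x + per (snd i)" "y + per (snd i)"] by (simp add: G_def)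
  then show "x = y" by simp
qed

lemma G_inj: assumes "i \<in> I" shows "inj_on (G i) (HP 0)"
  using exp_G_inj[OF assms] by (auto simp: inj_on_def)

lemma f_G: "i \<in> I \<Longrightarrow> Re z > 0 \<Longrightarrow> f (exp (G i z)) = exp z"
  unfolding G_def using f_g[OF fst_I] by simp

lemma G_W: "i \<in> I \<Longrightarrow> Re z > 0 \<Longrightarrow> exp (G i z) \<in> W"
  unfolding G_def using g_W[OF fst_I] by simp

lemma preimage_G:
  assumes "v \<in> W" "f v = exp z"
  shows "\<exists>i\<in>I. v = exp (G i z)"
proof -
  obtain j z' where j: "j < N" "Re z' > 0" "v = exp (g j z')" using W_g[OF assms(1)] by blast
  then have "exp z' = exp z" using f_g assms(2) by simp
  then obtain k where "z' = z + per k" using exp_eq_per by blast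
  then have "v = exp (G (j, k) z)" using j by (simp add: G_def)
  moreover have "(j, k) \<in> I" using j by (simp add: I_def)
  ultimately show ?thesis by blast
qed

lemma Gw_pos: "set w \<subseteq> I \<Longrightarrow> Re z > 0 \<Longrightarrow> Re (Gw w z) > 0"
  by (induction w arbitrary: z) (auto simp: G_pos)

lemma Gw_range: "set w \<subseteq> I \<Longrightarrow> Re z \<ge> \<delta> \<Longrightarrow> Re (Gw w z) \<ge> \<delta>"
proof (induction w arbitrary: z)
  case (Cons i w)
  have "Re (G i z) > \<delta>" using G_range[of i z] Cons.prems delta_pos by simp
  then show ?case using Cons by simp
qed simp

lemma Gw_hol: "set w \<subseteq> I \<Longrightarrow> Gw w holomorphic_on HP 0"
proof (induction w)
  case Nil
  have "Gw [] = (\<lambda>z. z)" by auto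
  then show ?case by simp
next
  case (Cons i w)
  have i: "i \<in> I" "set w \<subseteq> I" using Cons.prems by auto
  have "G i ` HP 0 \<subseteq> HP 0" using G_pos[OF i(1)] by (simp add: image_subset_iff)
  then have "Gw w \<circ> G i holomorphic_on HP 0"
    by (rule holomorphic_on_compose_gen[OF G_hol[OF i(1)] Cons.IH[OF i(2)]])
  moreover have "Gw w \<circ> G i = Gw (i # w)" by auto
  ultimately show ?case by (simp only:)
qed

lemma Gw_inj: "set w \<subseteq> I \<Longrightarrow> inj_on (Gw w) (HP 0)"
proof (induction w)
  case Nil
  show ?case by (simp add: inj_on_def)
next
  case (Cons i w)
  show ?case
  proof (rule inj_onI)
    fix x y assume xy: "x \<in> HP 0" "y \<in> HP 0" "Gw (i # w) x = Gw (i # w) y"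
    have "G i x \<in> HP 0" "G i y \<in> HP 0" using xy Cons.prems G_pos by auto
    then have "G i x = G i y" using xy Cons unfolding inj_on_def by simp
    moreover have "i \<in> I" using Cons.prems by simp
    ultimately show "x = y" using inj_onD[OF G_inj] xy(1,2) by blast
  qed
qed

lemma f_Gw: "set w \<subseteq> I \<Longrightarrow> Re z > 0 \<Longrightarrow> (f ^^ length w) (exp (Gw w z)) = exp z"
  by (induction w arbitrary: z) (simp_all add: G_pos f_G)

lemma Gw_orbit_W: "set w \<subseteq> I \<Longrightarrow> Re z > 0 \<Longrightarrow> k < length w \<Longrightarrow> (f ^^ k) (exp (Gw w z)) \<in> W"
proof (induction w arbitrary: z)
  case (Cons i w)
  have G: "Re (G i z) > 0" "exp (G i z) \<in> W" using Cons.prems G_pos G_W by auto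
  show ?case
  proof (cases "k < length w")
    case True
    then show ?thesis using Cons.IH[of "G i z"] Cons.prems G by simp
  next
    case False
    then have "k = length w" using Cons.prems by simp
    then show ?thesis using f_Gw[of w "G i z"] Cons.prems G by simp
  qed
qed simp

text \<open>Iterating \<open>f\<close> from the common endpoint recovers \<open>exp (G i z)\<close>,
  which determines the letter applied first; the rest is induction from the new base point.\<close>

lemma Gw_uniq:
  "w \<in> words n \<Longrightarrow> w' \<in> words n \<Longrightarrow> Re z > 0 \<Longrightarrow> exp (Gw w z) = exp (Gw w' z) \<Longrightarrow> w = w'"
proof (induction n arbitrary: w w' z)
  case (Suc n)
  obtain i v i' v' where w: "w = i # v" "w' = i' # v'" "i \<in> I" "i' \<in> I" "v \<in> words n" "v' \<in> words n"
    using Suc.prems(1,2) by (auto simp: words_Suc)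
  have pos: "Re (G i z) > 0" "Re (G i' z) > 0" using w Suc.prems G_pos by auto
  have len: "set v \<subseteq> I" "set v' \<subseteq> I" "length v = n" "length v' = n" using w by (auto simp: words_def)
  have "exp (G i z) = (f ^^ n) (exp (Gw w z))" using f_Gw[of v "G i z"] w len pos by simp
  also have "\<dots> = exp (G i' z)" using f_Gw[of v' "G i' z"] Suc.prems(4) w len pos by simp
  finally have "i = i'" using G_uniq w Suc.prems(3) by blast
  then show ?case using Suc.IH[of v v' "G i z"] w pos Suc.prems(4) by simp
qed simp

lemma preimage_Gw:
  "(\<And>k. k < n \<Longrightarrow> (f ^^ k) u \<in> W) \<Longrightarrow> (f ^^ n) u = exp z \<Longrightarrow> Re z > 0 \<Longrightarrow> \<exists>w\<in>words n. u = exp (Gw w z)"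
proof (induction n arbitrary: z)
  case (Suc n)
  have "(f ^^ n) u \<in> W" using Suc.prems(1) by blast
  then obtain i where i: "i \<in> I" "(f ^^ n) u = exp (G i z)"
    using preimage_G[of "(f ^^ n) u" z] Suc.prems(2) by auto
  then obtain w where "w \<in> words n" "u = exp (Gw w (G i z))"
    using Suc.IH[of "G i z"] Suc.prems G_pos by auto
  then show ?case using i by (intro bexI[of _ "i # w"]) (auto simp: words_Suc)
qed simp

lemma deriv_Gw_Cons:
  assumes "i \<in> I" "set w \<subseteq> I" "Re z > 0"
  shows "deriv (Gw (i # w)) z = deriv (Gw w) (G i z) * deriv (G i) z"
proof -
  have "(Gw w has_field_derivative deriv (Gw w) (G i z)) (at (G i z))"
    using assms G_pos by (intro holomorphic_derivI[OF Gw_hol]) auto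
  moreover have "(G i has_field_derivative deriv (G i) z) (at z)"
    using assms by (intro holomorphic_derivI[OF G_hol]) auto
  ultimately have "((\<lambda>z. Gw w (G i z)) has_field_derivative deriv (Gw w) (G i z) * deriv (G i) z) (at z)"
    by (rule DERIV_chain2)
  moreover have "Gw (i # w) = (\<lambda>z. Gw w (G i z))" by (rule ext) simp
  ultimately show ?thesis by (simp only: DERIV_imp_deriv)
qed

lemma deriv_Gw_append:
  "set w \<subseteq> I \<Longrightarrow> set w' \<subseteq> I \<Longrightarrow> Re z > 0 \<Longrightarrow>
    deriv (Gw (w @ w')) z = deriv (Gw w') (Gw w z) * deriv (Gw w) z"
proof (induction w arbitrary: z)
  case Nil
  have "Gw [] = (\<lambda>z. z)" by auto
  then show ?case by simp
next
  case (Cons i w)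
  have G: "Re (G i z) > 0" using Cons.prems G_pos by simp
  have "deriv (Gw ((i # w) @ w')) z = deriv (Gw (w @ w')) (G i z) * deriv (G i) z"
    using Cons.prems deriv_Gw_Cons[of i "w @ w'"] by simp
  also have "\<dots> = deriv (Gw w') (Gw (i # w) z) * deriv (Gw (i # w)) z"
    using Cons.IH[OF _ _ G] Cons.prems deriv_Gw_Cons[of i w z] by simp
  finally show ?case .
qed

lemma deriv_Gw_nonzero: "set w \<subseteq> I \<Longrightarrow> Re z > 0 \<Longrightarrow> deriv (Gw w) z \<noteq> 0"
  by (rule inj_deriv_nonzero[OF Gw_hol open_HP Gw_inj]) auto

section \<open>Contraction of the inverse branches\<close>

lemma deriv_G_bound:
  assumes "i \<in> I" "Re z > 0"
  shows "Re z * norm (deriv (G i) z) \<le> 48"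
  using assms ball_subset_HP[of z]
  by (intro deriv_bound_of_exp_inj holomorphic_on_subset[OF G_hol] inj_on_subset[OF exp_G_inj]) auto

text \<open>The threshold is 96 = 2 * 48. Where \<open>Re (G i z)\<close> is below it, the gap
  \<delta> is at least the proportion \<delta> / 96 of \<open>Re (G i z)\<close>; above it, the
  Bloch bound 48 is at most half of \<open>Re (G i z)\<close>. The 1/2 also keeps \<kappa> positive
  for large \<delta>.\<close>

definition \<kappa> :: real where "\<kappa> = max (1/2) (1 - \<delta> / 96)"

lemma kappa: "0 < \<kappa>" "\<kappa> < 1" using delta_pos by (auto simp: \<kappa>_def)

text \<open>Schwarz-Pick gives the contraction where \<open>Re (G i z)\<close> is small, Bloch's theorem where it is large.\<close>
lemma deriv_G_contract:
  assumes i: "i \<in> I" and z: "Re z > 0"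
  shows "Re z * norm (deriv (G i) z) \<le> \<kappa> * Re (G i z)"
proof (cases "Re (G i z) \<le> 96")
  case True
  have "Re z * norm (deriv (G i) z) \<le> Re (G i z) - \<delta>"
    using G_range[OF i] by (intro Schwarz_Pick_HP[OF G_hol[OF i] _ z]) auto
  also have "\<dots> \<le> Re (G i z) - \<delta> / 96 * Re (G i z)"
    using True delta_pos by simp
  also have "\<dots> = (1 - \<delta> / 96) * Re (G i z)" by (simp add: algebra_simps)
  also have "\<dots> \<le> \<kappa> * Re (G i z)"
    using G_pos[OF i z] by (intro mult_right_mono) (auto simp: \<kappa>_def)
  finally show ?thesis .
next
  case False
  have "Re z * norm (deriv (G i) z) \<le> 48" by (rule deriv_G_bound[OF i z])
  also have "\<dots> \<le> 1/2 * Re (G i z)" using False by simp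
  also have "\<dots> \<le> \<kappa> * Re (G i z)" using False by (intro mult_right_mono) (auto simp: \<kappa>_def)
  finally show ?thesis .
qed

text \<open>\<open>Re z * norm (deriv (Gw w) z) / Re (Gw w z)\<close> is the derivative in the
  hyperbolic metric of the half-plane. It is multiplicative along the word, and each letter
  contributes a factor \<kappa>.\<close>

lemma deriv_Gw_contract:
  "set w \<subseteq> I \<Longrightarrow> Re z > 0 \<Longrightarrow> Re z * norm (deriv (Gw w) z) \<le> \<kappa> ^ length w * Re (Gw w z)"
proof (induction w arbitrary: z)
  case Nil
  have "Gw [] = (\<lambda>z. z)" by auto
  then show ?case by simp
next
  case (Cons i w)
  have i: "i \<in> I" "set w \<subseteq> I" using Cons.prems by auto
  have G: "Re (G i z) > 0" using Cons.prems G_pos by simp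
  have "Re z * norm (deriv (Gw (i # w)) z) = norm (deriv (Gw w) (G i z)) * (Re z * norm (deriv (G i) z))"
    using deriv_Gw_Cons[OF i Cons.prems(2)] by (simp add: norm_mult)
  also have "\<dots> \<le> norm (deriv (Gw w) (G i z)) * (\<kappa> * Re (G i z))"
    using deriv_G_contract[OF i(1) Cons.prems(2)] by (intro mult_left_mono) auto
  also have "\<dots> = \<kappa> * (Re (G i z) * norm (deriv (Gw w) (G i z)))" by simp
  also have "\<dots> \<le> \<kappa> * (\<kappa> ^ length w * Re (Gw w (G i z)))"
    using Cons.IH[OF i(2) G] kappa by (intro mult_left_mono) auto
  also have "\<dots> = \<kappa> ^ length (i # w) * Re (Gw (i # w) z)" by simp
  finally show ?case .
qed

text \<open>This turns hyperbolic contraction into Euclidean contraction: the last letter has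
  derivative at most \<open>48 / Re (Gw v z)\<close>, which cancels the factor
  \<open>Re (Gw v z)\<close> left by \<open>deriv_Gw_contract\<close>. One letter is spent on this,
  hence \<kappa> to the power \<open>n\<close> for words of length \<open>Suc n\<close>.\<close>

lemma deriv_Gw_bound:
  assumes w: "w \<in> words (Suc n)" and z: "Re z > 0"
  shows "norm (deriv (Gw w) z) \<le> 48 * \<kappa> ^ n / Re z"
proof -
  have "w \<noteq> []" using w by (auto simp: words_def)
  then obtain v i where v: "w = v @ [i]" by (metis rev_exhaust)
  have I: "set v \<subseteq> I" "i \<in> I" "length v = n" using w v by (auto simp: words_def)
  have pos: "Re (Gw v z) > 0" using Gw_pos I z by simp
  have "deriv (Gw w) z = deriv (Gw [i]) (Gw v z) * deriv (Gw v) z"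
    unfolding v using I z by (intro deriv_Gw_append) auto
  also have "Gw [i] = G i" by auto
  finally have "Re z * norm (deriv (Gw w) z) = norm (deriv (G i) (Gw v z)) * (Re z * norm (deriv (Gw v) z))"
    by (simp add: norm_mult)
  also have "\<dots> \<le> norm (deriv (G i) (Gw v z)) * (\<kappa> ^ n * Re (Gw v z))"
    using deriv_Gw_contract[OF I(1) z] I(3) by (intro mult_left_mono) auto
  also have "\<dots> = \<kappa> ^ n * (Re (Gw v z) * norm (deriv (G i) (Gw v z)))" by simp
  also have "\<dots> \<le> \<kappa> ^ n * 48"
    using deriv_G_bound[OF I(2) pos] kappa by (intro mult_left_mono) auto
  finally show ?thesis using z by (simp add: field_simps)
qed

lemma Gw_Lipschitz:
  assumes w: "w \<in> words (Suc n)" and xy: "Re x \<ge> \<delta>" "Re y \<ge> \<delta>"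
  shows "norm (Gw w x - Gw w y) \<le> (48 / \<delta>) * \<kappa> ^ n * norm (x - y)"
proof (rule field_differentiable_bound[of "{z. Re z \<ge> \<delta>}" "Gw w" "deriv (Gw w)"])
  fix z assume z: "z \<in> {z. Re z \<ge> \<delta>}"
  then have z0: "Re z > 0" using delta_pos by simp
  have "set w \<subseteq> I" using w by (simp add: words_def)
  have "(Gw w has_field_derivative deriv (Gw w) z) (at z)"
    by (rule holomorphic_derivI[OF Gw_hol[OF \<open>set w \<subseteq> I\<close>] open_HP]) (use z0 in simp)
  then show "(Gw w has_field_derivative deriv (Gw w) z) (at z within {z. \<delta> \<le> Re z})"
    by (rule has_field_derivative_at_within)
  have "norm (deriv (Gw w) z) \<le> 48 * \<kappa> ^ n / Re z" by (rule deriv_Gw_bound[OF w z0])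
  also have "\<dots> \<le> 48 * \<kappa> ^ n / \<delta>"
    using z z0 delta_pos kappa by (intro divide_left_mono mult_nonneg_nonneg) simp_all
  finally show "norm (deriv (Gw w) z) \<le> (48 / \<delta>) * \<kappa> ^ n" by simp
qed (use xy convex_halfspace_Re_ge[of \<delta>] in simp_all)

section \<open>The transfer operator in logarithmic coordinates\<close>

definition S :: "real \<Rightarrow> nat \<Rightarrow> (complex \<Rightarrow> ennreal) \<Rightarrow> complex \<Rightarrow> ennreal" where
  "S t n u z = infsum (\<lambda>w. ennreal (norm (deriv (Gw w) z) powr t) * u (Gw w z)) (words n)"

definition L :: "real \<Rightarrow> (complex \<Rightarrow> ennreal) \<Rightarrow> complex \<Rightarrow> ennreal" where
  "L t u z = infsum (\<lambda>i. ennreal (norm (deriv (G i) z) powr t) * u (G i z)) I"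

lemma S_0 [simp]: "S t 0 u z = u z"
proof -
  have "Gw [] = (\<lambda>z. z)" by auto
  then show ?thesis by (simp add: S_def)
qed

lemma S_Suc:
  assumes "Re z > 0" shows "S t (Suc n) u z = L t (S t n u) z"
proof -
  have bij: "bij_betw (\<lambda>(i, w). i # w) (I \<times> words n) (words (Suc n))"
    unfolding words_Suc bij_betw_def by (auto simp: inj_on_def)
  have "S t (Suc n) u z = infsum (\<lambda>(i, w). ennreal (norm (deriv (Gw (i # w)) z) powr t) * u (Gw (i # w) z)) (I \<times> words n)"
    unfolding S_def by (subst infsum_reindex_bij_betw[OF bij, symmetric]) (simp add: case_prod_unfold)
  also have "\<dots> = infsum (\<lambda>i. infsum (\<lambda>w. ennreal (norm (deriv (Gw (i # w)) z) powr t) * u (Gw (i # w) z)) (words n)) I"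
    by (rule infsum_Sigma_ennreal)
  also have "\<dots> = L t (S t n u) z"
    unfolding L_def S_def
  proof (rule infsum_cong)
    fix i assume i: "i \<in> I"
    have "infsum (\<lambda>w. ennreal (norm (deriv (Gw (i # w)) z) powr t) * u (Gw (i # w) z)) (words n)
        = infsum (\<lambda>w. ennreal (norm (deriv (G i) z) powr t) *
            (ennreal (norm (deriv (Gw w) (G i z)) powr t) * u (Gw w (G i z)))) (words n)"
    proof (rule infsum_cong)
      fix w assume w: "w \<in> words n"
      have "norm (deriv (Gw (i # w)) z) powr t
          = norm (deriv (G i) z) powr t * norm (deriv (Gw w) (G i z)) powr t"
        using deriv_Gw_Cons[OF i, of w z] w assms by (simp add: norm_mult powr_mult words_def)
      then show "ennreal (norm (deriv (Gw (i # w)) z) powr t) * u (Gw (i # w) z)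
          = ennreal (norm (deriv (G i) z) powr t) * (ennreal (norm (deriv (Gw w) (G i z)) powr t) * u (Gw w (G i z)))"
        by (simp add: ennreal_mult mult.assoc)
    qed
    then show "infsum (\<lambda>w. ennreal (norm (deriv (Gw (i # w)) z) powr t) * u (Gw (i # w) z)) (words n)
      = ennreal (norm (deriv (G i) z) powr t) * infsum (\<lambda>w. ennreal (norm (deriv (Gw w) (G i z)) powr t) * u (Gw w (G i z))) (words n)"
      by (simp only: infsum_cmult_ennreal)
  qed
  finally show ?thesis .
qed

lemma L_cong: "Re z > 0 \<Longrightarrow> (\<And>x. Re x > 0 \<Longrightarrow> u x = v x) \<Longrightarrow> L t u z = L t v z"
  unfolding L_def using G_pos by (intro infsum_cong) simp

text \<open>\<open>S_Suc\<close> splits off the branch applied first, this version the one applied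
  last, at the endpoint \<open>Gw w z\<close>. The endpoint is what decides whether mass escapes to
  infinity.\<close>

lemma S_Suc': "Re z > 0 \<Longrightarrow> S t (Suc n) u z = S t n (L t u) z"
proof (induction n arbitrary: z)
  case 0
  then show ?case by (simp add: S_Suc L_def)
next
  case (Suc n)
  have "S t (Suc (Suc n)) u z = L t (S t (Suc n) u) z" by (rule S_Suc[OF Suc.prems])
  also have "\<dots> = L t (S t n (L t u)) z" using Suc.prems Suc.IH by (rule L_cong)
  also have "\<dots> = S t (Suc n) (L t u) z" by (rule S_Suc[OF Suc.prems, symmetric])
  finally show ?case .
qed

text \<open>The weight is the derivative in the metric |dv|/|v|, which \<open>exp\<close> pulls back
  to the Euclidean metric. So differentiating \<open>f (exp (G i z)) = exp z\<close> shows it to be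
  the reciprocal of \<open>norm (deriv (G i) z)\<close>.\<close>

lemma cyl_deriv_G:
  assumes i: "i \<in> I" and z: "Re z > 0"
  shows "cyl_deriv f (exp (G i z)) powr (- t) = norm (deriv (G i) z) powr t"
proof -
  define v where "v = exp (G i z)"
  have "(f has_field_derivative deriv f v) (at (exp (G i z)))"
    using holomorphic_derivI[OF f_hol W_open, of v] G_W[OF i z] by (simp add: v_def)
  moreover have "((\<lambda>z. exp (G i z)) has_field_derivative exp (G i z) * deriv (G i) z) (at z)"
    using holomorphic_derivI[OF G_hol[OF i] open_HP, of z] z
    by (auto intro!: derivative_eq_intros)
  ultimately have "((\<lambda>z. f (exp (G i z))) has_field_derivative deriv f v * (exp (G i z) * deriv (G i) z)) (at z)"
    by (rule DERIV_chain2)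
  then have "(exp has_field_derivative deriv f v * (v * deriv (G i) z)) (at z)"
    unfolding v_def
    by (rule has_field_derivative_transform_within_open[OF _ open_HP[of 0]]) (use z f_G[OF i] in auto)
  then have "deriv f v * (v * deriv (G i) z) = exp z"
    by (rule DERIV_unique) simp
  then have "norm (deriv f v) * norm v * norm (deriv (G i) z) = norm (f v)"
    using f_G[OF i z] by (metis mult.assoc norm_mult v_def)
  moreover have "f v \<noteq> 0" using f_G[OF i z] by (simp add: v_def)
  ultimately have "cyl_deriv f v * norm (deriv (G i) z) = 1"
    by (simp add: cyl_deriv_def)
  then have "cyl_deriv f v = inverse (norm (deriv (G i) z))"
    by (metis inverse_unique mult.commute inverse_inverse_eq)
  then show ?thesis by (simp add: v_def powr_minus inverse_powr)
qed

lemma transfer_op_exp: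
  assumes Dom: "{v \<in> Dom. f v = exp z} = {v \<in> W. f v = exp z}" and z: "Re z > 0"
  shows "transfer_op f Dom t u (exp z) = L t (\<lambda>x. u (exp x)) z"
proof -
  have bij: "bij_betw (\<lambda>i. exp (G i z)) I {v \<in> Dom. f v = exp z}"
    unfolding Dom bij_betw_def inj_on_def using G_uniq[OF _ _ z] G_W[OF _ z] f_G[OF _ z] preimage_G by blast
  show ?thesis unfolding transfer_op_def L_def
    by (subst infsum_reindex_bij_betw[OF bij, symmetric]) (auto intro!: infsum_cong simp: cyl_deriv_G[OF _ z])
qed

lemma transfer_op_power_exp:
  assumes Dom: "\<And>z. Re z > 0 \<Longrightarrow> {v \<in> Dom. f v = exp z} = {v \<in> W. f v = exp z}"
  shows "Re z > 0 \<Longrightarrow> (transfer_op f Dom t ^^ n) u (exp z) = S t n (\<lambda>x. u (exp x)) z"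
proof (induction n arbitrary: z)
  case (Suc n)
  have "(transfer_op f Dom t ^^ Suc n) u (exp z) = L t (\<lambda>x. (transfer_op f Dom t ^^ n) u (exp x)) z"
    using transfer_op_exp[OF Dom Suc.prems] Suc.prems by simp
  also have "\<dots> = L t (S t n (\<lambda>x. u (exp x))) z" using Suc.prems Suc.IH by (rule L_cong)
  finally show ?case using S_Suc[OF Suc.prems] by simp
qed simp

lemma S_mono: "(\<And>w. w \<in> words n \<Longrightarrow> u (Gw w z) \<le> v (Gw w z)) \<Longrightarrow> S t n u z \<le> S t n v z"
  unfolding S_def by (intro infsum_mono_ennreal mult_left_mono) auto

lemma S_cmult: "S t n (\<lambda>x. c * u x) z = c * S t n u z"
  unfolding S_def by (subst infsum_cmult_ennreal[symmetric]) (simp add: mult.left_commute)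

lemma S_add: "S t n (\<lambda>x. u x + v x) z = S t n u z + S t n v z"
  unfolding S_def by (subst infsum_add[symmetric]) (auto simp: distrib_left intro: summable_on_ennreal_any)

end

section \<open>The upper bound\<close>

lemma exp_Lipschitz:
  assumes "Re x \<le> \<rho>" "Re y \<le> \<rho>"
  shows "norm (exp x - exp y) \<le> exp \<rho> * norm (x - y)"
proof (rule field_differentiable_bound[of "{z. Re z \<le> \<rho>}" exp exp])
  show "(exp has_field_derivative exp z) (at z within {z. Re z \<le> \<rho>})" for z :: complex
    by (rule has_field_derivative_at_within) (rule DERIV_exp)
  show "norm (exp z) \<le> exp \<rho>" if "z \<in> {z. Re z \<le> \<rho>}" for z :: complex
    using that by (simp add: norm_exp_eq_Re)
qed (use assms convex_halfspace_Re_le in simp_all)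

lemma frequently_of_liminf_less:
  fixes x :: "nat \<Rightarrow> real"
  assumes "liminf (\<lambda>n. ereal (x n)) < \<infinity>"
  shows "\<exists>K::nat. \<exists>\<^sub>\<infinity>n. x n \<le> real K"
proof (rule ccontr)
  assume none: "\<not> ?thesis"
  have le: "ereal (real K) \<le> liminf (\<lambda>n. ereal (x n))" for K
  proof (rule Liminf_bounded)
    have "\<forall>\<^sub>F n in sequentially. \<not> x n \<le> real K"
      using none by (simp add: frequently_def cofinite_eq_sequentially)
    then show "\<forall>\<^sub>F n in sequentially. ereal (real K) \<le> ereal (x n)" by (rule eventually_mono) simp
  qed
  have "liminf (\<lambda>n. ereal (x n)) = \<infinity>"
  proof (rule ereal_top)
    fix B :: real
    obtain K :: nat where "B \<le> real K" using real_arch_simple by blast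
    then have "ereal B \<le> ereal (real K)" by simp
    then show "ereal B \<le> liminf (\<lambda>n. ereal (x n))" using le[of K] by (rule order_trans)
  qed
  then show False using assms by simp
qed

lemma eventually_power_less:
  fixes q :: real
  assumes "0 < q" "q < 1" "e > 0"
  shows "\<forall>\<^sub>F n in sequentially. c * q ^ n < e"
proof -
  have "(\<lambda>n. c * q ^ n) \<longlonglongrightarrow> c * 0"
    using assms by (intro tendsto_intros LIMSEQ_realpow_zero) auto
  then show ?thesis using assms(3) by (intro order_tendstoD(2)) auto
qed

context tract_system
begin

lemma W_Ln:
  assumes "v \<in> W"
  shows "exp (Ln v) = v" "Re (Ln v) > \<delta>" "\<bar>Im (Ln v)\<bar> \<le> pi"
proof -
  obtain j z where j: "j < N" "Re z > 0" "v = exp (g j z)" using W_g[OF assms] by blast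
  have v0: "v \<noteq> 0" using j by simp
  then show "exp (Ln v) = v" by simp
  have "Re (Ln v) = Re (g j z)" using v0 j by (simp add: Re_Ln norm_exp_eq_Re)
  then show "Re (Ln v) > \<delta>" using g_range[OF j(1,2)] by simp
  show "\<bar>Im (Ln v)\<bar> \<le> pi" using mpi_less_Im_Ln[OF v0] Im_Ln_le_pi[OF v0] by simp
qed

lemma Gw_Lipschitz_ball:
  assumes "set w \<subseteq> I" "ball c r \<subseteq> HP 0" "p \<in> ball c r" "q \<in> ball c r"
    and "\<And>x. x \<in> ball c r \<Longrightarrow> norm (deriv (Gw w) x) \<le> B"
  shows "norm (Gw w p - Gw w q) \<le> B * norm (p - q)"
proof (rule field_differentiable_bound[of "ball c r" "Gw w" "deriv (Gw w)"])
  fix x assume "x \<in> ball c r"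
  then have "(Gw w has_field_derivative deriv (Gw w) x) (at x)"
    using assms(2) by (intro holomorphic_derivI[OF Gw_hol[OF assms(1)] open_HP]) blast
  then show "(Gw w has_field_derivative deriv (Gw w) x) (at x within ball c r)"
    by (rule has_field_derivative_at_within)
qed (use assms in simp_all)

text \<open>Vanishing pressure over the base point \<open>exp z\<close>, in logarithmic coordinates.
  Positivity and finiteness are required because \<open>enn2real\<close> sends \<infinity> to 0 and
  the logarithm of 0 would carry no information.\<close>

definition subexponential :: "real \<Rightarrow> complex \<Rightarrow> bool" where
  "subexponential h z \<longleftrightarrow> (\<forall>n. 0 < S h n (\<lambda>_. 1) z \<and> S h n (\<lambda>_. 1) z < \<infinity>) \<and>
    (\<lambda>n. ln (enn2real (S h n (\<lambda>_. 1) z)) / real n) \<longlonglongrightarrow> 0"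

lemma S_growth:
  assumes sub: "subexponential h z"
  shows "q > 1 \<Longrightarrow> \<forall>\<^sub>F n in sequentially. S h n (\<lambda>_. 1) z \<le> ennreal (q ^ n)"
    and "0 < q \<Longrightarrow> q < 1 \<Longrightarrow> \<forall>\<^sub>F n in sequentially. ennreal (q ^ n) \<le> S h n (\<lambda>_. 1) z"
proof -
  define a where "a n = enn2real (S h n (\<lambda>_. 1) z)" for n
  have a: "S h n (\<lambda>_. 1) z = ennreal (a n)" "a n > 0" for n
    using sub by (auto simp: a_def enn2real_positive_iff subexponential_def)
  have lim': "(\<lambda>n. ln (a n) / real n) \<longlonglongrightarrow> 0" using sub by (simp add: a_def subexponential_def)
  show "\<forall>\<^sub>F n in sequentially. S h n (\<lambda>_. 1) z \<le> ennreal (q ^ n)" if q: "q > 1"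
  proof -
    have "\<forall>\<^sub>F n in sequentially. ln (a n) / real n < ln q"
      using q by (intro order_tendstoD(2)[OF lim']) simp
    then show ?thesis using eventually_gt_at_top[of 0]
    proof eventually_elim
      case (elim n)
      have "ln (a n) < real n * ln q" using elim by (simp add: field_simps)
      also have "\<dots> = ln (q ^ n)" using q by (simp add: ln_realpow)
      finally have "a n < q ^ n" using a(2)[of n] q by simp
      then show ?case unfolding a by (intro ennreal_leI) simp
    qed
  qed
  show "\<forall>\<^sub>F n in sequentially. ennreal (q ^ n) \<le> S h n (\<lambda>_. 1) z" if q: "0 < q" "q < 1"
  proof -
    have "\<forall>\<^sub>F n in sequentially. ln q < ln (a n) / real n"
      using q by (intro order_tendstoD(1)[OF lim']) simp
    then show ?thesis using eventually_gt_at_top[of 0]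
    proof eventually_elim
      case (elim n)
      have "ln (q ^ n) = real n * ln q" using q by (simp add: ln_realpow)
      also have "\<dots> < ln (a n)" using elim by (simp add: field_simps)
      finally have "q ^ n < a n" using a(2)[of n] q by simp
      then show ?case unfolding a by (intro ennreal_leI) simp
    qed
  qed
qed

text \<open>The trade between exponents. The upper bound uses it with \<open>s\<close> above the
  zero of the pressure; the lower bound uses it with \<open>h\<close> in the role of
  \<open>s\<close> and the smaller exponent in the role of \<open>h\<close>.\<close>

lemma deriv_powr_le:
  assumes w: "w \<in> words (Suc n)" and z: "Re z > 0" and hs: "h \<le> s"
  shows "norm (deriv (Gw w) z) powr s \<le> (48 * \<kappa> ^ n / Re z) powr (s - h) * norm (deriv (Gw w) z) powr h"
proof -
  have "norm (deriv (Gw w) z) powr s = norm (deriv (Gw w) z) powr (s - h) * norm (deriv (Gw w) z) powr h"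
    by (simp add: powr_add[symmetric])
  also have "\<dots> \<le> (48 * \<kappa> ^ n / Re z) powr (s - h) * norm (deriv (Gw w) z) powr h"
    using deriv_Gw_bound[OF w z] hs by (intro mult_right_mono powr_mono2) auto
  finally show ?thesis .
qed

text \<open>At each return to norm at most \<open>K\<close> the logarithm of the orbit lies in a
  compact rectangle. A finite cover of that rectangle by discs, pulled back along the branches,
  covers the set by pieces of diameter at most a constant times
  \<open>norm (deriv (Gw w) z0)\<close>.\<close>

lemma hausdorff_measure_bounded_part_eq_0:
  fixes K :: real
  assumes h: "0 < h" "h < s" and z0: "Re z0 > 0"
    and sub: "subexponential h z0"
    and K: "K \<ge> 1"
  shows "hausdorff_measure s {u. (\<forall>n. (f ^^ n) u \<in> W) \<and> norm u \<le> K \<and> (\<exists>\<^sub>\<infinity>n. norm ((f ^^ n) u) \<le> K)} = 0"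
    (is "hausdorff_measure s ?A = 0")
proof -
  define r where "r = \<delta> / 4"
  have r: "r > 0" using delta_pos by (simp add: r_def)
  define P where "P = cbox (Complex \<delta> (- pi)) (Complex (ln K) pi)"
  have "compact P" by (simp add: P_def)
  moreover have "P \<subseteq> (\<Union>c\<in>P. ball c r)" using r by auto
  ultimately obtain C where C: "C \<subseteq> P" "finite C" "P \<subseteq> (\<Union>c\<in>C. ball c r)"
    using compactE_image[of P P "\<lambda>c. ball c r"] by auto
  obtain c :: "nat \<Rightarrow> complex" and m where c: "C = c ` {..<m}"
    using C(2) by (metis finite_imp_nat_seg_image_inj_on lessThan_def)
  have cP: "Re (c i) \<ge> \<delta>" "c i \<in> P" if "i < m" for i
    using that C(1) c by (auto simp: P_def in_cbox_complex_iff image_subset_iff)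
  \<comment> \<open>The discs have radius \<delta>/4 and centres with real part at least \<delta>,
    so real parts stay above \<delta>/2 on them. \<open>Re z0\<close> enters because every
    derivative is compared with the one at \<open>z0\<close>.\<close>
  define d where "d = min (\<delta> / 2) (Re z0)"
  have d: "d > 0" using z0 delta_pos by (simp add: d_def)
  obtain M where M: "\<And>x. x \<in> P \<Longrightarrow> dist z0 x \<le> M"
    using \<open>compact P\<close> compact_imp_bounded bounded_any_center[of P z0] by metis
  obtain K1 where K1: "K1 \<ge> 1" "\<And>g a b. g holomorphic_on HP 0 \<Longrightarrow> inj_on g (HP 0) \<Longrightarrow> Re a \<ge> d \<Longrightarrow> Re b \<ge> d
      \<Longrightarrow> dist a b \<le> M + r \<Longrightarrow> norm (deriv g b) \<le> K1 * norm (deriv g a)"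
    using univalent_distortion_HP[OF d, of "M + r"] by blast
  have near: "Re x \<ge> d" "dist z0 x \<le> M + r" if "i < m" "x \<in> ball (c i) r" for i x
  proof -
    have "\<bar>Re (c i - x)\<bar> < r" using that(2) abs_Re_le_cmod[of "c i - x"] by (simp add: dist_norm)
    then have "Re x \<ge> \<delta> - \<delta>/4" using cP(1)[OF that(1)] unfolding r_def minus_complex.simps by linarith
    then show "Re x \<ge> d" using delta_pos by (simp add: d_def)
    show "dist z0 x \<le> M + r"
      using dist_triangle[of z0 x "c i"] M[OF cP(2)[OF that(1)]] that(2) by simp
  qed
  define D where "D = K * (K1 * (2 * r))"
  have D: "D > 0" using K K1(1) r by (simp add: D_def)
  \<comment> \<open>Cutting with \<open>cball 0 K\<close> bounds the real part of
    \<open>Gw w p\<close> by \<open>ln K\<close>, and there \<open>exp\<close> has Lipschitz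
    constant \<open>K\<close>.\<close>
  define U where "U w i = exp ` Gw w ` ball (c i) r \<inter> cball 0 K" for w i
  have Udist: "norm (x - y) \<le> D * norm (deriv (Gw w) z0)"
    if w: "set w \<subseteq> I" and i: "i < m" and xy: "x \<in> U w i" "y \<in> U w i" for w i x y
  proof -
    obtain p q where pq: "p \<in> ball (c i) r" "q \<in> ball (c i) r" "x = exp (Gw w p)" "y = exp (Gw w q)"
      using xy by (auto simp: U_def)
    have "exp (Re (Gw w p)) \<le> K" "exp (Re (Gw w q)) \<le> K"
      using xy pq by (auto simp: U_def norm_exp_eq_Re)
    then have re: "Re (Gw w p) \<le> ln K" "Re (Gw w q) \<le> ln K"
      using K by (simp_all add: ln_ge_iff)
    have "norm (Gw w p - Gw w q) \<le> (K1 * norm (deriv (Gw w) z0)) * norm (p - q)"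
    proof (rule Gw_Lipschitz_ball[OF w _ pq(1,2)])
      show "ball (c i) r \<subseteq> HP 0" using near(1)[OF i] d by (metis HP_iff order_less_le_trans subsetI)
      fix x assume x: "x \<in> ball (c i) r"
      show "norm (deriv (Gw w) x) \<le> K1 * norm (deriv (Gw w) z0)"
        using near[OF i x] by (intro K1(2) Gw_hol Gw_inj w) (auto simp: d_def)
    qed
    also have "\<dots> \<le> (K1 * norm (deriv (Gw w) z0)) * (2 * r)"
    proof (rule mult_left_mono)
      have "dist p q \<le> dist (c i) p + dist (c i) q" by (metis dist_commute dist_triangle)
      then show "norm (p - q) \<le> 2 * r" using pq by (simp add: dist_norm)
    qed (use K1(1) in simp)
    finally have "norm (Gw w p - Gw w q) \<le> (K1 * norm (deriv (Gw w) z0)) * (2 * r)" .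
    moreover have "norm (x - y) \<le> exp (ln K) * norm (Gw w p - Gw w q)"
      unfolding pq using re by (rule exp_Lipschitz)
    ultimately have "norm (x - y) \<le> K * ((K1 * norm (deriv (Gw w) z0)) * (2 * r))"
      using K mult_left_mono[of "norm (Gw w p - Gw w q)" "(K1 * norm (deriv (Gw w) z0)) * (2 * r)" K]
      by (simp add: order_trans)
    then show ?thesis by (simp add: D_def mult_ac)
  qed
  have Ubdd: "bounded (U w i)" for w i
    unfolding U_def by (rule bounded_Int) simp
  have Udiam: "diameter (U w i) \<le> D * norm (deriv (Gw w) z0)" if "set w \<subseteq> I" "i < m" for w i
    using D Udist[OF that] by (intro diameter_le) auto
  define b where "b = 48 / Re z0"
  have b: "b > 0" using z0 by (simp add: b_def)
  \<comment> \<open>Half of the gain: the surplus exponent contributes \<open>q ^ (2 * n)\<close>,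
    the subexponential sum at most \<open>(1/q) ^ Suc n\<close>, and a summable multiple of
    \<open>q ^ n\<close> remains.\<close>
  define q where "q = \<kappa> powr ((s - h) / 2)"
  have q: "0 < q" "q < 1" using kappa h by (auto simp: q_def powr_def mult_pos_neg)
  define E where "E = D powr s * b powr (s - h)"
  have E: "E > 0" using D b by (simp add: E_def)
  have ev1: "\<forall>\<^sub>F n in sequentially. S h n (\<lambda>_. 1) z0 \<le> ennreal ((1/q) ^ n)"
    by (rule S_growth(1)[OF sub]) (use q in simp)
  have sum_n: "infsum (\<lambda>w. ennreal (diameter (U w i) powr s)) (words (Suc n)) \<le> ennreal ((E / q) * q ^ n)"
    if n: "S h (Suc n) (\<lambda>_. 1) z0 \<le> ennreal ((1/q) ^ Suc n)" and i: "i < m" for n i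
  proof -
    have "infsum (\<lambda>w. ennreal (diameter (U w i) powr s)) (words (Suc n))
        \<le> infsum (\<lambda>w. ennreal (E * (q ^ n)\<^sup>2) * (ennreal (norm (deriv (Gw w) z0) powr h) * 1)) (words (Suc n))"
    proof (rule infsum_mono_ennreal)
      fix w assume w: "w \<in> words (Suc n)"
      then have wI: "set w \<subseteq> I" by (simp add: words_def)
      have "diameter (U w i) powr s \<le> (D * norm (deriv (Gw w) z0)) powr s"
        using Udiam[OF wI i] h Ubdd by (intro powr_mono2 diameter_ge_0) auto
      also have "\<dots> = D powr s * norm (deriv (Gw w) z0) powr s" using D by (simp add: powr_mult)
      also have "\<dots> \<le> D powr s * ((48 * \<kappa> ^ n / Re z0) powr (s - h) * norm (deriv (Gw w) z0) powr h)"
        using deriv_powr_le[OF w z0, of h s] h by (intro mult_left_mono) auto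
      also have "(48 * \<kappa> ^ n / Re z0) powr (s - h) = (b * \<kappa> ^ n) powr (s - h)" by (simp add: b_def)
      also have "\<dots> = b powr (s - h) * (\<kappa> powr (s - h)) ^ n"
        using b kappa by (simp add: powr_mult powr_realpow[symmetric] powr_powr mult.commute)
      also have "\<kappa> powr (s - h) = q\<^sup>2"
        using kappa by (simp add: q_def power2_eq_square powr_add[symmetric])
      finally have "diameter (U w i) powr s \<le> E * (q ^ n)\<^sup>2 * norm (deriv (Gw w) z0) powr h"
        by (simp add: E_def power_mult[symmetric] mult_ac)
      then show "ennreal (diameter (U w i) powr s)
          \<le> ennreal (E * (q ^ n)\<^sup>2) * (ennreal (norm (deriv (Gw w) z0) powr h) * 1)"
        using E by (simp add: ennreal_mult[symmetric] ennreal_leI)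
    qed
    also have "\<dots> = ennreal (E * (q ^ n)\<^sup>2) * S h (Suc n) (\<lambda>_. 1) z0"
      unfolding S_def by (rule infsum_cmult_ennreal)
    also have "\<dots> \<le> ennreal (E * (q ^ n)\<^sup>2) * ennreal ((1/q) ^ Suc n)"
      using n by (rule mult_left_mono) simp
    also have "\<dots> = ennreal ((E / q) * q ^ n)"
      using E q by (simp add: ennreal_mult[symmetric] power2_eq_square field_simps)
    finally show ?thesis .
  qed
  show ?thesis unfolding hausdorff_measure_eq_0_iff
  proof (intro allI impI)
    fix \<eta> :: real assume \<eta>: "\<eta> > 0"
    have "hausdorff_content \<eta> s ?A \<le> 0 + ennreal e" if e: "e > 0" for e
    proof -
      have "\<forall>\<^sub>F n in sequentially. D * (b * \<kappa> ^ n) < \<eta>"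
        using eventually_power_less[OF kappa \<eta>, of "D * b"] by (simp only: mult.assoc)
      moreover have "\<forall>\<^sub>F n in sequentially. real m * (E / q / (1 - q)) * q ^ n < e"
        by (rule eventually_power_less[OF q e])
      moreover have "\<forall>\<^sub>F n in sequentially. S h (Suc n) (\<lambda>_. 1) z0 \<le> ennreal ((1/q) ^ Suc n)"
        using ev1 by (subst eventually_sequentially_Suc)
      ultimately have "\<forall>\<^sub>F n in sequentially. D * (b * \<kappa> ^ n) < \<eta> \<and> real m * (E / q / (1 - q)) * q ^ n < e \<and>
          S h (Suc n) (\<lambda>_. 1) z0 \<le> ennreal ((1/q) ^ Suc n)"
        by eventually_elim blast
      then obtain n0 where n0: "\<And>n. n \<ge> n0 \<Longrightarrow> D * (b * \<kappa> ^ n) < \<eta> \<and> real m * (E / q / (1 - q)) * q ^ n < e \<and>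
          S h (Suc n) (\<lambda>_. 1) z0 \<le> ennreal ((1/q) ^ Suc n)"
        unfolding eventually_sequentially by blast
      \<comment> \<open>Return times differ from point to point, so words of every length beyond
        \<open>n0\<close> enter the cover; the geometric decay in the length keeps the total
        small.\<close>
      define J where "J = Sigma (UNIV :: nat set) (\<lambda>n. {..<m} \<times> words (Suc (n + n0)))"
      have "hausdorff_content \<eta> s ?A \<le> infsum (\<lambda>(n, i, w). ennreal (diameter (U w i) powr s)) J"
      proof -
        have "hausdorff_content \<eta> s ?A
            \<le> infsum (\<lambda>p. ennreal (diameter ((\<lambda>(n, i, w). U w i) p) powr s)) J"
        proof (rule hausdorff_content_le_infsum)
          show "?A \<subseteq> (\<Union>p\<in>J. (\<lambda>(n, i, w). U w i) p)"
          proof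
            fix u assume u: "u \<in> ?A"
            then obtain n where n: "n > n0" "norm ((f ^^ n) u) \<le> K"
              using INFM_nat[of "\<lambda>n. norm ((f ^^ n) u) \<le> K"] by blast
            define v where "v = (f ^^ n) u"
            have vW: "v \<in> W" using u by (simp add: v_def)
            have "norm v > 0" using W_Ln(1)[OF vW] by (metis exp_not_eq_zero zero_less_norm_iff)
            then have "Re (Ln v) \<le> ln K" using n(2) K by (simp add: v_def)
            then have "Ln v \<in> P"
              using W_Ln(2,3)[OF vW] by (auto simp: P_def in_cbox_complex_iff abs_le_iff)
            then obtain i where i: "i < m" "Ln v \<in> ball (c i) r" using C(3) c by blast
            have "Re (Ln v) > 0" using W_Ln(2)[OF vW] delta_pos by simp
            moreover have "(f ^^ n) u = exp (Ln v)" using W_Ln(1)[OF vW] by (simp add: v_def)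
            ultimately obtain w where w: "w \<in> words n" "u = exp (Gw w (Ln v))"
              using preimage_Gw[of n u "Ln v"] u by blast
            have "u \<in> U w i" using i(2) w(2) u by (auto simp: U_def)
            moreover have "(n - Suc n0, i, w) \<in> J" using i w n(1) by (simp add: J_def)
            ultimately show "u \<in> (\<Union>p\<in>J. (\<lambda>(n, i, w). U w i) p)" by (intro UN_I) auto
          qed
          fix p assume "p \<in> J"
          then obtain n i w where p: "p = (n, i, w)" "i < m" "w \<in> words (Suc (n + n0))" by (auto simp: J_def)
          have wI: "set w \<subseteq> I" using p by (simp add: words_def)
          have "diameter (U w i) \<le> D * norm (deriv (Gw w) z0)" by (rule Udiam[OF wI p(2)])
          also have "\<dots> \<le> D * (b * \<kappa> ^ (n + n0))"
            using deriv_Gw_bound[OF p(3) z0] D by (intro mult_left_mono) (auto simp: b_def)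
          also have "\<dots> < \<eta>" using n0[of "n + n0"] by simp
          finally show "bounded ((\<lambda>(n, i, w). U w i) p) \<and> diameter ((\<lambda>(n, i, w). U w i) p) \<le> \<eta>"
            using Ubdd p(1) by simp
        qed (use \<eta> in simp)
        then show ?thesis by (simp add: case_prod_unfold)
      qed
      also have "\<dots> = infsum (\<lambda>n. infsum (\<lambda>(i, w). ennreal (diameter (U w i) powr s)) ({..<m} \<times> words (Suc (n + n0)))) UNIV"
        unfolding J_def by (rule infsum_Sigma_ennreal)
      also have "\<dots> \<le> infsum (\<lambda>n. ennreal (real m * ((E / q) * q ^ (n + n0)))) UNIV"
      proof (rule infsum_mono_ennreal)
        fix n :: nat
        have "infsum (\<lambda>(i, w). ennreal (diameter (U w i) powr s)) ({..<m} \<times> words (Suc (n + n0)))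
            = infsum (\<lambda>i. infsum (\<lambda>w. ennreal (diameter (U w i) powr s)) (words (Suc (n + n0)))) {..<m}"
          by (rule infsum_Sigma_ennreal)
        also have "\<dots> = (\<Sum>i<m. infsum (\<lambda>w. ennreal (diameter (U w i) powr s)) (words (Suc (n + n0))))"
          by simp
        also have "\<dots> \<le> (\<Sum>i<m. ennreal ((E / q) * q ^ (n + n0)))"
          using n0[of "n + n0"] by (intro sum_mono sum_n) auto
        also have "\<dots> = ennreal (real m * ((E / q) * q ^ (n + n0)))"
          using E q by (simp add: ennreal_of_nat_eq_real_of_nat ennreal_mult[symmetric])
        finally show "infsum (\<lambda>(i, w). ennreal (diameter (U w i) powr s)) ({..<m} \<times> words (Suc (n + n0)))
          \<le> ennreal (real m * ((E / q) * q ^ (n + n0)))" .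
      qed
      also have "\<dots> \<le> (\<Sum>n. ennreal (real m * ((E / q) * q ^ (n + n0))))"
        by (rule infsum_nat_le_suminf_ennreal)
      also have "\<dots> = ennreal (real m * ((E / q) * q ^ n0) * (1 / (1 - q)))"
      proof (rule suminf_ennreal_eq)
        have "(\<lambda>n. real m * ((E / q) * q ^ n0) * q ^ n) sums (real m * ((E / q) * q ^ n0) * (1 / (1 - q)))"
          using q by (intro sums_mult geometric_sums) simp
        then show "(\<lambda>n. real m * ((E / q) * q ^ (n + n0))) sums (real m * ((E / q) * q ^ n0) * (1 / (1 - q)))"
          by (simp add: power_add mult_ac)
      qed (use E q in simp)
      also have "\<dots> \<le> ennreal e"
        using n0[of n0] by (intro ennreal_leI) (simp add: mult_ac)
      finally show ?thesis by simp
    qed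
    then have "hausdorff_content \<eta> s ?A \<le> 0" by (rule ennreal_le_epsilon)
    then show "hausdorff_content \<eta> s ?A = 0" by simp
  qed
qed

lemma hausdorff_measure_upper:
  assumes h: "0 < h" "h < s" and z0: "Re z0 > 0"
    and sub: "subexponential h z0"
  shows "hausdorff_measure s {u. (\<forall>n. (f ^^ n) u \<in> W) \<and> liminf (\<lambda>n. ereal (norm ((f ^^ n) u))) < \<infinity>} = 0"
proof -
  define A where "A K = {u. (\<forall>n. (f ^^ n) u \<in> W) \<and> norm u \<le> K \<and> (\<exists>\<^sub>\<infinity>n. norm ((f ^^ n) u) \<le> K)}" for K :: real
  have "hausdorff_measure s (\<Union>k. A (real (Suc k))) = 0"
    unfolding A_def
    by (intro hausdorff_measure_0_UN hausdorff_measure_bounded_part_eq_0[OF h z0 sub]) simp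
  moreover have "{u. (\<forall>n. (f ^^ n) u \<in> W) \<and> liminf (\<lambda>n. ereal (norm ((f ^^ n) u))) < \<infinity>} \<subseteq> (\<Union>k. A (real (Suc k)))"
  proof
    fix u assume "u \<in> {u. (\<forall>n. (f ^^ n) u \<in> W) \<and> liminf (\<lambda>n. ereal (norm ((f ^^ n) u))) < \<infinity>}"
    then have u: "\<forall>n. (f ^^ n) u \<in> W" "liminf (\<lambda>n. ereal (norm ((f ^^ n) u))) < \<infinity>" by auto
    obtain k where k: "\<exists>\<^sub>\<infinity>n. norm ((f ^^ n) u) \<le> real k" using frequently_of_liminf_less[OF u(2)] by blast
    obtain l where l: "norm u \<le> real l" using real_arch_simple by blast
    have "real k \<le> real (Suc (max k l))" "real l \<le> real (Suc (max k l))" by auto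
    then have "\<exists>\<^sub>\<infinity>n. norm ((f ^^ n) u) \<le> real (Suc (max k l))" "norm u \<le> real (Suc (max k l))"
      using k l by (auto elim!: frequently_elim1 intro: order_trans)
    then have "u \<in> A (real (Suc (max k l)))" using u(1) by (simp add: A_def)
    then show "u \<in> (\<Union>k. A (real (Suc k)))" by blast
  qed
  ultimately show ?thesis using hausdorff_measure_0_mono by blast
qed

end

section \<open>The lower bound\<close>

text \<open>On the disc of radius \<open>dist a y\<close> about \<open>a\<close> the function omits the value \<open>g y\<close>.\<close>
lemma univalent_lower_bound:
  assumes hol: "g holomorphic_on ball a r" and inj: "inj_on g (ball a r)" and y: "y \<in> ball a r"
  shows "norm (deriv g a) * dist a y \<le> 48 * norm (g a - g y)"
proof (cases "y = a")
  case False
  define t where "t = dist a y"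
  have t: "0 < t" "t < r" using False y by (auto simp: t_def)
  have sub: "ball a t \<subseteq> ball a r" using t by (intro subset_ball) simp
  have "g y \<notin> g ` ball a t"
  proof
    assume "g y \<in> g ` ball a t"
    then obtain x where "x \<in> ball a t" "g y = g x" by blast
    then have "y = x" using inj_onD[OF inj, of y x] y sub by blast
    then show False using \<open>x \<in> ball a t\<close> by (simp add: t_def)
  qed
  then obtain F where F: "F holomorphic_on ball a t" "\<And>z. z \<in> ball a t \<Longrightarrow> g z - g y = exp (F z)"
      "\<And>z. z \<in> ball a t \<Longrightarrow> (t - dist a z) * norm (deriv F z) \<le> 48"
    using deriv_log_of_inj[of g a t "g y"] holomorphic_on_subset[OF hol sub] inj_on_subset[OF inj sub] t
    by auto
  have a: "a \<in> ball a t" using t by simp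
  have "(F has_field_derivative deriv F a) (at a)" by (rule holomorphic_derivI[OF F(1) open_ball a])
  then have "((\<lambda>z. exp (F z)) has_field_derivative exp (F a) * deriv F a) (at a)"
    by (auto intro!: derivative_eq_intros)
  then have "((\<lambda>z. g z - g y) has_field_derivative exp (F a) * deriv F a) (at a)"
    by (rule has_field_derivative_transform_within_open[OF _ open_ball a]) (simp add: F(2))
  moreover have "(g has_field_derivative deriv g a) (at a)"
    using t by (intro holomorphic_derivI[OF hol open_ball]) simp
  then have "((\<lambda>z. g z - g y) has_field_derivative deriv g a) (at a)"
    by (auto intro!: derivative_eq_intros)
  ultimately have "deriv g a = (g a - g y) * deriv F a"
    using DERIV_unique F(2)[OF a] by metis
  then have "norm (deriv g a) * t = norm (g a - g y) * (t * norm (deriv F a))"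
    by (simp add: norm_mult)
  also have "\<dots> \<le> norm (g a - g y) * 48"
    using F(3)[OF a] by (intro mult_left_mono) auto
  finally show ?thesis by (simp add: t_def)
qed simp

lemma exp_inj_near:
  fixes x y :: complex
  assumes "exp x = exp y" "dist x y < 6"
  shows "x = y"
proof -
  obtain n :: int where n: "x = y + of_real (of_int (2 * n) * pi) * \<i>" using assms(1) exp_eq by blast
  have "n = 0"
  proof (rule ccontr)
    assume "n \<noteq> 0"
    then have "\<bar>real_of_int n\<bar> \<ge> 1" by linarith
    then have "2 * pi \<le> 2 * pi * \<bar>real_of_int n\<bar>" by simp
    also have "\<dots> = dist x y" by (simp add: n dist_norm norm_mult abs_mult)
    finally show False using assms(2) pi_gt3 by simp
  qed
  then show ?thesis using n by simp
qed

text \<open>Points of \<open>ball x 1\<close> are less than 2 < 2 * pi apart, so \<open>exp\<close>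
  is univalent there, and \<open>Re x \<ge> 0\<close> makes its derivative at \<open>x\<close> at
  least 1 in modulus.\<close>

lemma exp_lower_bound:
  fixes x y :: complex
  assumes "Re x \<ge> 0" "dist x y < 1"
  shows "dist x y \<le> 48 * norm (exp x - exp y)"
proof -
  have "inj_on exp (ball x 1)"
  proof (rule inj_onI)
    fix a b assume "a \<in> ball x 1" "b \<in> ball x 1" "exp a = exp b"
    moreover have "dist a b \<le> dist x a + dist x b" by (metis dist_commute dist_triangle)
    ultimately have "exp a = exp b" "dist a b < 6" by simp_all
    then show "a = b" by (rule exp_inj_near)
  qed
  then have "norm (deriv exp x) * dist x y \<le> 48 * norm (exp x - exp y)"
    using assms(2) by (intro univalent_lower_bound[of exp x 1]) (auto intro: holomorphic_intros)
  moreover have "norm (deriv exp x) = exp (Re x)"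
    by (simp only: DERIV_imp_deriv[OF DERIV_exp] norm_exp_eq_Re)
  moreover have "1 * dist x y \<le> exp (Re x) * dist x y" using assms(1) by (intro mult_right_mono) auto
  ultimately show ?thesis by simp
qed

lemma exists_period_shift: "\<exists>k::int. \<bar>t + 2 * pi * of_int k\<bar> \<le> pi"
proof -
  define k where "k = - \<lfloor>(t + pi) / (2 * pi)\<rfloor>"
  have "of_int (- k) \<le> (t + pi) / (2 * pi)" unfolding k_def by simp
  then have "of_int (- k) * (2 * pi) \<le> t + pi" using pi_gt_zero by (subst (asm) pos_le_divide_eq) simp_all
  moreover have "(t + pi) / (2 * pi) < of_int (- k) + 1" unfolding k_def by linarith
  then have "t + pi < (of_int (- k) + 1) * (2 * pi)" using pi_gt_zero by (subst (asm) pos_divide_less_eq) simp_all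
  ultimately have "- pi \<le> t + 2 * pi * of_int k" "t + 2 * pi * of_int k \<le> pi"
    by (simp_all add: algebra_simps)
  then show ?thesis by (intro exI[of _ k]) (simp add: abs_le_iff)
qed

lemma compact_family_separated:
  fixes B :: "'i \<Rightarrow> complex set"
  assumes "finite E" "\<And>i. i \<in> E \<Longrightarrow> compact (B i)"
    and "\<And>i j. i \<in> E \<Longrightarrow> j \<in> E \<Longrightarrow> i \<noteq> j \<Longrightarrow> B i \<inter> B j = {}"
  shows "\<exists>d>0. \<forall>i\<in>E. \<forall>j\<in>E. i \<noteq> j \<longrightarrow> (\<forall>x\<in>B i. \<forall>y\<in>B j. d \<le> dist x y)"
proof -
  define R where "R p d \<longleftrightarrow> d > 0 \<and> (\<forall>x\<in>B (fst p). \<forall>y\<in>B (snd p). d \<le> dist x y)" for p and d :: real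
  have "\<exists>d. R p d" if "p \<in> {p \<in> E \<times> E. fst p \<noteq> snd p}" for p
    unfolding R_def
  proof (rule separate_compact_closed)
    have "fst p \<in> E" "snd p \<in> E" "fst p \<noteq> snd p" using that by auto
    then show "compact (B (fst p))" "closed (B (snd p))" "B (fst p) \<inter> B (snd p) = {}"
      using assms(2) compact_imp_closed assms(3) by blast+
  qed
  then obtain D where D': "\<And>p. p \<in> {p \<in> E \<times> E. fst p \<noteq> snd p} \<Longrightarrow> R p (D p)" by metis
  note D = D'[unfolded R_def]
  \<comment> \<open>The 1 keeps the set nonempty when there is no pair of distinct indices.\<close>
  define d where "d = Min (insert 1 (D ` {p \<in> E \<times> E. fst p \<noteq> snd p}))"
  have fin: "finite (insert 1 (D ` {p \<in> E \<times> E. fst p \<noteq> snd p}))" using assms(1) by simp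
  have "0 < y" if "y \<in> insert 1 (D ` {p \<in> E \<times> E. fst p \<noteq> snd p})" for y
    using that
  proof (elim insertE imageE)
    fix p assume "y = D p" "p \<in> {p \<in> E \<times> E. fst p \<noteq> snd p}"
    then show "0 < y" using D[of p] by blast
  qed simp
  then have "d > 0" unfolding d_def using fin by (subst Min_gr_iff) blast+
  moreover have "d \<le> dist x y" if "i \<in> E" "j \<in> E" "i \<noteq> j" "x \<in> B i" "y \<in> B j" for i j x y
  proof -
    have p: "(i, j) \<in> {p \<in> E \<times> E. fst p \<noteq> snd p}" using that by simp
    then have "d \<le> D (i, j)" unfolding d_def using fin by (intro Min_le) blast+
    also have "\<dots> \<le> dist x y" using D[OF p] that by simp
    finally show ?thesis .
  qed
  ultimately show ?thesis by blast
qed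

section \<open>Returning words and the finite iterated function system\<close>

context tract_system
begin

text \<open>Words whose endpoint has large real part lose a factor \<open>1/2\<close> in the next step; if the
  remaining words contributed too little, \<open>S h n 1\<close> would decay exponentially.\<close>
lemma no_escape:
  assumes z0: "Re z0 \<ge> \<delta>"
    and sub: "subexponential h z0"
    and B: "\<And>z. Re z \<ge> \<delta> \<Longrightarrow> L h (\<lambda>_. 1) z \<le> ennreal B"
    and small: "\<And>z. Re z \<ge> \<rho> \<Longrightarrow> L h (\<lambda>_. 1) z \<le> ennreal (1/2)"
    and \<theta>: "1/2 < \<theta>" "\<theta> < 1"
  shows "\<exists>\<^sub>F n in sequentially. ennreal (\<theta> ^ n) \<le> S h n (indicator {x. Re x \<le> \<rho>}) z0"
proof (rule ccontr)
  assume "\<not> ?thesis"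
  then have "\<forall>\<^sub>F n in sequentially. S h n (indicator {x. Re x \<le> \<rho>}) z0 < ennreal (\<theta> ^ n)"
    by (simp add: frequently_def not_le)
  then obtain n0 where n0: "\<And>n. n \<ge> n0 \<Longrightarrow> S h n (indicator {x. Re x \<le> \<rho>}) z0 < ennreal (\<theta> ^ n)"
    unfolding eventually_sequentially by blast
  define a where "a n = enn2real (S h n (\<lambda>_. 1) z0)" for n
  have a: "S h n (\<lambda>_. 1) z0 = ennreal (a n)" "a n \<ge> 0" for n
    using sub by (auto simp: a_def subexponential_def)
  define B' where "B' = max B 0"
  have z0': "Re z0 > 0" using z0 delta_pos by simp
  have rec: "a (Suc n) \<le> B' * \<theta> ^ n + a n / 2" if n: "n \<ge> n0" for n
  proof -
    have "ennreal (a (Suc n)) = S h n (L h (\<lambda>_. 1)) z0"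
      using S_Suc'[OF z0'] a(1) by metis
    also have "\<dots> \<le> S h n (\<lambda>x. ennreal B' * indicator {x. Re x \<le> \<rho>} x + ennreal (1/2) * 1) z0"
    proof (rule S_mono)
      fix w assume w: "w \<in> words n"
      define x where "x = Gw w z0"
      have x: "Re x \<ge> \<delta>" using Gw_range[of w z0] w z0 by (simp add: words_def x_def)
      have "L h (\<lambda>_. 1) x \<le> ennreal B' * indicator {x. Re x \<le> \<rho>} x + ennreal (1/2) * 1"
      proof (cases "Re x \<le> \<rho>")
        case True
        have "L h (\<lambda>_. 1) x \<le> ennreal B'"
          using B[OF x] by (rule order_trans) (simp add: B'_def ennreal_leI)
        then show ?thesis using True by (simp add: add_increasing2)
      next
        case False
        then show ?thesis using small[of x] by simp
      qed
      then show "L h (\<lambda>_. 1) (Gw w z0) \<le> ennreal B' * indicator {x. Re x \<le> \<rho>} (Gw w z0) + ennreal (1/2) * 1"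
        by (simp add: x_def)
    qed
    also have "\<dots> = ennreal B' * S h n (indicator {x. Re x \<le> \<rho>}) z0 + ennreal (1/2) * S h n (\<lambda>_. 1) z0"
      unfolding S_add S_cmult ..
    also have "\<dots> \<le> ennreal B' * ennreal (\<theta> ^ n) + ennreal (1/2) * ennreal (a n)"
      using n0[OF n] a(1)[of n] by (intro add_mono mult_left_mono) auto
    also have "\<dots> = ennreal (B' * \<theta> ^ n + a n / 2)"
    proof -
      have "ennreal (1/2) * ennreal (a n) = ennreal (a n / 2)"
        using a(2)[of n] by (subst ennreal_mult[symmetric]) simp_all
      moreover have "ennreal B' * ennreal (\<theta> ^ n) = ennreal (B' * \<theta> ^ n)"
        using \<theta> by (subst ennreal_mult[symmetric]) (simp_all add: B'_def)
      ultimately show ?thesis using \<theta> a(2)[of n] by (subst ennreal_plus) (simp_all add: B'_def)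
    qed
    finally show ?thesis
      using \<theta> a(2)[of n] by (subst (asm) ennreal_le_iff) (auto simp: B'_def)
  qed
  \<comment> \<open>The first entry starts the induction; the second is the condition
    \<open>B' + C / 2 \<le> C * \<theta>\<close> that lets the recursion preserve the bound.\<close>
  define C where "C = max (a n0 / \<theta> ^ n0) (B' / (\<theta> - 1/2))"
  have "B' / (\<theta> - 1/2) \<le> C" by (simp add: C_def)
  then have CB: "B' + C / 2 \<le> C * \<theta>" using \<theta> by (simp add: field_simps)
  have bound: "a n \<le> C * \<theta> ^ n" if "n \<ge> n0" for n
    using that
  proof (induction n rule: dec_induct)
    case base
    have "a n0 / \<theta> ^ n0 \<le> C" by (simp add: C_def)
    then show ?case using \<theta> by (simp add: field_simps)
  next
    case (step n)
    have "a (Suc n) \<le> B' * \<theta> ^ n + (C * \<theta> ^ n) / 2"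
      using rec[OF step.hyps(1)] step.IH by linarith
    also have "\<dots> = (B' + C / 2) * \<theta> ^ n" by (simp add: algebra_simps)
    also have "\<dots> \<le> (C * \<theta>) * \<theta> ^ n" using CB \<theta> by (intro mult_right_mono) auto
    finally show ?case by (simp add: mult_ac)
  qed
  \<comment> \<open>Any rate strictly between \<theta> and 1 contradicts the subexponential lower
    bound on the sums.\<close>
  define q where "q = (\<theta> + 1) / 2"
  have q: "0 < q" "q < 1" "\<theta> / q < 1" "0 < \<theta> / q" using \<theta> by (auto simp: q_def)
  have "\<forall>\<^sub>F n in sequentially. C * (\<theta> / q) ^ n < 1"
    by (rule eventually_power_less[OF q(4,3)]) simp
  moreover have "\<forall>\<^sub>F n in sequentially. ennreal (q ^ n) \<le> S h n (\<lambda>_. 1) z0"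
    by (rule S_growth(2)[OF sub q(1,2)])
  ultimately have "\<forall>\<^sub>F n in sequentially. False" using eventually_ge_at_top[of n0]
  proof eventually_elim
    case (elim n)
    have "q ^ n \<le> a n" using elim(2) a q(1) by simp
    also have "\<dots> \<le> C * \<theta> ^ n" using bound elim(3) by simp
    finally have "1 \<le> C * (\<theta> / q) ^ n" using q(1) by (simp add: power_divide field_simps)
    then show False using elim(1) by simp
  qed
  then show False by simp
qed

text \<open>By \<open>no_escape\<close> the returning words carry mass at least
  \<open>\<theta> ^ n\<close> at exponent \<open>h\<close> for arbitrarily large \<open>n\<close>,
  with \<theta> free to be close to 1. Lowering the exponent to \<open>s\<close> gains a factor that
  grows faster than this decays, so the sum at \<open>s\<close> exceeds any \<open>M\<close>,
  already over finitely many words.\<close>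

lemma many_returning_words:
  assumes hs: "0 < s" "s < h" and z0: "Re z0 \<ge> \<delta>"
    and sub: "subexponential h z0"
    and B: "\<And>z. Re z \<ge> \<delta> \<Longrightarrow> L h (\<lambda>_. 1) z \<le> ennreal B"
    and small: "\<And>z. Re z \<ge> \<rho> \<Longrightarrow> L h (\<lambda>_. 1) z \<le> ennreal (1/2)"
    and M: "M > 0"
  shows "\<exists>n\<ge>n1. \<exists>F. finite F \<and> F \<subseteq> {w \<in> words (Suc n). Re (Gw w z0) \<le> \<rho>} \<and>
    M \<le> (\<Sum>w\<in>F. norm (deriv (Gw w) z0) powr s)"
proof -
  have z0': "Re z0 > 0" using z0 delta_pos by simp
  \<comment> \<open>The square root of the gain per letter: one factor \<open>k ^ n\<close> is
    matched against \<open>\<theta> ^ n\<close>, the other beats the constant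
    \<open>M * b\<close>.\<close>
  define k where "k = \<kappa> powr ((h - s) / 2)"
  have k: "0 < k" "k < 1" using kappa hs by (auto simp: k_def powr_def mult_pos_neg)
  have k2: "\<kappa> powr (h - s) = k\<^sup>2"
    using kappa by (simp add: k_def power2_eq_square powr_add[symmetric])
  define \<theta> where "\<theta> = max (3/4) k"
  have \<theta>: "1/2 < \<theta>" "\<theta> < 1" "k \<le> \<theta>" using k by (auto simp: \<theta>_def)
  define b where "b = (48 / Re z0) powr (h - s)"
  have b: "b > 0" using z0' by (simp add: b_def)
  have ev: "\<forall>\<^sub>F n in sequentially. M * b * k ^ n < k" by (rule eventually_power_less[OF k k(1)])
  have "\<exists>\<^sub>F n in sequentially. ennreal (\<theta> ^ n) \<le> S h n (indicator {x. Re x \<le> \<rho>}) z0"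
    by (rule no_escape[OF z0 sub B small \<theta>(1,2)])
  moreover have "\<forall>\<^sub>F n in sequentially. n \<ge> Suc n1 \<and> M * b * k ^ (n - 1) < k"
    using eventually_ge_at_top[of "Suc n1"] filterlim_minus_const_nat_at_top[THEN eventually_compose_filterlim[OF ev]]
    by eventually_elim simp
  ultimately have "\<exists>\<^sub>F n in sequentially. ennreal (\<theta> ^ n) \<le> S h n (indicator {x. Re x \<le> \<rho>}) z0 \<and>
      n \<ge> Suc n1 \<and> M * b * k ^ (n - 1) < k"
    by (rule frequently_eventually_frequently)
  then obtain n' where n': "ennreal (\<theta> ^ n') \<le> S h n' (indicator {x. Re x \<le> \<rho>}) z0"
      "n' \<ge> Suc n1" "M * b * k ^ (n' - 1) < k"
    by (elim frequently_ex[THEN exE] conjE)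
  define n where "n = n' - 1"
  have n: "n' = Suc n" "n \<ge> n1" using n'(2) by (auto simp: n_def)
  define V where "V = {w \<in> words (Suc n). Re (Gw w z0) \<le> \<rho>}"
  define c where "c = b * k ^ n * k ^ n"
  have c: "c > 0" using b k by (simp add: c_def)
  have "ennreal (\<theta> ^ Suc n) \<le> infsum (\<lambda>w. ennreal (norm (deriv (Gw w) z0) powr h) * indicator {x. Re x \<le> \<rho>} (Gw w z0)) (words (Suc n))"
    using n'(1) n(1) by (simp add: S_def)
  also have "\<dots> = infsum (\<lambda>w. ennreal (norm (deriv (Gw w) z0) powr h)) V"
    by (rule infsum_cong_neutral) (auto simp: V_def)
  also have "\<dots> \<le> infsum (\<lambda>w. ennreal c * ennreal (norm (deriv (Gw w) z0) powr s)) V"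
  proof (rule infsum_mono_ennreal)
    fix w assume "w \<in> V"
    then have w: "w \<in> words (Suc n)" by (simp add: V_def)
    have "norm (deriv (Gw w) z0) powr h \<le> (48 * \<kappa> ^ n / Re z0) powr (h - s) * norm (deriv (Gw w) z0) powr s"
      by (rule deriv_powr_le[OF w z0']) (use hs in simp)
    also have "(48 * \<kappa> ^ n / Re z0) powr (h - s) = ((48 / Re z0) * \<kappa> ^ n) powr (h - s)" by simp
    also have "\<dots> = b * (\<kappa> powr (h - s)) ^ n"
    proof -
      have "((48 / Re z0) * \<kappa> ^ n) powr (h - s) = b * (\<kappa> ^ n) powr (h - s)"
        unfolding b_def using z0' kappa by (subst powr_mult) simp_all
      also have "(\<kappa> ^ n) powr (h - s) = (\<kappa> powr (h - s)) ^ n"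
        using kappa by (simp add: powr_realpow[symmetric] powr_powr mult.commute)
      finally show ?thesis .
    qed
    also have "\<dots> = c" unfolding k2 c_def by (simp add: power2_eq_square power_mult_distrib)
    finally show "ennreal (norm (deriv (Gw w) z0) powr h) \<le> ennreal c * ennreal (norm (deriv (Gw w) z0) powr s)"
      using c by (simp add: ennreal_mult[symmetric] ennreal_leI)
  qed
  also have "\<dots> = ennreal c * infsum (\<lambda>w. ennreal (norm (deriv (Gw w) z0) powr s)) V"
    by (rule infsum_cmult_ennreal)
  finally have big: "ennreal (\<theta> ^ Suc n) \<le> ennreal c * infsum (\<lambda>w. ennreal (norm (deriv (Gw w) z0) powr s)) V" .
  have "c * M < \<theta> ^ Suc n"
  proof -
    have "c * M = (M * b * k ^ n) * k ^ n" by (simp add: c_def)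
    also have "\<dots> < k * k ^ n" using n'(3) k by (intro mult_strict_right_mono) (auto simp: n_def)
    also have "\<dots> \<le> \<theta> ^ Suc n" using power_mono[OF \<theta>(3), of "Suc n"] k by simp
    finally show ?thesis .
  qed
  have "ennreal M < infsum (\<lambda>w. ennreal (norm (deriv (Gw w) z0) powr s)) V"
  proof (rule ccontr)
    assume "\<not> ?thesis"
    then have "ennreal (\<theta> ^ Suc n) \<le> ennreal c * ennreal M"
      by (intro order_trans[OF big] mult_left_mono) (simp_all add: not_less)
    then have "\<theta> ^ Suc n \<le> c * M"
      using c M by (simp add: ennreal_mult[symmetric])
    then show False using \<open>c * M < \<theta> ^ Suc n\<close> by simp
  qed
  then obtain F where F: "finite F" "F \<subseteq> V" "ennreal M < (\<Sum>w\<in>F. ennreal (norm (deriv (Gw w) z0) powr s))"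
    unfolding infsum_ennreal_SUP less_SUP_iff by blast
  then have "ennreal M < ennreal (\<Sum>w\<in>F. norm (deriv (Gw w) z0) powr s)" by simp
  then have "M \<le> (\<Sum>w\<in>F. norm (deriv (Gw w) z0) powr s)"
    using M by (simp add: ennreal_less_iff)
  then show ?thesis using F n(2) by (intro exI[of _ n] conjI exI[of _ F]) (auto simp: V_def)
qed


text \<open>A translation by a period costs no additional map: it is absorbed into the first letter
  of the return word. So endpoints can be brought to bounded imaginary part before the
  return.\<close>

lemma Gw_shift:
  "Gw ((0, l) # replicate m (0, 0)) z = Gw ((0, 0) # replicate m (0, 0)) (z + per l)"
  by (simp add: G_def)

text \<open>All maps of the finite system are inverse branches of the same iterate \<open>f ^^ m\<close>, so that
  distinct ones have disjoint images.\<close>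
lemma hausdorff_measure_limit_set:
  fixes F :: "'i set" and \<psi> :: "'i \<Rightarrow> (nat \<times> int) list"
  assumes s: "s > 0" and m: "m \<ge> 1" and F: "finite F" "card F \<ge> 2"
    and \<psi>: "\<And>i. i \<in> F \<Longrightarrow> \<psi> i \<in> words m" and inj: "inj_on \<psi> F"
    and D: "compact D" "D \<noteq> {}" "\<And>x. x \<in> D \<Longrightarrow> Re x \<ge> \<delta>" "\<And>x y. x \<in> D \<Longrightarrow> y \<in> D \<Longrightarrow> dist x y < 6"
    and into: "\<And>i x. i \<in> F \<Longrightarrow> x \<in> D \<Longrightarrow> Gw (\<psi> i) x \<in> D"
    and expd: "\<And>i x y. i \<in> F \<Longrightarrow> x \<in> D \<Longrightarrow> y \<in> D \<Longrightarrow>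
      \<rho> i * dist (exp x) (exp y) \<le> dist (exp (Gw (\<psi> i) x)) (exp (Gw (\<psi> i) y))"
    and \<rho>: "\<And>i. i \<in> F \<Longrightarrow> \<rho> i > 0" and sum: "1 \<le> (\<Sum>i\<in>F. \<rho> i powr s)"
  shows "\<exists>X. hausdorff_measure s X \<noteq> 0 \<and>
    (\<forall>u\<in>X. \<forall>n. \<exists>w\<in>words (n * m). \<exists>x\<in>D. u = exp (Gw w x))"
proof -
  \<comment> \<open>The Hutchinson operator of the finite system; the iterates of \<open>D\<close>
    decrease and their intersection is the limit set.\<close>
  define \<Phi> where "\<Phi> X = (\<Union>i\<in>F. Gw (\<psi> i) ` X)" for X
  define X where "X k = (\<Phi> ^^ k) D" for k
  have X0: "X 0 = D" and XS: "X (Suc k) = \<Phi> (X k)" for k by (simp_all add: X_def)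
  have D0: "x \<in> HP 0" if "x \<in> D" for x using D(3)[OF that] delta_pos by simp
  have sub: "X (Suc k) \<subseteq> X k" for k
  proof (induction k)
    case 0
    show ?case unfolding XS X0 \<Phi>_def using into by blast
  next
    case (Suc k)
    then show ?case unfolding XS[of "Suc k"] XS[of k] \<Phi>_def by blast
  qed
  have dec: "X l \<subseteq> X k" if "k \<le> l" for k l
    using lift_Suc_antimono_le[of X, OF sub that] .
  have XD: "X k \<subseteq> D" for k using dec[of 0 k] X0 by simp
  have ne: "X k \<noteq> {}" for k
  proof (induction k)
    case 0
    show ?case using X0 D(2) by simp
  next
    case (Suc k)
    have "F \<noteq> {}" using F(2) by auto
    then show ?case using Suc unfolding XS \<Phi>_def by blast
  qed
  have cont: "continuous_on A (Gw (\<psi> i))" if "i \<in> F" "A \<subseteq> D" for i A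
  proof -
    have "set (\<psi> i) \<subseteq> I" using \<psi>[OF that(1)] by (simp add: words_def)
    moreover have "A \<subseteq> HP 0" using that(2) D0 by blast
    ultimately show ?thesis
      using holomorphic_on_imp_continuous_on[OF Gw_hol] continuous_on_subset by blast
  qed
  have comp: "compact (X k)" for k
  proof (induction k)
    case 0
    show ?case using X0 D(1) by simp
  next
    case (Suc k)
    show ?case unfolding XS \<Phi>_def
      by (rule compact_UN[OF F(1)]) (rule compact_continuous_image[OF cont[OF _ XD] Suc])
  qed
  define \<Lambda> where "\<Lambda> = (\<Inter>k. X k)"
  have \<Lambda>D: "\<Lambda> \<subseteq> D" using XD by (auto simp: \<Lambda>_def)
  have \<Lambda>ne: "\<Lambda> \<noteq> {}" unfolding \<Lambda>_def using comp ne dec by (rule compact_nest)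
  have \<Lambda>comp: "compact \<Lambda>" unfolding \<Lambda>_def using comp by (intro compact_Inter) auto
  have \<Lambda>inv: "Gw (\<psi> i) x \<in> \<Lambda>" if i: "i \<in> F" and x: "x \<in> \<Lambda>" for i x
  proof -
    have "Gw (\<psi> i) x \<in> X k" for k
    proof -
      have "x \<in> X k" using x by (simp add: \<Lambda>_def)
      then have "Gw (\<psi> i) x \<in> X (Suc k)" unfolding XS \<Phi>_def using i by blast
      then show ?thesis using sub by blast
    qed
    then show ?thesis by (simp add: \<Lambda>_def)
  qed
  have coded: "\<exists>w\<in>words (k * m). \<exists>y\<in>D. x = Gw w y" if "x \<in> X k" for x k
    using that
  proof (induction k arbitrary: x)
    case 0
    then show ?case using X0 by simp
  next
    case (Suc k)
    then obtain i x' where i: "i \<in> F" "x' \<in> X k" "x = Gw (\<psi> i) x'" unfolding XS \<Phi>_def by blast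
    obtain w y where w: "w \<in> words (k * m)" "y \<in> D" "x' = Gw w y" using Suc.IH[OF i(2)] by blast
    have "w @ \<psi> i \<in> words (k * m + m)" by (rule words_append[OF w(1) \<psi>[OF i(1)]])
    moreover have "k * m + m = Suc k * m" by simp
    moreover have "x = Gw (w @ \<psi> i) y" using i w by (simp add: Gw_append)
    ultimately show ?case using w(2) by metis
  qed
  define B where "B i = (\<lambda>x. exp (Gw (\<psi> i) x)) ` D" for i
  have Bcomp: "compact (B i)" if "i \<in> F" for i
    unfolding B_def by (intro compact_continuous_image continuous_intros cont that D(1) order_refl)
  have Bdisj: "B i \<inter> B j = {}" if ij: "i \<in> F" "j \<in> F" "i \<noteq> j" for i j
  proof (rule ccontr)
    assume "B i \<inter> B j \<noteq> {}"
    then obtain x y where xy: "x \<in> D" "y \<in> D" "exp (Gw (\<psi> i) x) = exp (Gw (\<psi> j) y)"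
      unfolding B_def by blast
    have w: "set (\<psi> i) \<subseteq> I" "length (\<psi> i) = m" "set (\<psi> j) \<subseteq> I" "length (\<psi> j) = m"
      using \<psi> ij by (simp_all add: words_def)
    have x0: "Re x > 0" "Re y > 0" using D0 xy by simp_all
    have "exp x = exp y"
      using f_Gw[OF w(1) x0(1)] f_Gw[OF w(3) x0(2)] xy(3) w(2,4) by simp
    \<comment> \<open>The points of \<open>D\<close> are less than 6 < 2 * pi apart, so on
      \<open>D\<close> the exponential determines the base point, and \<open>Gw_uniq\<close> then
      compares two words of equal length.\<close>
    then have "x = y" by (rule exp_inj_near) (rule D(4)[OF xy(1,2)])
    then have "\<psi> i = \<psi> j" using Gw_uniq[OF \<psi>[OF ij(1)] \<psi>[OF ij(2)] x0(1)] xy(3) by simp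
    then show False using inj_onD[OF inj _ ij(1,2)] ij(3) by blast
  qed
  obtain d where d: "d > 0" "\<forall>i\<in>F. \<forall>j\<in>F. i \<noteq> j \<longrightarrow> (\<forall>x\<in>B i. \<forall>y\<in>B j. d \<le> dist x y)"
  proof -
    have "\<exists>d>0. \<forall>i\<in>F. \<forall>j\<in>F. i \<noteq> j \<longrightarrow> (\<forall>x\<in>B i. \<forall>y\<in>B j. d \<le> dist x y)"
      by (rule compact_family_separated[OF F(1)]) (fact Bcomp, fact Bdisj)
    then show ?thesis using that by blast
  qed
  have ecomp: "compact (exp ` \<Lambda>)" by (intro compact_continuous_image continuous_intros \<Lambda>comp)
  have "hausdorff_measure s (exp ` \<Lambda>) \<noteq> 0"
  proof (rule hausdorff_measure_pos_of_finite_covers[OF ecomp s])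
    show "d powr s > 0" using d(1) by simp
    fix U :: "nat \<Rightarrow> complex set" and J
    assume J: "finite J" "\<And>j. j \<in> J \<Longrightarrow> bounded (U j)" "exp ` \<Lambda> \<subseteq> (\<Union>j\<in>J. U j)"
    show "d powr s \<le> (\<Sum>j\<in>J. diameter (U j) powr s)"
    proof (rule Moran_finite_cover[where E = F and \<phi> = exp and \<Lambda> = \<Lambda> and g = "\<lambda>i. Gw (\<psi> i)" and \<rho> = \<rho>])
      fix i j x y assume "i \<in> F" "j \<in> F" "i \<noteq> j" "x \<in> \<Lambda>" "y \<in> \<Lambda>"
      moreover have "exp (Gw (\<psi> i) x) \<in> B i" if "i \<in> F" "x \<in> \<Lambda>" for i x
        using that \<Lambda>D by (auto simp: B_def)
      ultimately show "d \<le> dist (exp (Gw (\<psi> i) x)) (exp (Gw (\<psi> j) y))" using d(2) by blast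
    next
      fix i x y assume "i \<in> F" "x \<in> \<Lambda>" "y \<in> \<Lambda>"
      then show "\<rho> i * dist (exp x) (exp y) \<le> dist (exp (Gw (\<psi> i) x)) (exp (Gw (\<psi> i) y))"
        using expd \<Lambda>D by blast
    qed (use F \<Lambda>ne \<Lambda>inv d(1) \<rho> s sum J compact_imp_bounded[OF ecomp] in \<open>blast+\<close>)
  qed
  moreover have "\<exists>w\<in>words (n * m). \<exists>x\<in>D. u = exp (Gw w x)" if u: "u \<in> exp ` \<Lambda>" for u n
  proof -
    obtain x where x: "x \<in> \<Lambda>" "u = exp x" using u by blast
    then have "x \<in> X n" by (simp add: \<Lambda>_def)
    then show ?thesis using coded x(2) by blast
  qed
  ultimately show ?thesis by blast
qed

text \<open>The returning words have bounded endpoints up to a period. After the shift, a fixed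
  return word contracts the whole rectangle of possible endpoints into the small disc about its own
  image of a base point, so all composed words map one set \<open>D\<close> into itself. The coding
  by words of length \<open>n * m\<close> with bounded \<open>x\<close> in the conclusion later
  yields both membership in the Julia set and a bounded subsequence of the orbit.\<close>

lemma hausdorff_measure_lower:
  assumes hs: "0 < s" "s < h" and z0: "Re z0 \<ge> \<delta>"
    and sub: "subexponential h z0"
    and B: "\<And>z. Re z \<ge> \<delta> \<Longrightarrow> L h (\<lambda>_. 1) z \<le> ennreal B"
    and small: "\<And>z. Re z \<ge> \<rho>0 \<Longrightarrow> L h (\<lambda>_. 1) z \<le> ennreal (1/2)"
  shows "\<exists>X m R. m \<ge> 1 \<and> hausdorff_measure s X \<noteq> 0 \<and>
    (\<forall>u\<in>X. \<forall>n. \<exists>w\<in>words (n * m). \<exists>x. Re x \<ge> \<delta> \<and> norm x \<le> R \<and> u = exp (Gw w x))"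
proof -
  define \<rho> where "\<rho> = max \<rho>0 0"
  have \<rho>: "\<rho> \<ge> 0" "\<And>z. Re z \<ge> \<rho> \<Longrightarrow> L h (\<lambda>_. 1) z \<le> ennreal (1/2)"
    using small by (simp_all add: \<rho>_def)
  have z0': "Re z0 > 0" using z0 delta_pos by simp
  have I0: "(0, l) \<in> I" for l using N_pos by (simp add: I_def)
  define p0 where "p0 = complex_of_real \<delta>"
  \<comment> \<open>A bound for the distance from \<open>p0\<close> to the rectangle with real parts
    in [\<delta>, \<rho> + 1] and imaginary parts at most pi + 1 in modulus. The extra 1 on each
    side allows for the spread of the images of \<open>D\<close>.\<close>
  define M where "M = \<rho> + pi + 2 + \<delta>"
  \<comment> \<open>\<delta> / 8 places \<open>D\<close> inside \<open>ball x (Re x)\<close> for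
    each of its points \<open>x\<close>; 1 / 8 keeps its diameter below 1, as
    \<open>exp_lower_bound\<close> requires.\<close>
  define r where "r = min (\<delta> / 8) (1 / 8)"
  have r: "r > 0" "r \<le> \<delta> / 8" "r \<le> 1 / 8" using delta_pos by (simp_all add: r_def)
  have "\<forall>\<^sub>F n in sequentially. (48 / \<delta>) * \<kappa> ^ n * M < r"
    using eventually_power_less[OF kappa r(1), of "(48 / \<delta>) * M"] by (simp only: mult_ac)
  then obtain m0 where m0: "(48 / \<delta>) * \<kappa> ^ m0 * M < r" unfolding eventually_sequentially by blast
  define v where "v = (0, 0) # replicate m0 (0::nat, 0::int)"
  have v: "v \<in> words (Suc m0)" "set v \<subseteq> I" using I0 by (auto simp: words_def v_def)
  define p where "p = Gw v p0"
  have p0: "Re p0 \<ge> \<delta>" "Re p0 > 0" using delta_pos by (simp_all add: p0_def)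
  have p: "Re p \<ge> \<delta>" unfolding p_def by (rule Gw_range[OF v(2) p0(1)])
  define D where "D = cball p r \<inter> {x. Re x \<ge> \<delta>}"
  have Dcomp: "compact D" unfolding D_def
    by (intro compact_Int_closed compact_cball closed_halfspace_Re_ge)
  have Dne: "p \<in> D" using p r(1) by (simp add: D_def)
  have Ddist: "dist x y \<le> 2 * r" if "x \<in> D" "y \<in> D" for x y
    using that dist_triangle[of x y p] by (simp add: D_def dist_commute)
  have DRe: "Re x \<ge> \<delta>" if "x \<in> D" for x using that by (simp add: D_def)
  define R where "R = norm p + r"
  have DR: "norm x \<le> R" if "x \<in> D" for x
  proof -
    have "norm x \<le> norm p + norm (x - p)" by (metis add.commute diff_add_cancel norm_triangle_ineq)
    then show ?thesis using that by (simp add: D_def R_def dist_norm norm_minus_commute)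
  qed
  have ret: "Gw v x \<in> D" if x: "\<delta> \<le> Re x" "Re x \<le> \<rho> + 1" "\<bar>Im x\<bar> \<le> pi + 1" for x
  proof -
    have "norm (x - p0) \<le> \<bar>Re (x - p0)\<bar> + \<bar>Im (x - p0)\<bar>" by (rule cmod_le)
    also have "\<dots> \<le> M" using x delta_pos by (simp add: p0_def M_def)
    finally have xp: "norm (x - p0) \<le> M" .
    have "norm (Gw v x - p) \<le> (48 / \<delta>) * \<kappa> ^ m0 * norm (x - p0)"
      unfolding p_def by (rule Gw_Lipschitz[OF v(1) x(1) p0(1)])
    also have "\<dots> \<le> (48 / \<delta>) * \<kappa> ^ m0 * M" using xp delta_pos kappa by (intro mult_left_mono) auto
    also have "\<dots> \<le> r" using m0 by simp
    finally have "Gw v x \<in> cball p r" by (simp add: dist_norm norm_minus_commute)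
    moreover have "Re (Gw v x) \<ge> \<delta>" by (rule Gw_range[OF v(2) x(1)])
    ultimately show ?thesis by (simp add: D_def)
  qed
  define M2 where "M2 = norm (z0 - p) + r"
  have M2: "norm (x - z0) \<le> M2" if "x \<in> D" for x
    using that dist_triangle[of x z0 p] by (simp add: D_def M2_def dist_norm norm_minus_commute)
  obtain K where K: "K \<ge> 1" "\<And>g a b. g holomorphic_on HP 0 \<Longrightarrow> inj_on g (HP 0) \<Longrightarrow> Re a \<ge> \<delta> \<Longrightarrow> Re b \<ge> \<delta>
      \<Longrightarrow> dist a b \<le> max M M2 \<Longrightarrow> norm (deriv g b) \<le> K * norm (deriv g a)"
    using univalent_distortion_HP[OF delta_pos, of "max M M2"] by blast
  define e where "e = exp (Re p + r)"
  \<comment> \<open>The losses in the expansion estimate: two distortion constants \<open>K\<close>,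
    one 48 from the lower bound for the univalent branch and one from that for \<open>exp\<close>,
    and \<open>e\<close>, the Lipschitz constant of \<open>exp\<close> on \<open>D\<close>.\<close>
  define c where "c = norm (deriv (Gw v) p0) / (48 * 48 * K * K * e)"
  have "deriv (Gw v) p0 \<noteq> 0" by (rule deriv_Gw_nonzero[OF v(2) p0(2)])
  then have c: "c > 0" using K(1) by (simp add: c_def e_def)
  have ev1: "\<forall>\<^sub>F n in sequentially. (48 / \<delta>) * \<kappa> ^ n * M2 < 1"
    using eventually_power_less[OF kappa zero_less_one, of "(48 / \<delta>) * M2"] by (simp only: mult_ac)
  have ev2: "\<forall>\<^sub>F n in sequentially. c * (48 * \<kappa> ^ n / Re z0) < 1"
    using eventually_power_less[OF kappa zero_less_one, of "c * 48 / Re z0"]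
    by (simp only: mult_ac times_divide_eq_left times_divide_eq_right)
  \<comment> \<open>The first condition keeps the image of \<open>D\<close> under
    \<open>Gw w\<close> within distance 1 of \<open>Gw w z0\<close>. The second makes every ratio
    \<open>q w\<close> less than 1, so that a sum of at least 1 takes at least two words.\<close>
  obtain n1 where n1: "\<And>n. n \<ge> n1 \<Longrightarrow> (48 / \<delta>) * \<kappa> ^ n * M2 < 1 \<and> c * (48 * \<kappa> ^ n / Re z0) < 1"
    using eventually_conj[OF ev1 ev2] unfolding eventually_sequentially by blast
  have "1 / c powr s > 0" using c by simp
  have "\<exists>n\<ge>n1. \<exists>F. finite F \<and> F \<subseteq> {w \<in> words (Suc n). Re (Gw w z0) \<le> \<rho>} \<and>
    1 / c powr s \<le> (\<Sum>w\<in>F. norm (deriv (Gw w) z0) powr s)"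
    by (rule many_returning_words[OF hs z0 sub]) (fact B, fact \<rho>(2), fact)
  then obtain n where n: "n \<ge> n1" "\<exists>F. finite F \<and> F \<subseteq> {w \<in> words (Suc n). Re (Gw w z0) \<le> \<rho>} \<and>
    1 / c powr s \<le> (\<Sum>w\<in>F. norm (deriv (Gw w) z0) powr s)"
    by blast
  from n(2) obtain F where F: "finite F" "F \<subseteq> {w \<in> words (Suc n). Re (Gw w z0) \<le> \<rho>}"
      "1 / c powr s \<le> (\<Sum>w\<in>F. norm (deriv (Gw w) z0) powr s)"
    by (elim exE conjE)
  note nF = n(1) F
  have Fw: "w \<in> words (Suc n)" "set w \<subseteq> I" "length w = Suc n" "Re (Gw w z0) \<le> \<rho>" if "w \<in> F" for w
    using that nF(3) by (auto simp: words_def)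
  define l where "l w = (SOME k::int. \<bar>Im (Gw w z0) + 2 * pi * of_int k\<bar> \<le> pi)" for w
  have l: "\<bar>Im (Gw w z0) + 2 * pi * of_int (l w)\<bar> \<le> pi" for w
    unfolding l_def by (rule someI_ex[OF exists_period_shift])
  define \<psi> where "\<psi> w = w @ (0, l w) # replicate m0 (0, 0)" for w
  define m where "m = Suc n + Suc m0"
  have G\<psi>: "Gw (\<psi> w) x = Gw v (Gw w x + per (l w))" for w x
    unfolding \<psi>_def v_def Gw_append by (rule Gw_shift)
  have \<psi>w: "\<psi> w \<in> words m" if "w \<in> F" for w
  proof -
    have "(0, l w) # replicate m0 (0, 0) \<in> words (Suc m0)"
      using I0[of "l w"] v(1) by (simp add: words_def v_def)
    then show ?thesis unfolding \<psi>_def m_def by (rule words_append[OF Fw(1)[OF that]])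
  qed
  have box: "\<delta> \<le> Re (Gw w x + per (l w))" "Re (Gw w x + per (l w)) \<le> \<rho> + 1"
      "\<bar>Im (Gw w x + per (l w))\<bar> \<le> pi + 1" if w: "w \<in> F" and x: "x \<in> D" for w x
  proof -
    show "\<delta> \<le> Re (Gw w x + per (l w))" using Gw_range[OF Fw(2)[OF w] DRe[OF x]] by simp
    have "norm (Gw w x - Gw w z0) \<le> (48 / \<delta>) * \<kappa> ^ n * norm (x - z0)"
      by (rule Gw_Lipschitz[OF Fw(1)[OF w] DRe[OF x] z0])
    also have "\<dots> \<le> (48 / \<delta>) * \<kappa> ^ n * M2" using M2[OF x] delta_pos kappa by (intro mult_left_mono) auto
    also have "\<dots> \<le> 1" using n1[OF nF(1)] by simp
    finally have near: "norm (Gw w x - Gw w z0) \<le> 1" .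
    have "\<bar>Re (Gw w x - Gw w z0)\<bar> \<le> 1" "\<bar>Im (Gw w x - Gw w z0)\<bar> \<le> 1"
      using near abs_Re_le_cmod abs_Im_le_cmod order_trans by blast+
    then show "Re (Gw w x + per (l w)) \<le> \<rho> + 1" "\<bar>Im (Gw w x + per (l w))\<bar> \<le> pi + 1"
      using Fw(4)[OF w] l[of w] by (simp_all add: Im_per abs_le_iff)
  qed
  define q where "q w = c * norm (deriv (Gw w) z0)" for w
  have q0: "q w > 0" if "w \<in> F" for w
    using c deriv_Gw_nonzero[OF Fw(2)[OF that] z0'] by (simp add: q_def)
  have "\<exists>X. hausdorff_measure s X \<noteq> 0 \<and> (\<forall>u\<in>X. \<forall>n. \<exists>w\<in>words (n * m). \<exists>x\<in>D. u = exp (Gw w x))"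
  proof (rule hausdorff_measure_limit_set[OF hs(1), where F = F and \<psi> = \<psi> and \<rho> = q])
    show "m \<ge> 1" by (simp add: m_def)
    show "finite F" by fact
    show sum1: "1 \<le> (\<Sum>w\<in>F. q w powr s)"
    proof -
      have "1 = c powr s * (1 / c powr s)" using c by simp
      also have "\<dots> \<le> c powr s * (\<Sum>w\<in>F. norm (deriv (Gw w) z0) powr s)"
        using nF(4) by (intro mult_left_mono) auto
      also have "\<dots> = (\<Sum>w\<in>F. q w powr s)" using c by (simp add: sum_distrib_left q_def powr_mult)
      finally show ?thesis .
    qed
    have q1: "q w powr s < 1" if w: "w \<in> F" for w
    proof -
      have "q w \<le> c * (48 * \<kappa> ^ n / Re z0)"
        unfolding q_def using deriv_Gw_bound[OF Fw(1)[OF w] z0'] c by (intro mult_left_mono) auto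
      then have "q w < 1" using n1[OF nF(1)] by simp
      then have "q w powr s < 1 powr s" using q0[OF w] hs(1) by (intro powr_less_mono2) auto
      then show ?thesis by simp
    qed
    show "card F \<ge> 2"
    proof (rule ccontr)
      assume "\<not> card F \<ge> 2"
      then consider "card F = 0" | "card F = 1" by linarith
      then show False
      proof cases
        case 1
        then show False using sum1 nF(2) by simp
      next
        case 2
        then obtain w where "F = {w}" by (auto simp: card_1_singleton_iff)
        then show False using sum1 q1[of w] by simp
      qed
    qed
    show "\<psi> w \<in> words m" if "w \<in> F" for w by (rule \<psi>w[OF that])
    show "inj_on \<psi> F"
    proof (rule inj_onI)
      fix w w' assume "w \<in> F" "w' \<in> F" "\<psi> w = \<psi> w'"
      then show "w = w'" using Fw(3) by (simp add: \<psi>_def)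
    qed
    show "compact D" by fact
    show "D \<noteq> {}" using Dne by blast
    show "Re x \<ge> \<delta>" if "x \<in> D" for x by (rule DRe[OF that])
    show "dist x y < 6" if "x \<in> D" "y \<in> D" for x y using Ddist[OF that] r(3) by simp
    show "Gw (\<psi> w) x \<in> D" if "w \<in> F" "x \<in> D" for w x
      unfolding G\<psi> using box[OF that] by (rule ret)
    show "q w > 0" if "w \<in> F" for w by (rule q0[OF that])
    show "q w * dist (exp x) (exp y) \<le> dist (exp (Gw (\<psi> w) x)) (exp (Gw (\<psi> w) y))"
      if w: "w \<in> F" and x: "x \<in> D" and y: "y \<in> D" for w x y
    proof -
      have x0: "Re x > 0" using DRe[OF x] delta_pos by simp
      have \<psi>I: "set (\<psi> w) \<subseteq> I" using \<psi>w[OF w] by (simp add: words_def)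
      define x' where "x' = Gw w x + per (l w)"
      have x': "Re x' \<ge> \<delta>" using box(1)[OF w x] by (simp add: x'_def)
      have Mx: "norm (x' - p0) \<le> M"
      proof -
        have "norm (x' - p0) \<le> \<bar>Re (x' - p0)\<bar> + \<bar>Im (x' - p0)\<bar>" by (rule cmod_le)
        also have "\<dots> \<le> M" using box[OF w x] delta_pos by (simp add: p0_def M_def x'_def)
        finally show ?thesis .
      qed
      have "norm (deriv (Gw v) p0) \<le> K * norm (deriv (Gw v) x')"
        using Mx x' p0 by (intro K(2) Gw_hol Gw_inj v(2)) (simp_all add: dist_norm)
      moreover have "norm (deriv (Gw w) z0) \<le> K * norm (deriv (Gw w) x)"
        using M2[OF x] DRe[OF x] z0 by (intro K(2) Gw_hol Gw_inj Fw(2)[OF w]) (simp_all add: dist_norm)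
      ultimately have "norm (deriv (Gw v) p0) * norm (deriv (Gw w) z0)
          \<le> (K * norm (deriv (Gw v) x')) * (K * norm (deriv (Gw w) x))"
        using K(1) by (intro mult_mono) auto
      also have "\<dots> = K * K * norm (deriv (Gw (\<psi> w)) x)"
      proof -
        have gw: "(Gw w has_field_derivative deriv (Gw w) x) (at x)"
          using x0 by (intro holomorphic_derivI[OF Gw_hol[OF Fw(2)[OF w]] open_HP]) simp
        then have "((\<lambda>x. Gw w x + per (l w)) has_field_derivative deriv (Gw w) x) (at x)"
          by (auto intro!: derivative_eq_intros)
        moreover have "(Gw v has_field_derivative deriv (Gw v) x') (at (Gw w x + per (l w)))"
          unfolding x'_def[symmetric] using x' delta_pos
          by (intro holomorphic_derivI[OF Gw_hol[OF v(2)] open_HP]) simp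
        ultimately have "((\<lambda>x. Gw v (Gw w x + per (l w))) has_field_derivative deriv (Gw v) x' * deriv (Gw w) x) (at x)"
          by (intro DERIV_chain2)
        then have "deriv (Gw (\<psi> w)) x = deriv (Gw v) x' * deriv (Gw w) x"
          unfolding G\<psi>[abs_def, symmetric] by (simp add: DERIV_imp_deriv G\<psi>[symmetric])
        then show ?thesis by (simp add: norm_mult)
      qed
      finally have d1: "norm (deriv (Gw v) p0) * norm (deriv (Gw w) z0) \<le> K * K * norm (deriv (Gw (\<psi> w)) x)" .
      have d2: "norm (deriv (Gw (\<psi> w)) x) * dist x y \<le> 48 * dist (Gw (\<psi> w) x) (Gw (\<psi> w) y)"
        unfolding dist_norm[of "Gw (\<psi> w) x"]
      proof (rule univalent_lower_bound[of _ x "Re x"])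
        show "Gw (\<psi> w) holomorphic_on ball x (Re x)" "inj_on (Gw (\<psi> w)) (ball x (Re x))"
          using ball_subset_HP[of x] Gw_hol[OF \<psi>I] Gw_inj[OF \<psi>I] holomorphic_on_subset inj_on_subset by blast+
        show "y \<in> ball x (Re x)" using Ddist[OF x y] r DRe[OF x] delta_pos by simp
      qed
      have in2: "Gw (\<psi> w) x \<in> D" "Gw (\<psi> w) y \<in> D"
        unfolding G\<psi> by (rule ret[OF box[OF w x]], rule ret[OF box[OF w y]])
      have d3: "dist (Gw (\<psi> w) x) (Gw (\<psi> w) y) \<le> 48 * dist (exp (Gw (\<psi> w) x)) (exp (Gw (\<psi> w) y))"
        unfolding dist_norm[of "exp _"]
        using Ddist[OF in2] r(3) DRe[OF in2(1)] delta_pos by (intro exp_lower_bound) auto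
      have DRe': "Re x \<le> Re p + r" if "x \<in> D" for x
      proof -
        have "norm (x - p) \<le> r" using that by (simp add: D_def dist_norm norm_minus_commute)
        then show ?thesis using abs_Re_le_cmod[of "x - p"] unfolding minus_complex.simps by linarith
      qed
      have d4: "dist (exp x) (exp y) \<le> e * dist x y"
        unfolding dist_norm e_def by (rule exp_Lipschitz[OF DRe'[OF x] DRe'[OF y]])
      have "e > 0" by (simp add: e_def)
      have "q w * dist (exp x) (exp y) \<le> q w * (e * dist x y)"
        using d4 q0[OF w] by (intro mult_left_mono) auto
      also have "\<dots> = (norm (deriv (Gw v) p0) * norm (deriv (Gw w) z0)) * dist x y / (48 * 48 * K * K)"
        using \<open>e > 0\<close> K(1) by (simp add: q_def c_def)
      also have "\<dots> \<le> (K * K * norm (deriv (Gw (\<psi> w)) x)) * dist x y / (48 * 48 * K * K)"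
        using d1 K(1) by (intro divide_right_mono mult_right_mono) auto
      also have "\<dots> = (norm (deriv (Gw (\<psi> w)) x) * dist x y) / (48 * 48)"
        using K(1) by simp
      also have "\<dots> \<le> (48 * (48 * dist (exp (Gw (\<psi> w) x)) (exp (Gw (\<psi> w) y)))) / (48 * 48)"
        using d2 d3 by (intro divide_right_mono) auto
      also have "\<dots> = dist (exp (Gw (\<psi> w) x)) (exp (Gw (\<psi> w) y))" by simp
      finally show ?thesis .
    qed
  qed
  then obtain X where X: "hausdorff_measure s X \<noteq> 0"
      "\<forall>u\<in>X. \<forall>n. \<exists>w\<in>words (n * m). \<exists>x\<in>D. u = exp (Gw w x)" by blast
  have "\<forall>u\<in>X. \<forall>n. \<exists>w\<in>words (n * m). \<exists>x. Re x \<ge> \<delta> \<and> norm x \<le> R \<and> u = exp (Gw w x)"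
    using X(2) DRe DR by blast
  then show ?thesis using X(1) by (intro exI[of _ X] exI[of _ m] exI[of _ R]) (simp add: m_def)
qed

end

section \<open>Negative spectrum makes the transfer operator decay at infinity\<close>

lemma sum_le_integral_steps:
  fixes F :: "real \<Rightarrow> real"
  assumes d: "d > 0" and cont: "continuous_on {real m * d..} F"
    and lower: "\<And>k y. k \<ge> m \<Longrightarrow> real k * d \<le> y \<Longrightarrow> y \<le> real (Suc k) * d \<Longrightarrow> k < m + l \<Longrightarrow> c k \<le> F y"
  shows "(\<Sum>k=m..<m+l. c k * d) \<le> integral {real m * d..real (m + l) * d} F"
  using lower
proof (induction l)
  case (Suc l)
  have int: "F integrable_on {a..b}" if "real m * d \<le> a" for a b
    using that cont by (intro integrable_continuous_real) (auto elim: continuous_on_subset)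
  have le: "real m * d \<le> real (m + l) * d" "real (m + l) * d \<le> real (Suc (m + l)) * d"
    using d by (auto intro: mult_right_mono)
  have "c (m + l) * d = integral {real (m + l) * d..real (Suc (m + l)) * d} (\<lambda>_. c (m + l))"
    using le(2) by (simp add: algebra_simps)
  also have "\<dots> \<le> integral {real (m + l) * d..real (Suc (m + l)) * d} F"
    using Suc.prems[of "m + l"] le(1) by (intro integral_le int) auto
  finally have "(\<Sum>k=m..<m+Suc l. c k * d) \<le>
      integral {real m * d..real (m + l) * d} F + integral {real (m + l) * d..real (Suc (m + l)) * d} F"
    using Suc.IH Suc.prems by (simp add: add_mono)
  also have "\<dots> = integral {real m * d..real (Suc (m + l)) * d} F"
    using le by (intro Henstock_Kurzweil_Integration.integral_combine int) auto
  finally show ?case by simp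
qed simp

lemma bounded_sum_of_dyadic_blocks:
  fixes a :: "nat \<Rightarrow> real"
  assumes a: "\<And>k. a k \<ge> 0" and q: "0 < q" "q < 1" and C: "C \<ge> 0"
    and block: "\<And>n. n \<ge> n0 \<Longrightarrow> (\<Sum>k=2^n..<2^Suc n. a k) \<le> C * q ^ n"
  shows "\<exists>B. \<forall>F. finite F \<longrightarrow> sum a F \<le> B"
proof -
  define A where "A = (\<Sum>k<2^n0. a k)"
  have part: "(\<Sum>k<2^(n0+m). a k) \<le> A + C * (\<Sum>i<m. q ^ i)" for m
  proof (induction m)
    case (Suc m)
    have "(\<Sum>k<2^(n0 + Suc m). a k) = (\<Sum>k<2^(n0+m). a k) + (\<Sum>k=2^(n0+m)..<2^Suc (n0+m). a k)"
      using sum.atLeastLessThan_concat[of 0 "2^(n0+m)" "2^Suc (n0+m)" a] by (simp add: atLeast0LessThan)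
    also have "\<dots> \<le> (A + C * (\<Sum>i<m. q ^ i)) + C * q ^ (n0 + m)"
      using Suc block[of "n0 + m"] by (intro add_mono) auto
    also have "\<dots> \<le> (A + C * (\<Sum>i<m. q ^ i)) + C * q ^ m"
      using C q by (intro add_left_mono mult_left_mono power_decreasing) auto
    finally show ?case by (simp add: algebra_simps)
  qed (simp add: A_def)
  have geo: "(\<Sum>i<m. q ^ i) \<le> 1 / (1 - q)" for m
    using q by (simp add: sum_gp_strict divide_right_mono)
  have "sum a F \<le> A + C * (1 / (1 - q))" if F: "finite F" for F
  proof -
    obtain m where m: "F \<subseteq> {..<m}" using finite_nat_bounded[OF F] by blast
    have "m < 2 ^ m" by (rule less_exp)
    also have "(2::nat) ^ m \<le> 2 ^ (n0 + m)" by (intro power_increasing) auto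
    finally have "F \<subseteq> {..<2 ^ (n0 + m)}" using m by auto
    then have "sum a F \<le> (\<Sum>k<2^(n0+m). a k)" using a by (intro sum_mono2) auto
    also have "\<dots> \<le> A + C * (\<Sum>i<m. q ^ i)" by (rule part)
    also have "\<dots> \<le> A + C * (1 / (1 - q))" using geo C by (intro add_left_mono mult_left_mono) auto
    finally show ?thesis .
  qed
  then show ?thesis by blast
qed

lemma integral_Iset:
  fixes F :: "real \<Rightarrow> real"
  assumes "continuous_on UNIV F"
  shows "integral Iset F = integral {1..2} F + integral {1..2} (\<lambda>y. F (- y))" "F integrable_on Iset"
proof -
  have int: "F integrable_on {a..b}" for a b
    using assms by (intro integrable_continuous_real) (auto elim: continuous_on_subset)
  have neg: "negligible ({-2..-1} \<inter> {1..2::real})" by simp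
  have "(F has_integral (integral {-2..-1} F + integral {1..2} F)) ({-2..-1} \<union> {1..2})"
    by (rule has_integral_Un[OF integrable_integral[OF int] integrable_integral[OF int] neg])
  moreover have "integral {-2..-1} F = integral {1..2} (\<lambda>y. F (- y))"
    using Henstock_Kurzweil_Integration.integral_reflect_real[where a = 1 and b = 2 and f = "\<lambda>y. F (- y)"] by simp
  ultimately have "(F has_integral (integral {1..2} F + integral {1..2} (\<lambda>y. F (- y)))) Iset"
    by (simp add: Iset_def add.commute)
  then show "integral Iset F = integral {1..2} F + integral {1..2} (\<lambda>y. F (- y))" "F integrable_on Iset"
    by (auto simp: integral_unique intro: has_integral_integrable)
qed

lemma deriv_powr_continuous:
  assumes "g holomorphic_on HP 0" "t > 0"
  shows "continuous_on UNIV (\<lambda>y. norm (deriv g (Complex 1 (c * y))) powr t)"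
proof -
  have "continuous_on (HP 0) (deriv g)"
    using assms(1) by (intro holomorphic_on_imp_continuous_on holomorphic_deriv) auto
  moreover have "continuous_on UNIV (\<lambda>y. Complex 1 (c * y))"
    by (intro continuous_intros)
  ultimately have "continuous_on UNIV (\<lambda>y. deriv g (Complex 1 (c * y)))"
    by (rule continuous_on_compose2) auto
  then show ?thesis using assms(2) by (intro continuous_on_powr' continuous_intros) auto
qed

text \<open>On the line \<open>Re z = 1\<close> the sum over a dyadic block is comparable to one integral mean.\<close>
lemma boundary_sum_bounded:
  assumes hol: "g holomorphic_on HP 0" and inj: "inj_on g (HP 0)" and t: "t > 0" and \<epsilon>: "\<epsilon> > 0"
    and means: "\<And>T. T \<ge> T0 \<Longrightarrow> integral Iset (\<lambda>y. norm (deriv g (Complex 1 (T * y))) powr t) \<le> C * T powr (- 1 - \<epsilon>)"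
  shows "\<exists>B. \<forall>F. finite F \<longrightarrow> (\<Sum>k\<in>F. norm (deriv g (Complex 1 (2 * pi * of_int k))) powr t) \<le> B"
proof -
  obtain K where K: "K \<ge> 1" "\<And>g a b. g holomorphic_on HP 0 \<Longrightarrow> inj_on g (HP 0) \<Longrightarrow> Re a \<ge> 1 \<Longrightarrow> Re b \<ge> 1
      \<Longrightarrow> dist a b \<le> 2 * pi \<Longrightarrow> norm (deriv g b) \<le> K * norm (deriv g a)"
    using univalent_distortion_HP[of 1 "2 * pi"] by auto
  define C' where "C' = K powr t * (max C 0 * (2 * pi) powr (- 1 - \<epsilon>))"
  have C': "C' \<ge> 0" by (simp add: C'_def)
  define q where "q = 2 powr (- \<epsilon>)"
  have q: "0 < q" "q < 1" using \<epsilon> by (auto simp: q_def powr_def)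
  obtain n0 :: nat where n0: "T0 \<le> real n0" using real_arch_simple by blast
  \<comment> \<open>The sign \<sigma> selects positive or negative integers, that is, one of the two
    halves of \<open>Iset\<close>.\<close>
  have main: "\<exists>B. \<forall>F. finite F \<longrightarrow> (\<Sum>k\<in>F. norm (deriv g (Complex 1 (\<sigma> * (2 * pi * real k)))) powr t) \<le> B"
    if \<sigma>: "\<sigma> = 1 \<or> \<sigma> = -1" for \<sigma> :: real
  proof (rule bounded_sum_of_dyadic_blocks[OF _ q C', where ?n0.0 = n0])
    fix n assume n: "n \<ge> n0"
    \<comment> \<open>With this \<open>T\<close> the point \<open>y = k / 2^n\<close> gives height
      \<open>2 * pi * k\<close>, so \<open>1 \<le> y \<le> 2\<close> sweeps exactly the block from
      \<open>2^n\<close> to \<open>2^Suc n\<close>.\<close>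
    define T where "T = 2 * pi * 2 ^ n"
    define F where "F y = norm (deriv g (Complex 1 (T * y))) powr t" for y
    define a where "a k = norm (deriv g (Complex 1 (\<sigma> * (2 * pi * real k)))) powr t" for k
    have T0: "T > 0" by (simp add: T_def)
    have "real n \<le> 2 ^ n" using less_exp[of n] by (metis less_imp_le of_nat_less_iff of_nat_numeral of_nat_power)
    also have "\<dots> \<le> T" unfolding T_def using pi_gt3 by simp
    finally have TT0: "T \<ge> T0" using n n0 by linarith
    have Fc: "continuous_on UNIV F" unfolding F_def by (rule deriv_powr_continuous[OF hol t])
    have Fc': "continuous_on A (\<lambda>y. F (\<sigma> * y))" for A
      by (rule continuous_on_compose2[OF Fc]) (auto intro!: continuous_intros)
    have lower: "a k \<le> K powr t * F (\<sigma> * y)" if "real k * (1/2^n) \<le> y" "y \<le> real (Suc k) * (1/2^n)" for k y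
    proof -
      have y: "real k \<le> 2 ^ n * y" "2 ^ n * y \<le> real k + 1" using that by (simp_all add: field_simps)
      have "dist (Complex 1 (T * (\<sigma> * y))) (Complex 1 (\<sigma> * (2 * pi * real k))) = \<bar>\<sigma>\<bar> * (2 * pi * \<bar>2 ^ n * y - real k\<bar>)"
      proof -
        have "Complex 1 (T * (\<sigma> * y)) - Complex 1 (\<sigma> * (2 * pi * real k)) = Complex 0 (\<sigma> * (2 * pi * (2 ^ n * y - real k)))"
          by (simp add: complex_eq_iff T_def algebra_simps)
        moreover have "norm (Complex 0 u) = \<bar>u\<bar>" for u by (simp add: complex_norm)
        ultimately show ?thesis by (simp add: dist_norm abs_mult)
      qed
      also have "\<dots> \<le> 1 * (2 * pi * 1)" using y \<sigma> by (intro mult_mono) auto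
      finally have "norm (deriv g (Complex 1 (\<sigma> * (2 * pi * real k)))) \<le> K * norm (deriv g (Complex 1 (T * (\<sigma> * y))))"
        by (intro K(2) hol inj) simp_all
      then have "a k \<le> (K * norm (deriv g (Complex 1 (T * (\<sigma> * y))))) powr t"
        unfolding a_def using t by (intro powr_mono2) auto
      then show ?thesis using K(1) by (simp add: powr_mult F_def)
    qed
    have "(\<Sum>k=2^n..<2^n+2^n. a k * (1/2^n)) \<le> integral {real (2^n) * (1/2^n)..real (2^n + 2^n) * (1/2^n)} (\<lambda>y. K powr t * F (\<sigma> * y))"
      by (rule sum_le_integral_steps) (use lower in \<open>auto intro!: continuous_intros Fc'\<close>)
    also have "\<dots> = K powr t * integral {1..2} (\<lambda>y. F (\<sigma> * y))" by simp
    also have "\<dots> \<le> K powr t * integral Iset F"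
    proof (rule mult_left_mono)
      have pos: "integral {1..2} F \<ge> 0" "integral {1..2} (\<lambda>y. F (- y)) \<ge> 0"
      proof -
        have "continuous_on {1..2} (\<lambda>y. F (- y))"
          by (rule continuous_on_compose2[OF Fc]) (auto intro!: continuous_intros)
        moreover have "F y \<ge> 0" for y by (simp add: F_def)
        ultimately show "integral {1..2} F \<ge> 0" "integral {1..2} (\<lambda>y. F (- y)) \<ge> 0"
          using continuous_on_subset[OF Fc] by (auto intro!: integral_nonneg integrable_continuous_real)
      qed
      then show "integral {1..2} (\<lambda>y. F (\<sigma> * y)) \<le> integral Iset F"
        using \<sigma> integral_Iset(1)[OF Fc] by auto
    qed simp
    also have "\<dots> \<le> K powr t * (C * T powr (- 1 - \<epsilon>))"
      unfolding F_def using means[OF TT0] by (intro mult_left_mono) auto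
    also have "\<dots> \<le> K powr t * (max C 0 * T powr (- 1 - \<epsilon>))"
      by (intro mult_left_mono mult_right_mono) auto
    also have "\<dots> = C' * (2 ^ n) powr (- 1 - \<epsilon>)" by (simp add: C'_def T_def powr_mult)
    \<comment> \<open>The factor \<open>1/2^n\<close> is the mesh width and cancels; the surplus
      \<epsilon> leaves the geometric factor \<open>q ^ n\<close> that makes the blocks
      summable.\<close>
    also have "(2 ^ n :: real) powr (- 1 - \<epsilon>) = q ^ n * (1/2^n)"
    proof -
      have "(2 ^ n :: real) powr (- 1 - \<epsilon>) = (2 ^ n) powr (- \<epsilon>) * (2 ^ n) powr (- 1)"
      proof -
        have eq: "- 1 - \<epsilon> = - \<epsilon> + (- 1)" by simp
        show ?thesis unfolding eq by (rule powr_add)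
      qed
      also have "(2 ^ n :: real) powr (- \<epsilon>) = q ^ n"
        by (simp add: q_def powr_realpow[symmetric] powr_powr mult.commute)
      also have "(2 ^ n :: real) powr (- 1) = 1/2^n" by (simp add: powr_minus_divide)
      finally show ?thesis .
    qed
    finally have "(\<Sum>k=2^n..<2^n+2^n. a k) * (1/2^n) \<le> (C' * q ^ n) * (1/2^n)"
      by (simp add: sum_divide_distrib)
    then have "(\<Sum>k=2^n..<2^n+2^n. a k) \<le> C' * q ^ n"
      by (rule mult_right_le_imp_le) simp
    moreover have "2 ^ n + 2 ^ n = (2::nat) ^ Suc n" by simp
    ultimately have "(\<Sum>k=2^n..<2^Suc n. a k) \<le> C' * q ^ n" by simp
    then show "(\<Sum>k=2^n..<2^Suc n. norm (deriv g (Complex 1 (\<sigma> * (2 * pi * real k)))) powr t) \<le> C' * q ^ n"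
      by (simp only: a_def)
  qed simp
  obtain B1 where B1: "\<And>F. finite F \<Longrightarrow> (\<Sum>k\<in>F. norm (deriv g (Complex 1 (1 * (2 * pi * real k)))) powr t) \<le> B1"
    using main[of 1] by blast
  obtain B2 where B2: "\<And>F. finite F \<Longrightarrow> (\<Sum>k\<in>F. norm (deriv g (Complex 1 (-1 * (2 * pi * real k)))) powr t) \<le> B2"
    using main[of "-1"] by blast
  have "(\<Sum>k\<in>F. norm (deriv g (Complex 1 (2 * pi * of_int k))) powr t) \<le> B1 + B2" if F: "finite F" for F
  proof -
    define b where "b k = norm (deriv g (Complex 1 (2 * pi * of_int k))) powr t" for k :: int
    have "sum b F = sum b {k\<in>F. k \<ge> 0} + sum b {k\<in>F. \<not> k \<ge> 0}"
    proof -
      have "{k\<in>F. k \<ge> 0} \<union> {k\<in>F. \<not> k \<ge> 0} = F" by blast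
      then have "sum b F = sum b ({k\<in>F. k \<ge> 0} \<union> {k\<in>F. \<not> k \<ge> 0})" by simp
      also have "\<dots> = sum b {k\<in>F. k \<ge> 0} + sum b {k\<in>F. \<not> k \<ge> 0}"
        using F by (intro sum.union_disjoint) auto
      finally show ?thesis .
    qed
    also have "sum b {k\<in>F. k \<ge> 0} = (\<Sum>k\<in>nat ` {k\<in>F. k \<ge> 0}. b (int k))"
      by (subst sum.reindex) (auto simp: inj_on_def)
    also have "\<dots> \<le> B1" using B1[of "nat ` {k\<in>F. k \<ge> 0}"] F by (simp add: b_def)
    also have "sum b {k\<in>F. \<not> k \<ge> 0} = (\<Sum>k\<in>(\<lambda>k. nat (- k)) ` {k\<in>F. \<not> k \<ge> 0}. b (- int k))"
      by (subst sum.reindex) (auto simp: inj_on_def)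
    also have "\<dots> \<le> B2" using B2[of "(\<lambda>k. nat (- k)) ` {k\<in>F. \<not> k \<ge> 0}"] F by (simp add: b_def)
    finally show ?thesis by (simp add: b_def)
  qed
  then show ?thesis by blast
qed

context tract_system
begin

text \<open>On \<open>Re z = \<delta>\<close> distortion compares the sum with the one on
  \<open>Re z = 1\<close>. The bound is carried to the right by Phragmen-Lindelof, applied to a
  holomorphic function that equals the sum at one point and is dominated by it elsewhere.\<close>

lemma fibre_sum_bounded:
  assumes j: "j < N" and t: "t > 0"
    and B: "\<And>F. finite F \<Longrightarrow> (\<Sum>k\<in>F. norm (deriv (g j) (Complex 1 (2 * pi * of_int k))) powr t) \<le> B"
  shows "\<exists>B'. \<forall>z F. Re z \<ge> \<delta> \<longrightarrow> finite F \<longrightarrow> (\<Sum>k\<in>F. norm (deriv (g j) (z + per k)) powr t) \<le> B'"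
proof -
  have jI: "(j, 0) \<in> I" using j by (simp add: I_def)
  have gG: "G (j, 0) = g j" by (rule ext) (simp add: G_def)
  have hol: "g j holomorphic_on HP 0" by (rule g_hol[OF j])
  have inj: "inj_on (g j) (HP 0)" using G_inj[OF jI] by (simp add: gG)
  obtain K where K: "K \<ge> 1" "\<And>g a b. g holomorphic_on HP 0 \<Longrightarrow> inj_on g (HP 0) \<Longrightarrow> Re a \<ge> min \<delta> 1 \<Longrightarrow> Re b \<ge> min \<delta> 1
      \<Longrightarrow> dist a b \<le> \<delta> + 1 + pi \<Longrightarrow> norm (deriv g b) \<le> K * norm (deriv g a)"
    using univalent_distortion_HP[of "min \<delta> 1" "\<delta> + 1 + pi"] delta_pos by auto
  have line: "(\<Sum>k\<in>F. norm (deriv (g j) (z + per k)) powr t) \<le> K powr t * B" if z: "Re z = \<delta>" and F: "finite F" for z F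
  proof -
    obtain k0 where k0: "\<bar>Im z + 2 * pi * of_int k0\<bar> \<le> pi" using exists_period_shift by blast
    have "(\<Sum>k\<in>F. norm (deriv (g j) (z + per k)) powr t)
        \<le> (\<Sum>k\<in>F. K powr t * norm (deriv (g j) (Complex 1 (2 * pi * of_int (k - k0)))) powr t)"
    proof (rule sum_mono)
      fix k
      define y where "y = Complex 1 (2 * pi * of_int (k - k0))"
      have Re: "Re (y - (z + per k)) = 1 - \<delta>" using z by (simp add: y_def)
      have Im: "Im (y - (z + per k)) = - (Im z + 2 * pi * of_int k0)" by (simp add: y_def Im_per algebra_simps)
      have "dist y (z + per k) \<le> \<bar>Re (y - (z + per k))\<bar> + \<bar>Im (y - (z + per k))\<bar>"
        unfolding dist_norm by (rule cmod_le)
      also have "\<dots> \<le> \<delta> + 1 + pi" unfolding Re Im using k0 delta_pos by linarith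
      finally have "norm (deriv (g j) (z + per k)) \<le> K * norm (deriv (g j) y)"
        using z by (intro K(2) hol inj) (simp_all add: y_def)
      then have "norm (deriv (g j) (z + per k)) powr t \<le> (K * norm (deriv (g j) y)) powr t"
        using t by (intro powr_mono2) auto
      then show "norm (deriv (g j) (z + per k)) powr t
          \<le> K powr t * norm (deriv (g j) (Complex 1 (2 * pi * of_int (k - k0)))) powr t"
        using K(1) by (simp add: powr_mult y_def)
    qed
    also have "\<dots> = K powr t * (\<Sum>k\<in>(\<lambda>k. k - k0) ` F. norm (deriv (g j) (Complex 1 (2 * pi * of_int k))) powr t)"
      by (subst sum.reindex) (auto simp: inj_on_def sum_distrib_left)
    also have "\<dots> \<le> K powr t * B" using F by (intro mult_left_mono B) auto
    finally show ?thesis .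
  qed
  have "deriv (g j) holomorphic_on HP 0" using hol by (intro holomorphic_deriv) auto
  moreover have "\<forall>z\<in>HP 0. deriv (g j) z \<noteq> 0" using inj_deriv_nonzero[OF hol open_HP inj] by blast
  ultimately obtain lg where lg: "lg holomorphic_on HP 0" "\<And>z. z \<in> HP 0 \<Longrightarrow> deriv (g j) z = exp (lg z)"
    using holomorphic_logarithm_exists[of "HP 0" "deriv (g j)" 1] by (metis HP_iff convex_HP open_HP one_complex.simps(1) zero_less_one)
  \<comment> \<open>A holomorphic branch of the power \<open>t\<close> of the derivative, available
    since univalence makes the derivative zero-free on the half-plane.\<close>
  define Q where "Q z = exp (of_real t * lg z)" for z
  have Qn: "norm (Q z) = norm (deriv (g j) z) powr t" if "Re z > 0" for z
    using that lg(2)[of z] by (simp add: Q_def norm_exp_eq_Re powr_def)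
  have per_hol: "(\<lambda>z. Q (z + per k)) holomorphic_on HP 0" for k
  proof -
    have "lg \<circ> (\<lambda>z. z + per k) holomorphic_on HP 0"
      by (rule holomorphic_on_compose_gen[OF _ lg(1)]) (auto intro!: holomorphic_intros)
    then have "(\<lambda>z. lg (z + per k)) holomorphic_on HP 0" by (simp add: o_def)
    then show ?thesis unfolding Q_def by (intro holomorphic_intros)
  qed
  have Qbnd: "norm (Q (z + per k)) \<le> (48 / \<delta>) powr t" if z: "Re z \<ge> \<delta>" for z k
  proof -
    have z0: "Re (z + per k) > 0" using z delta_pos by simp
    have "\<delta> * norm (deriv (g j) (z + per k)) \<le> Re (z + per k) * norm (deriv (g j) (z + per k))"
      using z by (intro mult_right_mono) auto
    also have "\<dots> \<le> 48" using deriv_G_bound[OF jI z0] by (simp add: gG)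
    finally have "norm (deriv (g j) (z + per k)) \<le> 48 / \<delta>" using delta_pos by (simp add: field_simps)
    then show ?thesis unfolding Qn[OF z0] using t by (intro powr_mono2) auto
  qed
  have "(\<Sum>k\<in>F. norm (deriv (g j) (z + per k)) powr t) \<le> K powr t * B" if z: "Re z \<ge> \<delta>" and F: "finite F" for z F
  proof -
    \<comment> \<open>The phases are fixed at the given \<open>z\<close>, so that \<open>H z\<close>
      is the full sum of moduli there and the triangle inequality bounds \<open>H\<close> by the sum
      elsewhere.\<close>
    define u where "u k = cnj (sgn (Q (z + per k)))" for k
    have u: "norm (u k) \<le> 1" for k by (simp add: u_def norm_sgn)
    define H where "H x = (\<Sum>k\<in>F. u k * Q (x + per k))" for x
    have "norm (H z) \<le> K powr t * B"
    proof (rule Phragmen_Lindelof_HP[OF _ delta_pos, where f = H and z = z])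
      show "H holomorphic_on HP 0" unfolding H_def by (intro holomorphic_intros per_hol)
      have le: "norm (H x) \<le> (\<Sum>k\<in>F. norm (Q (x + per k)))" for x
        unfolding H_def
      proof (rule sum_norm_le)
        fix k
        have "norm (u k) * norm (Q (x + per k)) \<le> 1 * norm (Q (x + per k))"
          by (intro mult_right_mono u) simp
        then show "norm (u k * Q (x + per k)) \<le> norm (Q (x + per k))" by (simp add: norm_mult)
      qed
      \<comment> \<open>The bound depends on \<open>card F\<close>, but Phragmen-Lindelof only asks
        for some bound; its conclusion involves the boundary value alone.\<close>
      show "norm (H x) \<le> real (card F) * (48 / \<delta>) powr t" if "Re x \<ge> \<delta>" for x
        using le[of x] sum_bounded_above[of F "\<lambda>k. norm (Q (x + per k))"] Qbnd[OF that] by force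
      show "norm (H x) \<le> K powr t * B" if x: "Re x = \<delta>" for x
      proof -
        have "(\<Sum>k\<in>F. norm (Q (x + per k))) = (\<Sum>k\<in>F. norm (deriv (g j) (x + per k)) powr t)"
          using x delta_pos by (intro sum.cong Qn) auto
        then show ?thesis using le[of x] line[OF x F] by simp
      qed
    qed (rule z)
    moreover have "H z = of_real (\<Sum>k\<in>F. norm (deriv (g j) (z + per k)) powr t)"
    proof -
      have "u k * Q (z + per k) = of_real (norm (deriv (g j) (z + per k)) powr t)" for k
      proof -
        have "u k * Q (z + per k) = of_real (norm (Q (z + per k)))"
        proof -
          define v where "v = Q (z + per k)"
          have "cnj (sgn v) * v = (v * cnj v) / of_real (norm v)" by (simp add: sgn_eq)
          also have "v * cnj v = of_real ((norm v)\<^sup>2)" by (simp only: complex_norm_square)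
          also have "\<dots> / of_real (norm v) = of_real (norm v)" by (simp add: power2_eq_square)
          finally show ?thesis by (simp only: u_def v_def)
        qed
        then show ?thesis using Qn[of "z + per k"] z delta_pos by simp
      qed
      then show ?thesis by (simp add: H_def)
    qed
    ultimately have "norm (complex_of_real (\<Sum>k\<in>F. norm (deriv (g j) (z + per k)) powr t)) \<le> K powr t * B" by simp
    moreover have "(\<Sum>k\<in>F. norm (deriv (g j) (z + per k)) powr t) \<ge> 0" by (intro sum_nonneg) auto
    ultimately show ?thesis unfolding norm_of_real by simp
  qed
  then show ?thesis by blast
qed

text \<open>Of the exponent \<open>h\<close>, the part \<open>t\<close> is summed along the fibres,
  and the part \<open>h - t\<close> goes to the Bloch bound \<open>48 / Re z\<close>, which supplies
  the decay.\<close>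

lemma L_decay:
  assumes t: "0 < t" "t < h"
    and B: "\<And>j. j < N \<Longrightarrow> \<exists>B. \<forall>F. finite F \<longrightarrow> (\<Sum>k\<in>F. norm (deriv (g j) (Complex 1 (2 * pi * of_int k))) powr t) \<le> B"
  shows "\<exists>C\<ge>0. \<forall>z. Re z \<ge> \<delta> \<longrightarrow> L h (\<lambda>_. 1) z \<le> ennreal (C / Re z powr (h - t))"
proof -
  have "\<exists>B'. \<forall>z F. Re z \<ge> \<delta> \<longrightarrow> finite F \<longrightarrow> (\<Sum>k\<in>F. norm (deriv (g j) (z + per k)) powr t) \<le> B'" if "j < N" for j
    using fibre_sum_bounded[OF that t(1)] B[OF that] by blast
  then obtain B' where B': "\<And>j z F. j < N \<Longrightarrow> Re z \<ge> \<delta> \<Longrightarrow> finite F \<Longrightarrow>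
      (\<Sum>k\<in>F. norm (deriv (g j) (z + per k)) powr t) \<le> B' j"
    by metis
  define A where "A = (\<Sum>j<N. B' j)"
  have A: "A \<ge> 0" unfolding A_def
  proof (rule sum_nonneg)
    fix j assume "j \<in> {..<N}"
    then show "0 \<le> B' j" using B'[of j "of_real \<delta>" "{}"] by simp
  qed
  have "L h (\<lambda>_. 1) z \<le> ennreal ((48 powr (h - t) * A) / Re z powr (h - t))" if z: "Re z \<ge> \<delta>" for z
    unfolding L_def
  proof (rule infsum_le_ennreal)
    fix F assume F: "finite F" "F \<subseteq> I"
    have z0: "Re z > 0" using z delta_pos by simp
    have dG: "deriv (G i) z = deriv (g (fst i)) (z + per (snd i))" if "i \<in> I" for i
    proof (rule DERIV_imp_deriv)
      have "(g (fst i) has_field_derivative deriv (g (fst i)) (z + per (snd i))) (at (z + per (snd i)))"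
        using z0 fst_I[OF that] by (intro holomorphic_derivI[OF g_hol open_HP]) auto
      then show "(G i has_field_derivative deriv (g (fst i)) (z + per (snd i))) (at z)"
        unfolding G_def by (simp only: DERIV_shift)
    qed
    have "(\<Sum>i\<in>F. ennreal (norm (deriv (G i) z) powr h) * 1) = ennreal (\<Sum>i\<in>F. norm (deriv (G i) z) powr h)"
      by simp
    also have "\<dots> \<le> ennreal (\<Sum>i\<in>F. (48 / Re z) powr (h - t) * norm (deriv (G i) z) powr t)"
    proof (intro ennreal_leI sum_mono)
      fix i assume "i \<in> F"
      then have i: "i \<in> I" using F by blast
      have "norm (deriv (G i) z) \<le> 48 / Re z"
        using deriv_G_bound[OF i z0] z0 by (simp add: field_simps)
      then have "norm (deriv (G i) z) powr (h - t) \<le> (48 / Re z) powr (h - t)"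
        using t by (intro powr_mono2) auto
      then have "norm (deriv (G i) z) powr (h - t) * norm (deriv (G i) z) powr t
          \<le> (48 / Re z) powr (h - t) * norm (deriv (G i) z) powr t" by (intro mult_right_mono) auto
      then show "norm (deriv (G i) z) powr h \<le> (48 / Re z) powr (h - t) * norm (deriv (G i) z) powr t"
        by (simp add: powr_add[symmetric])
    qed
    also have "\<dots> = ennreal ((48 / Re z) powr (h - t) * (\<Sum>i\<in>F. norm (deriv (G i) z) powr t))"
      by (simp add: sum_distrib_left)
    also have "\<dots> \<le> ennreal ((48 / Re z) powr (h - t) * A)"
    proof (intro ennreal_leI mult_left_mono)
      have "(\<Sum>i\<in>F. norm (deriv (G i) z) powr t) = (\<Sum>i\<in>F. norm (deriv (g (fst i)) (z + per (snd i))) powr t)"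
        using F dG by (intro sum.cong) auto
      also have "\<dots> \<le> (\<Sum>i\<in>{..<N} \<times> snd ` F. norm (deriv (g (fst i)) (z + per (snd i))) powr t)"
        using F by (intro sum_mono2) (auto simp: I_def intro: rev_image_eqI)
      also have "\<dots> = (\<Sum>j<N. \<Sum>k\<in>snd ` F. norm (deriv (g j) (z + per k)) powr t)"
        by (simp add: sum.cartesian_product case_prod_unfold)
      also have "\<dots> \<le> A" unfolding A_def using F z by (intro sum_mono B') auto
      finally show "(\<Sum>i\<in>F. norm (deriv (G i) z) powr t) \<le> A" .
    qed simp
    also have "(48 / Re z) powr (h - t) * A = (48 powr (h - t) * A) / Re z powr (h - t)"
      using z0 by (simp add: powr_divide)
    finally show "(\<Sum>i\<in>F. ennreal (norm (deriv (G i) z) powr h) * 1) \<le> ennreal ((48 powr (h - t) * A) / Re z powr (h - t))" .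
  qed
  then show ?thesis using A by (intro exI[of _ "48 powr (h - t) * A"]) simp
qed

lemma L_bounded_and_small:
  assumes t: "0 < t" "t < h"
    and B: "\<And>j. j < N \<Longrightarrow> \<exists>B. \<forall>F. finite F \<longrightarrow> (\<Sum>k\<in>F. norm (deriv (g j) (Complex 1 (2 * pi * of_int k))) powr t) \<le> B"
  shows "\<exists>B. \<forall>z. Re z \<ge> \<delta> \<longrightarrow> L h (\<lambda>_. 1) z \<le> ennreal B"
    and "\<exists>\<rho>. \<forall>z. Re z \<ge> \<rho> \<longrightarrow> L h (\<lambda>_. 1) z \<le> ennreal (1/2)"
proof -
  obtain C where C: "C \<ge> 0" "\<And>z. Re z \<ge> \<delta> \<Longrightarrow> L h (\<lambda>_. 1) z \<le> ennreal (C / Re z powr (h - t))"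
    using L_decay[OF t B] by blast
  have "L h (\<lambda>_. 1) z \<le> ennreal (C / \<delta> powr (h - t))" if z: "Re z \<ge> \<delta>" for z
  proof -
    have "C / Re z powr (h - t) \<le> C / \<delta> powr (h - t)"
      using C(1) z delta_pos t by (intro divide_left_mono powr_mono2 mult_pos_pos) auto
    then show ?thesis using C(2)[OF z] ennreal_leI order_trans by blast
  qed
  then show "\<exists>B. \<forall>z. Re z \<ge> \<delta> \<longrightarrow> L h (\<lambda>_. 1) z \<le> ennreal B" by blast
  define \<rho> where "\<rho> = max \<delta> ((2 * C + 1) powr (1 / (h - t)))"
  have "L h (\<lambda>_. 1) z \<le> ennreal (1/2)" if z: "Re z \<ge> \<rho>" for z
  proof -
    have z': "Re z \<ge> \<delta>" "Re z \<ge> (2 * C + 1) powr (1 / (h - t))" using z by (auto simp: \<rho>_def)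
    have "2 * C + 1 = ((2 * C + 1) powr (1 / (h - t))) powr (h - t)"
      using C(1) t by (simp add: powr_powr)
    also have "\<dots> \<le> Re z powr (h - t)" using z'(2) t by (intro powr_mono2) auto
    finally have "2 * C \<le> Re z powr (h - t)" by simp
    then have "C / Re z powr (h - t) \<le> 1/2" using z' delta_pos by (simp add: field_simps)
    then show ?thesis using C(2)[OF z'(1)] ennreal_leI order_trans by blast
  qed
  then show "\<exists>\<rho>. \<forall>z. Re z \<ge> \<rho> \<longrightarrow> L h (\<lambda>_. 1) z \<le> ennreal (1/2)" by blast
qed

end

section \<open>From tracts to the tract system\<close>

lemma exp_less_norm_of_closure_disjoint:
  fixes A :: "complex set"
  assumes "closure A \<inter> cball 0 1 = {}"
  shows "\<exists>\<delta>>0. \<forall>z\<in>A. exp \<delta> < norm z"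
proof -
  have "\<exists>d>0. \<forall>x\<in>cball 0 1. \<forall>y\<in>closure A. d \<le> dist x y"
    by (rule separate_compact_closed) (use assms in auto)
  then obtain d where d: "d > 0" "\<And>x y. norm x \<le> 1 \<Longrightarrow> y \<in> closure A \<Longrightarrow> d \<le> dist (x :: complex) y"
    by auto
  \<comment> \<open>The radial projection \<open>z / norm z\<close> lies in the closed disc at
    distance \<open>norm z - 1\<close> from \<open>z\<close>, so \<open>norm z \<ge> 1 + d\<close>;
    halving \<open>d\<close> makes the inequality strict.\<close>
  have "exp (ln (1 + d/2)) < norm z" if z: "z \<in> A" for z
  proof -
    have zc: "z \<in> closure A" using z closure_subset by blast
    then have z1: "norm z > 1" using assms by (force simp: not_le)
    then have zn: "z \<noteq> 0" "complex_of_real (norm z) \<noteq> 0" by auto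
    define p where "p = z / of_real (norm z)"
    have "p - z = of_real ((1 - norm z) / norm z) * z"
      using zn by (simp add: p_def field_simps)
    then have "dist p z = \<bar>(1 - norm z) / norm z\<bar> * norm z" by (simp only: dist_norm norm_mult norm_of_real)
    also have "\<dots> = norm z - 1" using z1 zn(1) by (simp add: abs_divide)
    finally have "dist p z = norm z - 1" .
    moreover have "norm p \<le> 1" using z1 by (simp add: p_def norm_divide)
    then have "d \<le> dist p z" using zc by (rule d(2))
    ultimately show ?thesis using d(1) by simp
  qed
  then show ?thesis using d(1) by (intro exI[of _ "ln (1 + d/2)"]) simp
qed

text \<open>The inverse of each conformal map omits 0, because the tracts avoid the unit disc, so it
  has a holomorphic logarithm on the convex half-plane; the gap to the disc becomes the lower bound
  \<delta> on real parts.\<close>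

lemma tract_system_of_tracts:
  assumes N: "N \<ge> 1" and op: "\<And>j. j < N \<Longrightarrow> open (\<Omega> j)"
    and disj: "\<And>i j. i < N \<Longrightarrow> j < N \<Longrightarrow> i \<noteq> j \<Longrightarrow> \<Omega> i \<inter> \<Omega> j = {}"
    and conf: "\<And>j. j < N \<Longrightarrow> conformal_onto_H (\<tau> j) (\<Omega> j)"
    and fexp: "\<And>j z. j < N \<Longrightarrow> z \<in> \<Omega> j \<Longrightarrow> f z = exp (\<tau> j z)"
    and clo: "closure (\<Union>j<N. \<Omega> j) \<inter> cball 0 1 = {}"
  shows "\<exists>g \<delta>. tract_system f N (\<Union>j<N. \<Omega> j) g \<delta> \<and>
    (\<forall>j<N. \<forall>z. Re z > 0 \<longrightarrow> exp (g j z) = phi \<Omega> \<tau> j z)"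
proof -
  obtain \<delta> where \<delta>: "\<delta> > 0" "\<And>z. z \<in> (\<Union>j<N. \<Omega> j) \<Longrightarrow> exp \<delta> < norm z"
    using exp_less_norm_of_closure_disjoint[OF clo] by blast
  have bij: "bij_betw (\<tau> j) (\<Omega> j) (HP 0)" and hol: "\<tau> j holomorphic_on \<Omega> j" if "j < N" for j
    using conf[OF that] by (simp_all add: conformal_onto_H_def HP_0)
  have phi_in: "phi \<Omega> \<tau> j z \<in> \<Omega> j" and tau_phi: "\<tau> j (phi \<Omega> \<tau> j z) = z" if "j < N" "Re z > 0" for j z
  proof -
    have "z \<in> \<tau> j ` \<Omega> j" using bij_betw_imp_surj_on[OF bij[OF that(1)]] that(2) by simp
    then show "phi \<Omega> \<tau> j z \<in> \<Omega> j" "\<tau> j (phi \<Omega> \<tau> j z) = z"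
      unfolding phi_def by (rule inv_into_into, rule f_inv_into_f)
  qed
  have phi_tau: "phi \<Omega> \<tau> j (\<tau> j v) = v" if "j < N" "v \<in> \<Omega> j" for j v
    unfolding phi_def using bij_betw_imp_inj_on[OF bij[OF that(1)]] that(2) by (rule inv_into_f_f)
  have tau_pos: "Re (\<tau> j v) > 0" if "j < N" "v \<in> \<Omega> j" for j v
    using bij_betwE[OF bij[OF that(1)]] that(2) by simp
  have phi_hol: "phi \<Omega> \<tau> j holomorphic_on HP 0" if j: "j < N" for j
  proof -
    obtain p where p: "p holomorphic_on (\<tau> j ` \<Omega> j)" "\<And>v. v \<in> \<Omega> j \<Longrightarrow> p (\<tau> j v) = v"
      using holomorphic_has_inverse[OF hol[OF j] op[OF j] bij_betw_imp_inj_on[OF bij[OF j]]] by metis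
    have im: "\<tau> j ` \<Omega> j = HP 0" by (rule bij_betw_imp_surj_on[OF bij[OF j]])
    show ?thesis
    proof (rule holomorphic_transform[OF p(1)[unfolded im]])
      show "p z = phi \<Omega> \<tau> j z" if "z \<in> HP 0" for z
        using p(2)[OF phi_in[OF j], of z] tau_phi[OF j, of z] that by simp
    qed
  qed
  have "\<exists>g. g holomorphic_on HP 0 \<and> (\<forall>z\<in>HP 0. phi \<Omega> \<tau> j z = exp (g z))" if j: "j < N" for j
  proof -
    have nz: "\<forall>z\<in>HP 0. phi \<Omega> \<tau> j z \<noteq> 0"
    proof
      fix z assume "z \<in> HP 0"
      then have "phi \<Omega> \<tau> j z \<in> (\<Union>j<N. \<Omega> j)" using phi_in[OF j, of z] j by auto
      then have "exp \<delta> < norm (phi \<Omega> \<tau> j z)" by (rule \<delta>(2))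
      then show "phi \<Omega> \<tau> j z \<noteq> 0" using exp_gt_zero[of \<delta>] by auto
    qed
    have "1 \<in> HP 0" by simp
    from holomorphic_logarithm_exists[OF convex_HP open_HP phi_hol[OF j] _ this] nz
    show ?thesis by metis
  qed
  then have "\<forall>j. \<exists>g. j < N \<longrightarrow> g holomorphic_on HP 0 \<and> (\<forall>z\<in>HP 0. phi \<Omega> \<tau> j z = exp (g z))"
    by blast
  from choice[OF this] obtain g where
    g': "\<forall>j. j < N \<longrightarrow> g j holomorphic_on HP 0 \<and> (\<forall>z\<in>HP 0. phi \<Omega> \<tau> j z = exp (g j z))" by blast
  then have g: "\<And>j. j < N \<Longrightarrow> g j holomorphic_on HP 0"
      "\<And>j z. j < N \<Longrightarrow> Re z > 0 \<Longrightarrow> phi \<Omega> \<tau> j z = exp (g j z)"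
    by simp_all
  have "tract_system f N (\<Union>j<N. \<Omega> j) g \<delta>"
  proof
    show "\<delta> > 0" "N \<ge> 1" by fact+
    show "g j holomorphic_on HP 0" if "j < N" for j by (rule g(1)[OF that])
    fix j assume j: "j < N"
    show in_W: "exp (g j z) \<in> (\<Union>j<N. \<Omega> j)" if "Re z > 0" for z
      using phi_in[OF j that] j unfolding g(2)[OF j that] by blast
    show "Re (g j z) > \<delta>" if "Re z > 0" for z
      using \<delta>(2)[OF in_W[OF that]] by (simp add: norm_exp_eq_Re)
    show "f (exp (g j z)) = exp z" if "Re z > 0" for z
      using fexp[OF j phi_in[OF j that]] tau_phi[OF j that] g(2)[OF j that] by simp
  next
    fix v assume "v \<in> (\<Union>j<N. \<Omega> j)"
    then obtain j where j: "j < N" "v \<in> \<Omega> j" by blast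
    have "v = exp (g j (\<tau> j v))" using g(2)[OF j(1) tau_pos[OF j]] phi_tau[OF j] by simp
    then show "\<exists>j<N. \<exists>z. Re z > 0 \<and> v = exp (g j z)" using j tau_pos[OF j] by blast
  next
    fix j k z z' assume *: "j < N" "k < N" "Re z > 0" "Re z' > 0" "exp (g j z) = exp (g k z')"
    then have eq: "phi \<Omega> \<tau> j z = phi \<Omega> \<tau> k z'" using g(2) by simp
    then have "\<Omega> j \<inter> \<Omega> k \<noteq> {}" using phi_in[OF *(1,3)] phi_in[OF *(2,4)] by auto
    then have "j = k" using disj[OF *(1,2)] by blast
    moreover have "z = z'" using eq tau_phi[OF *(1,3)] tau_phi[OF *(2,4)] \<open>j = k\<close> by metis
    ultimately show "j = k \<and> z = z'" ..
  next
    have "f holomorphic_on \<Omega> j" if "j < N" for j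
    proof -
      have "(\<lambda>z. exp (\<tau> j z)) holomorphic_on \<Omega> j" by (intro holomorphic_intros hol that)
      then show ?thesis by (rule holomorphic_transform) (simp add: fexp[OF that])
    qed
    then show "f holomorphic_on (\<Union>j<N. \<Omega> j)" using op by (intro holomorphic_on_UN_open) auto
    show "open (\<Union>j<N. \<Omega> j)" using op by auto
  qed
  then show ?thesis using g(2) by (intro exI[of _ g] exI[of _ \<delta>]) auto
qed

text \<open>By bounded distortion \<open>\<phi> (1 + \<i> T y)\<close> is comparable to \<open>\<phi> T\<close> for \<open>1 \<le> |y| \<le> 2\<close>, so the
  derivative of the rescaled map at \<open>1/T + \<i> y\<close> is comparable to \<open>T\<close> times the logarithmic derivative.\<close>
lemma integral_means_decay:
  assumes hol: "g holomorphic_on HP 0" and eq: "\<And>z. Re z > 0 \<Longrightarrow> exp (g z) = phi \<Omega> \<tau> j z"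
    and bd: "bounded_distortion (phi \<Omega> \<tau> j)"
    and t: "t > 0" and neg: "b_inf \<Omega> \<tau> j t < 0"
  shows "\<exists>\<epsilon>>0. \<exists>C T0. \<forall>T\<ge>T0. integral Iset (\<lambda>y. norm (deriv g (Complex 1 (T * y))) powr t) \<le> C * T powr (- 1 - \<epsilon>)"
proof -
  define \<phi> where "\<phi> = phi \<Omega> \<tau> j"
  obtain M T1 where M: "\<And>T \<xi> \<xi>'. T \<ge> T1 \<Longrightarrow> \<xi> \<in> Qsq T - Qsq (T / 8) \<Longrightarrow> \<xi>' \<in> Qsq T - Qsq (T / 8)
      \<Longrightarrow> norm (\<phi> \<xi>) \<le> M * norm (\<phi> \<xi>')"
    using bd unfolding bounded_distortion_def \<phi>_def by blast
  have eq': "\<phi> z = exp (g z)" if "Re z > 0" for z using eq[OF that] by (simp add: \<phi>_def)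
  define b where "b = beta_inf \<Omega> \<tau> j t"
  have "\<exists>\<epsilon>>0. b < ereal (t - 1 - \<epsilon>)"
  \<comment> \<open>The limsup is an extended real: negativity excludes +\<infinity>, and the value
    -\<infinity> leaves \<epsilon> arbitrary.\<close>
  proof (cases b)
    case (real r)
    then have "r - t + 1 < 0" using neg by (simp add: b_inf_def b_def[symmetric] one_ereal_def zero_ereal_def)
    then show ?thesis using real by (intro exI[of _ "(t - 1 - r) / 2"]) (simp add: field_simps)
  next
    case PInf
    then show ?thesis using neg by (simp add: b_inf_def b_def[symmetric])
  next
    case MInf
    then show ?thesis by (intro exI[of _ 1]) simp
  qed
  then obtain \<epsilon> where \<epsilon>: "\<epsilon> > 0" "b < ereal (t - 1 - \<epsilon>)" by blast
  have "\<forall>\<^sub>F T in at_top. ereal (beta (phiT \<Omega> \<tau> j T) (1 / T) t) < ereal (t - 1 - \<epsilon>)"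
    using \<epsilon>(2) unfolding b_def beta_inf_def by (rule Limsup_lessD)
  then obtain T2 where T2: "\<And>T. T \<ge> T2 \<Longrightarrow> beta (phiT \<Omega> \<tau> j T) (1 / T) t < t - 1 - \<epsilon>"
    unfolding eventually_at_top_linorder by auto
  define M' where "M' = max M 1"
  have "integral Iset (\<lambda>y. norm (deriv g (Complex 1 (T * y))) powr t) \<le> M' powr t * T powr (- 1 - \<epsilon>)"
    if T: "T \<ge> max (max T1 T2) 2" for T
  proof -
    have T': "T \<ge> T1" "T \<ge> T2" "T \<ge> 2" using T by auto
    define F where "F y = norm (deriv g (Complex 1 (T * y))) powr t" for y
    define E where "E y = norm (deriv (phiT \<Omega> \<tau> j T) (Complex (1 / T) y)) powr t" for y
    have dphi: "deriv (phiT \<Omega> \<tau> j T) (Complex (1 / T) y)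
        = of_real T * (\<phi> (Complex 1 (T * y)) * deriv g (Complex 1 (T * y))) / of_real (norm (\<phi> (of_real T)))" for y
    proof (rule DERIV_imp_deriv)
      define x where "x = Complex (1 / T) y"
      have x: "of_real T * x = Complex 1 (T * y)" "Re x > 0"
        using T'(3) by (simp_all add: x_def complex_eq_iff)
      have "(g has_field_derivative deriv g (of_real T * x)) (at (of_real T * x))"
        using x T'(3) by (intro holomorphic_derivI[OF hol open_HP]) simp
      moreover have "((\<lambda>x. of_real T * x) has_field_derivative of_real T) (at x)"
        by (auto intro!: derivative_eq_intros)
      ultimately have "((\<lambda>x. g (of_real T * x)) has_field_derivative deriv g (of_real T * x) * of_real T) (at x)"
        by (rule DERIV_chain2)
      then have "((\<lambda>x. exp (g (of_real T * x)) / of_real (norm (\<phi> (of_real T)))) has_field_derivative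
          (exp (g (of_real T * x)) * (deriv g (of_real T * x) * of_real T)) / of_real (norm (\<phi> (of_real T)))) (at x)"
        by (intro DERIV_cdivide DERIV_fun_exp)
      then have "(phiT \<Omega> \<tau> j T has_field_derivative
          (exp (g (of_real T * x)) * (deriv g (of_real T * x) * of_real T)) / of_real (norm (\<phi> (of_real T)))) (at x)"
      proof (rule has_field_derivative_transform_within_open[OF _ open_HP[of 0]])
        show "x \<in> HP 0" using x(2) by simp
        fix y assume "y \<in> HP 0"
        then have "Re (of_real T * y) > 0" using T'(3) by simp
        then show "exp (g (of_real T * y)) / of_real (norm (\<phi> (of_real T))) = phiT \<Omega> \<tau> j T y"
          using eq' by (simp add: phiT_def \<phi>_def[symmetric])
      qed
      moreover have "\<phi> (of_real T * x) = exp (g (of_real T * x))" using eq' x by simp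
      ultimately show "(phiT \<Omega> \<tau> j T has_field_derivative
         of_real T * (\<phi> (Complex 1 (T * y)) * deriv g (Complex 1 (T * y))) / of_real (norm (\<phi> (of_real T)))) (at (Complex (1 / T) y))"
        unfolding x_def[symmetric] x(1)[symmetric] by (simp add: mult_ac)
    qed
    have phi0: "norm (\<phi> (of_real T)) > 0" using eq'[of "of_real T"] T'(3) by simp
    have FE: "F y \<le> (M' powr t * T powr (- t)) * E y" if y: "y \<in> Iset" for y
    proof -
      have y': "1 \<le> \<bar>y\<bar>" "\<bar>y\<bar> \<le> 2" using y by (auto simp: Iset_def)
      have Ty: "T * 1 \<le> T * \<bar>y\<bar>" "T * \<bar>y\<bar> \<le> T * 2" using y' T'(3) by (intro mult_left_mono; simp)+
      have aTy: "\<bar>T * y\<bar> = T * \<bar>y\<bar>" using T'(3) by (simp add: abs_mult)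
      \<comment> \<open>\<open>Qsq (T / 8)\<close> has width and half-height \<open>T / 2\<close>,
        so both \<open>T\<close> and the point at height \<open>T * y\<close> lie outside it, while
        \<open>|y| \<le> 2\<close> keeps the latter inside \<open>Qsq T\<close>.\<close>
      have "norm (\<phi> (of_real T)) \<le> M * norm (\<phi> (Complex 1 (T * y)))"
        using T'(3) Ty by (intro M[OF T'(1)]) (auto simp: Qsq_def aTy simp del: abs_mult)
      also have "\<dots> \<le> M' * norm (\<phi> (Complex 1 (T * y)))"
        by (intro mult_right_mono) (simp_all add: M'_def)
      finally have ratio: "1 \<le> M' * (norm (\<phi> (Complex 1 (T * y))) / norm (\<phi> (of_real T)))"
        using phi0 by (simp add: field_simps)
      define d where "d = norm (deriv g (Complex 1 (T * y)))"
      have d0: "d \<ge> 0" by (simp add: d_def)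
      have "1 * d \<le> (M' * (norm (\<phi> (Complex 1 (T * y))) / norm (\<phi> (of_real T)))) * d"
        by (rule mult_right_mono[OF ratio d0])
      also have "\<dots> = (M' / T) * norm (deriv (phiT \<Omega> \<tau> j T) (Complex (1 / T) y))"
        unfolding dphi using T'(3) by (simp add: norm_mult norm_divide d_def)
      finally have "d \<le> (M' / T) * norm (deriv (phiT \<Omega> \<tau> j T) (Complex (1 / T) y))" by simp
      then have "d powr t \<le> ((M' / T) * norm (deriv (phiT \<Omega> \<tau> j T) (Complex (1 / T) y))) powr t"
        using t d0 by (intro powr_mono2) auto
      also have "\<dots> = (M' / T) powr t * E y"
        using T'(3) by (subst powr_mult) (simp_all add: E_def M'_def)
      also have "(M' / T) powr t = M' powr t * T powr (- t)"
        using T'(3) by (simp add: powr_divide powr_minus_divide M'_def)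
      finally show ?thesis by (simp add: F_def d_def)
    qed
    have Fc: "continuous_on UNIV F" unfolding F_def by (rule deriv_powr_continuous[OF hol t])
    have line: "continuous_on UNIV (\<lambda>y. Complex 1 (T * y))" by (intro continuous_intros)
    have gc: "continuous_on UNIV (\<lambda>y. g (Complex 1 (T * y)))"
      by (rule continuous_on_compose2[OF holomorphic_on_imp_continuous_on[OF hol] line]) auto
    have E_eq: "E y = (T * (norm (exp (g (Complex 1 (T * y)))) / norm (\<phi> (of_real T)))) powr t * F y" for y
      using T'(3) by (simp add: E_def F_def dphi eq' norm_mult norm_divide powr_mult powr_divide)
    have E_cont: "continuous_on UNIV E"
      unfolding E_eq[abs_def] using T'(3) phi0 t by (intro continuous_intros gc Fc continuous_on_powr') auto
    have Eint: "E integrable_on Iset" by (rule integral_Iset(2)[OF E_cont])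
    have Fint: "F integrable_on Iset" by (rule integral_Iset(2)[OF Fc])
    have "ln (integral Iset E) / ln T < t - 1 - \<epsilon>"
      using T2[OF T'(2)] by (simp add: beta_def E_def[abs_def])
    then have lnE: "ln (integral Iset E) < (t - 1 - \<epsilon>) * ln T" using T'(3) by (simp add: divide_less_eq)
    have Ele: "integral Iset E \<le> T powr (t - 1 - \<epsilon>)"
    \<comment> \<open>If the integral is not positive its logarithm carries no information, but then
      the bound is trivial.\<close>
    proof (cases "integral Iset E > 0")
      case True
      then have "integral Iset E = exp (ln (integral Iset E))" by simp
      also have "\<dots> \<le> exp ((t - 1 - \<epsilon>) * ln T)" using lnE by simp
      finally show ?thesis using T'(3) by (simp add: powr_def)
    next
      case False
      then show ?thesis using powr_ge_zero[of T "t - 1 - \<epsilon>"] by linarith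
    qed
    have "integral Iset F \<le> integral Iset (\<lambda>y. (M' powr t * T powr (- t)) * E y)"
      using FE Fint integrable_cmul[OF Eint, of "M' powr t * T powr (- t)"] by (intro integral_le) simp_all
    also have "\<dots> = (M' powr t * T powr (- t)) * integral Iset E" by simp
    also have "\<dots> \<le> (M' powr t * T powr (- t)) * T powr (t - 1 - \<epsilon>)"
      using Ele by (intro mult_left_mono) auto
    also have "\<dots> = M' powr t * (T powr (- t) * T powr (t - 1 - \<epsilon>))" by simp
    also have "T powr (- t) * T powr (t - 1 - \<epsilon>) = T powr (- 1 - \<epsilon>)"
      by (simp add: powr_add[symmetric])
    finally show ?thesis by (simp add: F_def)
  qed
  then show ?thesis using \<epsilon>(1) by (intro exI[of _ \<epsilon>] conjI exI[of _ "M' powr t"] exI[of _ "max (max T1 T2) 2"]) auto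
qed

section \<open>The Julia set of an entire function\<close>

lemma holomorphic_funpow:
  assumes "f holomorphic_on UNIV" shows "(f ^^ n) holomorphic_on UNIV"
proof (induction n)
  case 0
  then show ?case by (simp add: id_def)
next
  case (Suc n)
  have "f \<circ> (f ^^ n) holomorphic_on UNIV"
    by (rule holomorphic_on_compose[OF Suc]) (rule holomorphic_on_subset[OF assms], simp)
  then show ?case by (simp only: funpow.simps)
qed

text \<open>A point outside \<open>W\<close> is sent into the closed unit disc, which is disjoint
  from the closure of \<open>W\<close>, so the orbit never leaves that disc again. This persists on
  a neighbourhood, and Montel's theorem puts the point into the Fatou set.\<close>

lemma julia_set_entire_subset:
  assumes hol: "f holomorphic_on UNIV" and W: "\<And>z. norm (f z) > 1 \<Longrightarrow> z \<in> W"
    and clo: "closure W \<inter> cball 0 1 = {}" and u: "u \<in> julia_set_entire f"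
  shows "(f ^^ n) u \<in> W"
proof (rule ccontr)
  assume "(f ^^ n) u \<notin> W"
  then have "norm (f ((f ^^ n) u)) \<le> 1" using W not_le by blast
  then have n1: "norm ((f ^^ Suc n) u) \<le> 1" by simp
  \<comment> \<open>The closure makes \<open>U\<close> open; \<open>u\<close> belongs to it because
    its iterate of order \<open>Suc n\<close> is already in the closed disc.\<close>
  define U where "U = (f ^^ Suc n) -` (- closure W)"
  have "continuous_on UNIV (f ^^ Suc n)"
    by (rule holomorphic_on_imp_continuous_on[OF holomorphic_funpow[OF hol]])
  then have U: "open U" unfolding U_def by (intro open_vimage) auto
  have uU: "u \<in> U" using n1 clo by (auto simp: U_def)
  have V: "norm (f z) \<le> 1" if "z \<notin> closure W" for z
    using W[of z] closure_subset[of W] that by (meson not_le subsetD)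
  have bound: "norm ((f ^^ (Suc (Suc n) + k)) z) \<le> 1" if z: "z \<in> U" for k z
  proof (induction k)
    case 0
    have "(f ^^ Suc n) z \<notin> closure W" using z by (simp add: U_def)
    from V[OF this] show ?case by simp
  next
    case (Suc k)
    have "(f ^^ (Suc (Suc n) + k)) z \<notin> closure W" using Suc clo by auto
    from V[OF this] show ?case by simp
  qed
  have bound': "norm ((f ^^ k) z) \<le> 1" if "k \<ge> Suc (Suc n)" "z \<in> U" for k z
    using bound[OF that(2), of "k - Suc (Suc n)"] that(1) by (simp only: le_add_diff_inverse)
  have "normal_family U (\<lambda>n. f ^^ n)"
    unfolding normal_family_def
  proof (intro allI impI)
    fix r :: "nat \<Rightarrow> nat" assume r: "strict_mono r"
    \<comment> \<open>The iterates are bounded on \<open>U\<close> only from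
      \<open>Suc (Suc n)\<close> on, so the start of the subsequence is dropped.\<close>
    define c where "c i = i + Suc (Suc n)" for i
    define Fam where "Fam = {h :: complex \<Rightarrow> complex. h holomorphic_on U \<and> (\<forall>z\<in>U. norm (h z) \<le> 1)}"
    have rng: "range (\<lambda>i. f ^^ r (c i)) \<subseteq> Fam"
    proof
      fix h assume "h \<in> range (\<lambda>i. f ^^ r (c i))"
      then obtain i where h: "h = f ^^ r (c i)" by blast
      have "Suc (Suc n) \<le> r (c i)" using seq_suble[OF r, of "c i"] by (simp add: c_def)
      then show "h \<in> Fam" unfolding h Fam_def
        using bound' holomorphic_on_subset[OF holomorphic_funpow[OF hol]] by blast
    qed
    have FamH: "h holomorphic_on U" if "h \<in> Fam" for h using that by (simp add: Fam_def)
    have FamB: "\<exists>B. \<forall>h\<in>Fam. \<forall>z\<in>K. norm (h z) \<le> B" if "K \<subseteq> U" for K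
      using that by (intro exI[of _ 1]) (auto simp: Fam_def)
    obtain gl s where s: "strict_mono (s :: nat \<Rightarrow> nat)"
        "\<And>K. compact K \<Longrightarrow> K \<subseteq> U \<Longrightarrow> uniform_limit K ((\<lambda>i. f ^^ r (c i)) \<circ> s) gl sequentially"
      using Montel[OF U FamH FamB rng] by metis
    have "strict_mono (c \<circ> s)" using s(1) by (simp add: strict_mono_def c_def)
    moreover have "\<forall>K. compact K \<and> K \<subseteq> U \<longrightarrow> uniform_limit K (\<lambda>i. f ^^ r ((c \<circ> s) i)) gl sequentially"
      using s(2) by (simp add: o_def)
    ultimately show "\<exists>s::nat \<Rightarrow> nat. strict_mono s \<and>
        ((\<exists>g. \<forall>K. compact K \<and> K \<subseteq> U \<longrightarrow> uniform_limit K (\<lambda>n. f ^^ r (s n)) g sequentially) \<or>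
         (\<forall>K. compact K \<and> K \<subseteq> U \<longrightarrow> (\<forall>B. eventually (\<lambda>n. \<forall>z\<in>K. B \<le> norm ((f ^^ r (s n)) z)) sequentially)))"
      by blast
  qed
  then show False using u U uU unfolding julia_set_entire_def fatou_set_def by blast
qed

context tract_system
begin

text \<open>The identity \<open>(f ^^ Suc n) (exp (Gw w z)) = exp z\<close> is differentiated at
  \<open>x\<close>, where the right side has modulus at least 1; small derivatives of
  \<open>Gw w\<close> become large derivatives of the iterate.\<close>

lemma deriv_iterate_at_Gw:
  assumes hol: "f holomorphic_on UNIV" and w: "w \<in> words (Suc n)" and x: "Re x \<ge> \<delta>"
  shows "\<delta> \<le> norm (deriv (f ^^ Suc n) (exp (Gw w x))) * norm (exp (Gw w x)) * (48 * \<kappa> ^ n)"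
proof -
  define v where "v = exp (Gw w x)"
  have wI: "set w \<subseteq> I" "length w = Suc n" using w by (simp_all add: words_def)
  have x0: "Re x > 0" using x delta_pos by simp
  have "((f ^^ Suc n) has_field_derivative deriv (f ^^ Suc n) v) (at (exp (Gw w x)))"
    unfolding v_def by (rule holomorphic_derivI[OF holomorphic_funpow[OF hol] open_UNIV UNIV_I])
  moreover have "(Gw w has_field_derivative deriv (Gw w) x) (at x)"
    using x0 by (intro holomorphic_derivI[OF Gw_hol[OF wI(1)] open_HP]) simp
  then have "((\<lambda>z. exp (Gw w z)) has_field_derivative v * deriv (Gw w) x) (at x)"
    unfolding v_def by (rule DERIV_fun_exp)
  ultimately have "((\<lambda>z. (f ^^ Suc n) (exp (Gw w z))) has_field_derivative
      deriv (f ^^ Suc n) v * (v * deriv (Gw w) x)) (at x)"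
    by (rule DERIV_chain2)
  then have "(exp has_field_derivative deriv (f ^^ Suc n) v * (v * deriv (Gw w) x)) (at x)"
    by (rule has_field_derivative_transform_within_open[OF _ open_HP[of 0]])
      (use x0 f_Gw[OF wI(1)] wI(2) in auto)
  then have "deriv (f ^^ Suc n) v * (v * deriv (Gw w) x) = exp x"
    by (rule DERIV_unique) (rule DERIV_exp)
  then have "norm (deriv (f ^^ Suc n) v) * norm v * norm (deriv (Gw w) x) = exp (Re x)"
    by (metis mult.assoc norm_mult norm_exp_eq_Re)
  moreover have "exp (Re x) \<ge> 1" using x0 by simp
  ultimately have "1 \<le> norm (deriv (f ^^ Suc n) v) * norm v * norm (deriv (Gw w) x)" by simp
  also have "\<dots> \<le> norm (deriv (f ^^ Suc n) v) * norm v * (48 * \<kappa> ^ n / \<delta>)"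
  proof (rule mult_left_mono)
    have "48 * \<kappa> ^ n / Re x \<le> 48 * \<kappa> ^ n / \<delta>"
      using x x0 delta_pos kappa by (intro divide_left_mono) auto
    then show "norm (deriv (Gw w) x) \<le> 48 * \<kappa> ^ n / \<delta>" using deriv_Gw_bound[OF w x0] by linarith
  qed simp
  finally show ?thesis using delta_pos by (simp add: v_def field_simps)
qed

text \<open>The iterates expand without bound along a bounded subsequence of the orbit, which excludes normality.\<close>
lemma in_julia_set_entire:
  assumes hol: "f holomorphic_on UNIV" and m: "m \<ge> 1"
    and coded: "\<And>n. \<exists>w\<in>words (n * m). \<exists>x. Re x \<ge> \<delta> \<and> norm x \<le> R \<and> u = exp (Gw w x)"
  shows "u \<in> julia_set_entire f"
proof (rule ccontr)
  assume "u \<notin> julia_set_entire f"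
  then obtain U where U: "open U" "u \<in> U" "normal_family U (\<lambda>n. f ^^ n)"
    unfolding julia_set_entire_def fatou_set_def by blast
  define r where "r k = k * m" for k
  have "strict_mono r" using m by (simp add: r_def strict_mono_def)
  then obtain s where s: "strict_mono (s :: nat \<Rightarrow> nat)" and
      lim: "(\<exists>g. \<forall>K. compact K \<and> K \<subseteq> U \<longrightarrow> uniform_limit K (\<lambda>n. f ^^ r (s n)) g sequentially) \<or>
         (\<forall>K. compact K \<and> K \<subseteq> U \<longrightarrow> (\<forall>B. eventually (\<lambda>n. \<forall>z\<in>K. B \<le> norm ((f ^^ r (s n)) z)) sequentially))"
    using U(3) unfolding normal_family_def by blast
  from lim show False
  proof
    assume div: "\<forall>K. compact K \<and> K \<subseteq> U \<longrightarrow> (\<forall>B. eventually (\<lambda>n. \<forall>z\<in>K. B \<le> norm ((f ^^ r (s n)) z)) sequentially)"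
    have "eventually (\<lambda>n. exp R + 1 \<le> norm ((f ^^ r (s n)) u)) sequentially"
      using div[rule_format, of "{u}" "exp R + 1"] U(2) by simp
    then obtain k where k: "exp R + 1 \<le> norm ((f ^^ r (s k)) u)"
      unfolding eventually_sequentially by blast
    obtain w x where w: "w \<in> words (s k * m)" "Re x \<ge> \<delta>" "norm x \<le> R" "u = exp (Gw w x)"
      using coded[of "s k"] by blast
    have "(f ^^ r (s k)) u = exp x"
      using f_Gw[of w x] w delta_pos by (simp add: words_def r_def)
    then have "norm ((f ^^ r (s k)) u) = exp (Re x)" by (simp add: norm_exp_eq_Re)
    also have "\<dots> \<le> exp R" using w(3) complex_Re_le_cmod[of x] by simp
    finally show False using k by simp
  next
    assume "\<exists>g. \<forall>K. compact K \<and> K \<subseteq> U \<longrightarrow> uniform_limit K (\<lambda>n. f ^^ r (s n)) g sequentially"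
    then obtain gl where gl: "\<And>K. compact K \<Longrightarrow> K \<subseteq> U \<Longrightarrow> uniform_limit K (\<lambda>n. f ^^ r (s n)) gl sequentially"
      by blast
    obtain e where e: "e > 0" "cball u e \<subseteq> U" using U(1,2) open_contains_cball by blast
    have "uniform_limit (cball u e) (\<lambda>n. f ^^ r (s n)) gl sequentially" by (rule gl[OF compact_cball e(2)])
    then have "\<forall>\<^sub>F k in sequentially. \<forall>z\<in>cball u e. dist ((f ^^ r (s k)) z) (gl z) < 1"
      unfolding uniform_limit_iff by simp
    then obtain k0 where k0: "\<And>k z. k \<ge> k0 \<Longrightarrow> z \<in> cball u e \<Longrightarrow> dist ((f ^^ r (s k)) z) (gl z) < 1"
      unfolding eventually_sequentially by blast
    \<comment> \<open>The definition of normality asks nothing of the limit function itself, so the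
      bound is taken from the single iterate \<open>r (s k0)\<close>: all later ones are within
      distance 2 of it on the disc.\<close>
    have "compact ((f ^^ r (s k0)) ` cball u e)"
      by (intro compact_continuous_image compact_cball continuous_on_subset[OF holomorphic_on_imp_continuous_on[OF holomorphic_funpow[OF hol]]]) simp
    then obtain B where B: "\<And>z. z \<in> cball u e \<Longrightarrow> norm ((f ^^ r (s k0)) z) \<le> B"
      using compact_imp_bounded bounded_iff by (metis (no_types, lifting) image_eqI)
    have der: "norm (deriv (f ^^ r (s k)) u) \<le> (B + 2) / e" if k: "k \<ge> k0" for k
    proof (rule Cauchy_deriv_bound[OF holomorphic_funpow[OF hol] open_UNIV _ e(1), of _ _ 0])
      fix z assume z: "z \<in> cball u e"
      have "dist ((f ^^ r (s k)) z) ((f ^^ r (s k0)) z) < 2"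
        using k0[OF k z] k0[OF order_refl z] dist_triangle2[of "(f ^^ r (s k)) z" "(f ^^ r (s k0)) z" "gl z"]
        by linarith
      then have "norm ((f ^^ r (s k)) z) \<le> norm ((f ^^ r (s k0)) z) + 2"
        using norm_triangle_sub[of "(f ^^ r (s k)) z" "(f ^^ r (s k0)) z"] by (simp add: dist_norm)
      then show "norm ((f ^^ r (s k)) z - 0) \<le> B + 2" using B[OF z] by simp
    qed simp
    have "\<forall>\<^sub>F k in sequentially. ((B + 2) / e) * norm u * (48 * \<kappa> ^ k) < \<delta>"
      using eventually_power_less[OF kappa delta_pos, of "((B + 2) / e) * norm u * 48"] by (simp only: mult.assoc)
    then obtain k1 where k1: "\<And>k. k \<ge> k1 \<Longrightarrow> ((B + 2) / e) * norm u * (48 * \<kappa> ^ k) < \<delta>"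
      unfolding eventually_sequentially by blast
    define k where "k = Suc (max k0 k1)"
    have "k \<le> s k" by (rule seq_suble[OF s])
    also have "s k \<le> r (s k)" using m by (simp add: r_def)
    finally have rk: "k \<le> r (s k)" .
    then obtain n where n: "r (s k) = Suc n" "n \<ge> k1" by (cases "r (s k)") (auto simp: k_def)
    obtain w x where w: "w \<in> words (s k * m)" "Re x \<ge> \<delta>" "u = exp (Gw w x)"
      using coded[of "s k"] by blast
    then have "\<delta> \<le> norm (deriv (f ^^ Suc n) u) * norm u * (48 * \<kappa> ^ n)"
      using deriv_iterate_at_Gw[OF hol, of w n x] n(1) by (simp add: r_def)
    also have "\<dots> \<le> ((B + 2) / e) * norm u * (48 * \<kappa> ^ n)"
      using der[of k] n(1) kappa by (intro mult_right_mono) (auto simp: k_def)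
    also have "\<dots> < \<delta>" by (rule k1[OF n(2)])
    finally show False by simp
  qed
qed

end

section \<open>Bowen's formula\<close>

lemma liminf_finite_of_frequently_bounded:
  fixes x :: "nat \<Rightarrow> real"
  assumes "\<And>n. \<exists>k\<ge>n. x k \<le> c"
  shows "liminf (\<lambda>n. ereal (x n)) < \<infinity>"
proof (rule ccontr)
  assume "\<not> ?thesis"
  then have "ereal c < liminf (\<lambda>n. ereal (x n))" by (simp add: not_less)
  then have "\<forall>\<^sub>F n in sequentially. ereal c < ereal (x n)" by (rule less_LiminfD)
  then obtain n where n: "\<And>k. k \<ge> n \<Longrightarrow> c < x k" unfolding eventually_sequentially by auto
  obtain k where "k \<ge> n" "x k \<le> c" using assms by blast
  then show False using n[of k] by simp
qed

context tract_system
begin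

text \<open>\<open>J\<close> is sandwiched between the points with orbit in \<open>W\<close> and those that are coded by inverse branches
  along a bounded subsequence of the orbit; this covers models and entire functions at once.\<close>
lemma hausdorff_dim_radial_eq:
  assumes h: "h > 0" and t: "0 < t" "t < h"
    and Dom: "\<And>z. Re z > 0 \<Longrightarrow> {v \<in> Dom. f v = exp z} = {v \<in> W. f v = exp z}"
    and B: "\<And>j. j < N \<Longrightarrow> \<exists>B. \<forall>F. finite F \<longrightarrow> (\<Sum>k\<in>F. norm (deriv (g j) (Complex 1 (2 * pi * of_int k))) powr t) \<le> B"
    and J_sub: "\<And>u n. u \<in> J \<Longrightarrow> (f ^^ n) u \<in> W"
    and J_sup: "\<And>u m R. m \<ge> 1 \<Longrightarrow> (\<And>n. (f ^^ n) u \<in> W) \<Longrightarrow>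
      (\<And>n. \<exists>w\<in>words (n * m). \<exists>x. Re x \<ge> \<delta> \<and> norm x \<le> R \<and> u = exp (Gw w x)) \<Longrightarrow> u \<in> J"
    and v: "v \<in> J" "pressure_zero_at f Dom h v"
  shows "hausdorff_dim {z \<in> J. liminf (\<lambda>n. ereal (norm ((f ^^ n) z))) < \<infinity>} = h"
proof (rule hausdorff_dim_eqI[OF h])
  define z0 where "z0 = Ln v"
  have vW: "v \<in> W" using J_sub[OF v(1), of 0] by simp
  have z0: "exp z0 = v" "Re z0 \<ge> \<delta>" "Re z0 > 0" using W_Ln[OF vW] delta_pos by (simp_all add: z0_def)
  have S_eq: "(transfer_op f Dom h ^^ n) (\<lambda>_. 1) v = S h n (\<lambda>_. 1) z0" for n
  proof -
    have "(transfer_op f Dom h ^^ n) (\<lambda>_. 1) (exp z0) = S h n (\<lambda>x. (\<lambda>_. 1) (exp x)) z0"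
      by (rule transfer_op_power_exp) (fact Dom, fact z0(3))
    then show ?thesis by (simp only: z0(1))
  qed
  have sub: "subexponential h z0"
    using v(2) unfolding pressure_zero_at_def subexponential_def S_eq .
  show "hausdorff_measure s {z \<in> J. liminf (\<lambda>n. ereal (norm ((f ^^ n) z))) < \<infinity>} = 0" if s: "s > h" for s
  proof (rule hausdorff_measure_0_mono)
    show "hausdorff_measure s {u. (\<forall>n. (f ^^ n) u \<in> W) \<and> liminf (\<lambda>n. ereal (norm ((f ^^ n) u))) < \<infinity>} = 0"
      by (rule hausdorff_measure_upper[OF h s z0(3) sub])
    show "{z \<in> J. liminf (\<lambda>n. ereal (norm ((f ^^ n) z))) < \<infinity>}
        \<subseteq> {u. (\<forall>n. (f ^^ n) u \<in> W) \<and> liminf (\<lambda>n. ereal (norm ((f ^^ n) u))) < \<infinity>}"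
      using J_sub by blast
  qed
  show "hausdorff_measure s {z \<in> J. liminf (\<lambda>n. ereal (norm ((f ^^ n) z))) < \<infinity>} \<noteq> 0"
    if s: "0 < s" "s < h" for s
  proof
    have "\<exists>B. \<forall>z. Re z \<ge> \<delta> \<longrightarrow> L h (\<lambda>_. 1) z \<le> ennreal B"
      by (rule L_bounded_and_small(1)[OF t]) (fact B)
    then obtain B where B': "\<And>z. Re z \<ge> \<delta> \<Longrightarrow> L h (\<lambda>_. 1) z \<le> ennreal B" by blast
    have "\<exists>\<rho>. \<forall>z. Re z \<ge> \<rho> \<longrightarrow> L h (\<lambda>_. 1) z \<le> ennreal (1/2)"
      by (rule L_bounded_and_small(2)[OF t]) (fact B)
    then obtain \<rho> where \<rho>: "\<And>z. Re z \<ge> \<rho> \<Longrightarrow> L h (\<lambda>_. 1) z \<le> ennreal (1/2)" by blast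
    have "\<exists>X m R. m \<ge> 1 \<and> hausdorff_measure s X \<noteq> 0 \<and>
        (\<forall>u\<in>X. \<forall>n. \<exists>w\<in>words (n * m). \<exists>x. Re x \<ge> \<delta> \<and> norm x \<le> R \<and> u = exp (Gw w x))"
      by (rule hausdorff_measure_lower[OF s z0(2) sub]) (fact B', fact \<rho>)
    then obtain X m R where X: "m \<ge> 1" "hausdorff_measure s X \<noteq> 0"
      and coded: "\<And>u n. u \<in> X \<Longrightarrow> \<exists>w\<in>words (n * m). \<exists>x. Re x \<ge> \<delta> \<and> norm x \<le> R \<and> u = exp (Gw w x)"
      by blast
    have "X \<subseteq> {z \<in> J. liminf (\<lambda>n. ereal (norm ((f ^^ n) z))) < \<infinity>}"
    proof
      fix u assume u: "u \<in> X"
      have orb: "(f ^^ n) u \<in> W" for n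
      proof -
        \<comment> \<open>A word controls only times below its length, so time \<open>n\<close> is
          read off from the code of length \<open>Suc n * m\<close>.\<close>
        obtain w x where w: "w \<in> words (Suc n * m)" "Re x \<ge> \<delta>" "u = exp (Gw w x)" using coded[OF u, of "Suc n"] by blast
        have "n < Suc n * m" using X(1) by (cases m) auto
        then show ?thesis using Gw_orbit_W[of w x n] w delta_pos by (simp add: words_def)
      qed
      have "\<exists>k\<ge>n. norm ((f ^^ k) u) \<le> exp R" for n
      proof -
        obtain w x where w: "w \<in> words (n * m)" "Re x \<ge> \<delta>" "norm x \<le> R" "u = exp (Gw w x)" using coded[OF u] by blast
        have "(f ^^ (n * m)) u = exp x" using f_Gw[of w x] w delta_pos by (simp add: words_def)
        then have "norm ((f ^^ (n * m)) u) \<le> exp R"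
          using w(3) complex_Re_le_cmod[of x] by (simp add: norm_exp_eq_Re)
        then show ?thesis using X(1) by (intro exI[of _ "n * m"]) simp
      qed
      then have "liminf (\<lambda>n. ereal (norm ((f ^^ n) u))) < \<infinity>" by (rule liminf_finite_of_frequently_bounded)
      moreover have "u \<in> J" by (rule J_sup[OF X(1)]) (fact orb, fact coded[OF u])
      ultimately show "u \<in> {z \<in> J. liminf (\<lambda>n. ereal (norm ((f ^^ n) z))) < \<infinity>}" by blast
    qed
    moreover assume "hausdorff_measure s {z \<in> J. liminf (\<lambda>n. ereal (norm ((f ^^ n) z))) < \<infinity>} = 0"
    ultimately show False using X(2) hausdorff_measure_0_mono by blast
  qed
qed

end

text \<open>The common ground of both cases. For entire functions, openness and disjointness hold
  because the tracts are components of an open set, and distinct indices give distinct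
  components.\<close>

lemma classD_tracts:
  assumes "classD model f N \<Omega> \<tau>"
  shows "N \<ge> 1" "\<And>j. j < N \<Longrightarrow> open (\<Omega> j)"
    "\<And>i j. i < N \<Longrightarrow> j < N \<Longrightarrow> i \<noteq> j \<Longrightarrow> \<Omega> i \<inter> \<Omega> j = {}"
    "\<And>j. j < N \<Longrightarrow> conformal_onto_H (\<tau> j) (\<Omega> j)"
    "\<And>j z. j < N \<Longrightarrow> z \<in> \<Omega> j \<Longrightarrow> f z = exp (\<tau> j z)"
    "closure (\<Union>j<N. \<Omega> j) \<inter> cball 0 1 = {}"
    "\<And>j. j < N \<Longrightarrow> bounded_distortion (phi \<Omega> \<tau> j)"
proof -
  have "N \<ge> 1 \<and> (\<forall>j<N. open (\<Omega> j)) \<and> (\<forall>i<N. \<forall>j<N. i \<noteq> j \<longrightarrow> \<Omega> i \<inter> \<Omega> j = {}) \<and>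
    (\<forall>j<N. conformal_onto_H (\<tau> j) (\<Omega> j) \<and> (\<forall>z\<in>\<Omega> j. f z = exp (\<tau> j z))) \<and>
    closure (\<Union>j<N. \<Omega> j) \<inter> cball 0 1 = {} \<and> (\<forall>j<N. bounded_distortion (phi \<Omega> \<tau> j))"
  proof (cases model)
    case True
    then have "model_classD f N \<Omega> \<tau>" using assms by (simp add: classD_def)
    then show ?thesis unfolding model_classD_def by blast
  next
    case False
    then have e: "entire_classD f N \<Omega> \<tau>" using assms by (simp add: classD_def)
    then have comp: "components (f -` outer_disc) = \<Omega> ` {..<N}" and inj: "inj_on \<Omega> {..<N}"
      and hol: "f holomorphic_on UNIV"
      by (simp_all add: entire_classD_def)
    have "open outer_disc" unfolding outer_disc_def by (intro open_Collect_less continuous_intros)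
    then have op: "open (f -` outer_disc)"
      using holomorphic_on_imp_continuous_on[OF hol] by (intro open_vimage)
    have mem: "\<Omega> j \<in> components (f -` outer_disc)" if "j < N" for j using that comp by blast
    have "open (\<Omega> j)" if "j < N" for j by (rule open_components[OF op mem[OF that]])
    moreover have "\<Omega> i \<inter> \<Omega> j = {}" if "i < N" "j < N" "i \<noteq> j" for i j
    proof -
      have "\<Omega> i \<noteq> \<Omega> j" using inj_onD[OF inj, of i j] that by auto
      then show ?thesis using components_nonoverlap[OF mem[OF that(1)] mem[OF that(2)]] by blast
    qed
    ultimately have "\<forall>j<N. open (\<Omega> j)" "\<forall>i<N. \<forall>j<N. i \<noteq> j \<longrightarrow> \<Omega> i \<inter> \<Omega> j = {}" by simp_all
    then show ?thesis using e unfolding entire_classD_def by (elim conjE) (intro conjI)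
  qed
  then show "N \<ge> 1" "\<And>j. j < N \<Longrightarrow> open (\<Omega> j)"
    "\<And>i j. i < N \<Longrightarrow> j < N \<Longrightarrow> i \<noteq> j \<Longrightarrow> \<Omega> i \<inter> \<Omega> j = {}"
    "\<And>j. j < N \<Longrightarrow> conformal_onto_H (\<tau> j) (\<Omega> j)"
    "\<And>j z. j < N \<Longrightarrow> z \<in> \<Omega> j \<Longrightarrow> f z = exp (\<tau> j z)"
    "closure (\<Union>j<N. \<Omega> j) \<inter> cball 0 1 = {}"
    "\<And>j. j < N \<Longrightarrow> bounded_distortion (phi \<Omega> \<tau> j)"
    by blast+
qed

text \<open>Positivity of \<open>Theta\<close> requires that the \<open>THE\<close> in
  \<open>smallest_pos_zero\<close> denotes an actual zero: existence is part of
  \<open>negative_spectrum\<close>, uniqueness follows from minimality.\<close>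

lemma negative_spectrum_beyond_Theta:
  assumes neg: "negative_spectrum N \<Omega> \<tau>" and N: "N \<ge> 1" and t: "t > Theta N \<Omega> \<tau>"
  shows "t > 0" "\<And>j. j < N \<Longrightarrow> b_inf \<Omega> \<tau> j t < 0"
proof -
  have "is_smallest_pos_zero (b_inf \<Omega> \<tau> 0) (smallest_pos_zero (b_inf \<Omega> \<tau> 0))"
  proof -
    obtain a where a: "is_smallest_pos_zero (b_inf \<Omega> \<tau> 0) a"
      using neg N unfolding negative_spectrum_def by auto
    have "x = a" if "is_smallest_pos_zero (b_inf \<Omega> \<tau> 0) x" for x
      using a that unfolding is_smallest_pos_zero_def by (meson linorder_neqE_linordered_idom)
    then show ?thesis unfolding smallest_pos_zero_def using a by (rule theI[rotated])
  qed
  then have "0 < smallest_pos_zero (b_inf \<Omega> \<tau> 0)" by (simp add: is_smallest_pos_zero_def)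
  also have "\<dots> \<le> Theta N \<Omega> \<tau>" unfolding Theta_def using N by (intro Max_ge) auto
  finally show "t > 0" using t by simp
  fix j assume j: "j < N"
  have "Max ((\<lambda>j. b_inf \<Omega> \<tau> j t) ` {..<N}) < 0" using neg t unfolding negative_spectrum_def by blast
  moreover have "b_inf \<Omega> \<tau> j t \<le> Max ((\<lambda>j. b_inf \<Omega> \<tau> j t) ` {..<N})" using j by (intro Max_ge) auto
  ultimately show "b_inf \<Omega> \<tau> j t < 0" by (rule le_less_trans[rotated])
qed

theorem theorem1p5:
  fixes model :: bool and f :: "complex \<Rightarrow> complex" and N :: nat
    and \<Omega> :: "nat \<Rightarrow> complex set" and \<tau> :: "nat \<Rightarrow> complex \<Rightarrow> complex" and h :: real
  assumes "classD model f N \<Omega> \<tau>"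
    and "negative_spectrum N \<Omega> \<tau>"
    and "h > Theta N \<Omega> \<tau>"
    and "\<exists>w\<in>julia_set model f N \<Omega>. pressure_zero_at f (domain_of model N \<Omega>) h w"
  shows "hyp_dim model f N \<Omega> = h"
proof -
  note D = classD_tracts[OF assms(1)]
  define W where "W = (\<Union>j<N. \<Omega> j)"
  have "\<exists>g \<delta>. tract_system f N W g \<delta> \<and> (\<forall>j<N. \<forall>z. Re z > 0 \<longrightarrow> exp (g j z) = phi \<Omega> \<tau> j z)"
    unfolding W_def
    by (rule tract_system_of_tracts) (fact D(1), fact D(2), fact D(3), fact D(4), fact D(5), fact D(6))
  then obtain g \<delta> where "tract_system f N W g \<delta>" and
    g: "\<And>j z. j < N \<Longrightarrow> Re z > 0 \<Longrightarrow> exp (g j z) = phi \<Omega> \<tau> j z"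
    by blast
  interpret tract_system f N W g \<delta> by fact
  \<comment> \<open>Strictly above \<open>Theta\<close>, so that the spectrum is negative at
    \<open>t\<close>, and strictly below \<open>h\<close>, so that the decay exponent
    \<open>h - t\<close> is positive.\<close>
  define t where "t = (Theta N \<Omega> \<tau> + h) / 2"
  have t: "Theta N \<Omega> \<tau> < t" "t < h" using assms(3) by (simp_all add: t_def)
  note neg = negative_spectrum_beyond_Theta[OF assms(2) D(1) t(1)]
  have B: "\<exists>B. \<forall>F. finite F \<longrightarrow> (\<Sum>k\<in>F. norm (deriv (g j) (Complex 1 (2 * pi * of_int k))) powr t) \<le> B"
    if j: "j < N" for j
  proof -
    have "G (j, 0) = g j" by (rule ext) (simp add: G_def)
    then have inj: "inj_on (g j) (HP 0)" using G_inj[of "(j, 0)"] j by (simp add: I_def)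
    have "\<exists>\<epsilon>>0. \<exists>C T0. \<forall>T\<ge>T0. integral Iset (\<lambda>y. norm (deriv (g j) (Complex 1 (T * y))) powr t) \<le> C * T powr (- 1 - \<epsilon>)"
      by (rule integral_means_decay[OF g_hol[OF j] _ D(7)[OF j] neg(1) neg(2)[OF j]]) (fact g[OF j])
    then obtain \<epsilon> C T0 where "\<epsilon> > 0"
        "\<And>T. T \<ge> T0 \<Longrightarrow> integral Iset (\<lambda>y. norm (deriv (g j) (Complex 1 (T * y))) powr t) \<le> C * T powr (- 1 - \<epsilon>)"
      by blast
    then show ?thesis by (rule boundary_sum_bounded[OF g_hol[OF j] inj neg(1)])
  qed
  have outer: "norm (exp z) > 1" if "Re z > 0" for z using that by (simp add: norm_exp_eq_Re)
  have entire: "f holomorphic_on UNIV \<and> (\<forall>z. norm (f z) > 1 \<longrightarrow> z \<in> W)" if "\<not> model"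
  proof -
    have e: "f holomorphic_on UNIV" "components (f -` outer_disc) = \<Omega> ` {..<N}"
      using assms(1) that by (simp_all add: classD_def entire_classD_def)
    \<comment> \<open>The tracts are all the components of the preimage, so every preimage of a
      point of the outer disc lies in \<open>W\<close>; this matches the domain \<open>UNIV\<close>
      with \<open>W\<close> in the transfer operator.\<close>
    have "f -` outer_disc = W" using Union_components[of "f -` outer_disc"] e(2) by (simp add: W_def)
    then show ?thesis using e(1) by (auto simp: outer_disc_def)
  qed
  obtain v where v: "v \<in> julia_set model f N \<Omega>" "pressure_zero_at f (domain_of model N \<Omega>) h v"
    using assms(4) by blast
  have "hausdorff_dim {z \<in> julia_set model f N \<Omega>. liminf (\<lambda>n. ereal (norm ((f ^^ n) z))) < \<infinity>} = h"
  proof (rule hausdorff_dim_radial_eq[where t = t and Dom = "domain_of model N \<Omega>" and v = v])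
    show "0 < t" "t < h" by (fact neg(1), fact t(2))
    show "\<exists>B. \<forall>F. finite F \<longrightarrow> (\<Sum>k\<in>F. norm (deriv (g j) (Complex 1 (2 * pi * of_int k))) powr t) \<le> B"
      if "j < N" for j by (rule B[OF that])
    show "v \<in> julia_set model f N \<Omega>" "pressure_zero_at f (domain_of model N \<Omega>) h v" by (fact v)+
    show "h > 0" using neg(1) t(2) by simp
    show "{v \<in> domain_of model N \<Omega>. f v = exp z} = {v \<in> W. f v = exp z}" if z: "Re z > 0" for z
    proof (cases model)
      case True
      then show ?thesis by (simp add: domain_of_def W_def)
    next
      case False
      then show ?thesis using entire[OF False] outer[OF z] by (auto simp: domain_of_def)
    qed
    show "(f ^^ n) u \<in> W" if u: "u \<in> julia_set model f N \<Omega>" for u n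
    proof (cases model)
      case True
      then show ?thesis using u by (simp add: julia_set_def julia_set_model_def W_def)
    next
      case False
      then have "u \<in> julia_set_entire f" using u by (simp add: julia_set_def)
      then show ?thesis
        using julia_set_entire_subset[of f W u n] entire[OF False] D(6) unfolding W_def by blast
    qed
    show "u \<in> julia_set model f N \<Omega>" if m: "m \<ge> 1" and orb: "\<And>n. (f ^^ n) u \<in> W"
      and coded: "\<And>n. \<exists>w\<in>words (n * m). \<exists>x. Re x \<ge> \<delta> \<and> norm x \<le> R \<and> u = exp (Gw w x)" for u m R
    proof (cases model)
      case True
      then show ?thesis using orb by (simp add: julia_set_def julia_set_model_def W_def)
    next
      case False
      then have "f holomorphic_on UNIV" using entire by blast
      then have "u \<in> julia_set_entire f" using m coded by (rule in_julia_set_entire)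
      then show ?thesis using False by (simp add: julia_set_def)
    qed
  qed
  then show ?thesis by (simp add: hyp_dim_def)
qed

end
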